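(* Let $R$ be a commutative Noetherian ring with unit, let $S$ be a finite set of ideals of $R$, and let $g\ge 0$ be an integer. Let $\mathcal{G}_{g,S}$ be the category of edge-labeled graphs of genus $g$ with labels in $S$, with contractions as morphisms. If $M$ is a finitely generated $\mathcal{G}_{g,S}^{\mathrm{op}}$-module over $R$, then every submodule of $M$ is also finitely generated.
   Context: A graph $G$ consists of a finite vertex set $V_G$, a finite edge set $E_G$, and a boundary map $\partial$ sending each edge to its endpoints (an unordered pair of distinct vertices, or a single vertex if the edge is a loop) and each vertex to itself; multiple edges and loops are allowed. All graphs are connected. The (combinatorial) genus is $g=|E_G|-|V_G|+1$. An edge-labeled graph is a pair $(G,\alpha)$ with $\alpha\colon E_G\to S$ a map. A contraction $(G,\alpha)\to(G',\alpha')$ is a map $\varphi\colon V_G\sqcup E_G\to V_{G'}\sqcup E_{G'}$ such that: (1) $\varphi(V_G)=V_{G'}$; (2) $\varphi(\partial(e))=\partial(\varphi(e))$ for all $e\in E_G$ (where a pair of endpoints with the same image is identified with that single vertex); (3) $\varphi$ restricts to a bijection $\varphi^{-1}(E_{G'})\to E_{G'}$, and $\alpha'(\varphi(e))=\alpha(e)$ for all $e\in\varphi^{-1}(E_{G'})$; (4) for every $v\in V_{G'}$, the preimage $\varphi^{-1}(v)$ is a subtree of $G$. Graph automorphisms preserving labels are contractions. A $\mathcal{G}_{g,S}^{\mathrm{op}}$-module over $R$ is a covariant functor $M$ from $\mathcal{G}_{g,S}^{\mathrm{op}}$ to the category of finitely generated $R$-modules; so a contraction $\varphi\colon(G,\alpha)\to(G',\alpha')$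 induces $\varphi^*\colon M(G',\alpha')\to M(G,\alpha)$. $M$ is finitely generated if there is a finite list of objects $(G_i,\alpha_i)$ such that for every object $(G,\alpha)$, the $R$-module $M(G,\alpha)$ is spanned by the images of the modules $M(G_i,\alpha_i)$ under the maps $\varphi^*$ induced by all contractions $\varphi\colon(G,\alpha)\to(G_i,\alpha_i)$. A submodule $N$ of $M$ is a collection of $R$-submodules $N(G,\alpha)\subseteq M(G,\alpha)$ preserved by all the induced maps $\varphi^*$. *)

theory Defs
  imports "HOL-Algebra.Module" "HOL-Algebra.Ring_Divisibility"
begin

section \<open>Graphs\<close>

text \<open>
  Finite undirected multigraphs: an edge has as its set of endpoints either two distinct
  vertices or, if it is a loop, a single vertex.  Functions on a carrier set are required
  to be extensional (via \<open>\<rightarrow>\<^sub>E\<close>), so that equality of graphs and of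
  morphisms is equality of the mathematical data.
\<close>

record ('v, 'e) multigraph =
  verts :: "'v set"
  edges :: "'e set"
  ends :: "'e \<Rightarrow> 'v set"

record ('v, 'e, 'l) labeled_graph = "('v, 'e) multigraph" +
  label :: "'e \<Rightarrow> 'l"

definition finite_graph :: "('v, 'e, 'z) multigraph_scheme \<Rightarrow> bool" where
  "finite_graph G \<longleftrightarrow> finite (verts G) \<and> finite (edges G) \<and>
     ends G \<in> edges G \<rightarrow>\<^sub>E {B. B \<subseteq> verts G \<and> (card B = 1 \<or> card B = 2)}"

definition adjacency :: "('v, 'e, 'z) multigraph_scheme \<Rightarrow> 'v rel" where
  "adjacency G = {(u, v). \<exists>e\<in>edges G. ends G e = {u, v}}"

text \<open>The empty graph does not count as connected.\<close>

definition connected_graph :: "('v, 'e, 'z) multigraph_scheme \<Rightarrow> bool" where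
  "connected_graph G \<longleftrightarrow> finite_graph G \<and> verts G \<noteq> {} \<and>
     (\<forall>u\<in>verts G. \<forall>v\<in>verts G. (u, v) \<in> (adjacency G)\<^sup>*)"

definition genus :: "('v, 'e, 'z) multigraph_scheme \<Rightarrow> int" where
  "genus G = int (card (edges G)) - int (card (verts G)) + 1"

text \<open>A loop is a cycle of length 1, a pair of parallel edges is a cycle of length 2.\<close>

definition cycle_in :: "('v, 'e, 'z) multigraph_scheme \<Rightarrow> 'v list \<Rightarrow> 'e list \<Rightarrow> bool" where
  "cycle_in G vs es \<longleftrightarrow> vs \<noteq> [] \<and> length es = length vs \<and>
     distinct vs \<and> distinct es \<and> set vs \<subseteq> verts G \<and> set es \<subseteq> edges G \<and>
     (\<forall>i<length vs. ends G (es ! i) = {vs ! i, vs ! (Suc i mod length vs)})"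

definition tree :: "('v, 'e, 'z) multigraph_scheme \<Rightarrow> bool" where
  "tree G \<longleftrightarrow> connected_graph G \<and> \<not> (\<exists>vs es. cycle_in G vs es)"

text \<open>The disjoint union of vertices and edges; vertices are tagged \<open>Inl\<close>, edges \<open>Inr\<close>.\<close>

definition cells :: "('v, 'e, 'z) multigraph_scheme \<Rightarrow> ('v + 'e) set" where
  "cells G = Inl ` verts G \<union> Inr ` edges G"

fun bdry :: "('v, 'e, 'z) multigraph_scheme \<Rightarrow> 'v + 'e \<Rightarrow> ('v + 'e) set" where
  "bdry G (Inl v) = {Inl v}"
| "bdry G (Inr e) = Inl ` ends G e"

text \<open>\<open>cells_subtree G C\<close>: the set \<open>C\<close> of cells of \<open>G\<close> is a subgraph of \<open>G\<close> and a tree.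
  That \<open>C\<close> contains the endpoints of its edges is part of \<^const>\<open>finite_graph\<close>.\<close>

definition cells_subtree :: "('v, 'e, 'z) multigraph_scheme \<Rightarrow> ('v + 'e) set \<Rightarrow> bool" where
  "cells_subtree G C \<longleftrightarrow> C \<subseteq> cells G \<and>
     tree \<lparr>verts = Inl -` C, edges = Inr -` C, ends = restrict (ends G) (Inr -` C)\<rparr>"


section \<open>The category of edge-labeled graphs and contractions\<close>

text \<open>
  A HOL type variable cannot range over all sets, so vertices and edges are drawn from types
  \<open>'v\<close> and \<open>'e\<close> that are arbitrary.  If both are infinite, every finite graph is isomorphic
  to one of this form, and the category below is the whole category up to equivalence.
\<close>

definition graph_obj :: "nat \<Rightarrow> 'l set \<Rightarrow> ('v, 'e, 'l) labeled_graph set" where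
  "graph_obj g S = {G. connected_graph G \<and> genus G = int g \<and> label G \<in> edges G \<rightarrow>\<^sub>E S}"

definition contractions ::
  "('v, 'e, 'l) labeled_graph \<Rightarrow> ('v, 'e, 'l) labeled_graph \<Rightarrow> ('v + 'e \<Rightarrow> 'v + 'e) set" where
  "contractions G G' = {\<phi> \<in> cells G \<rightarrow>\<^sub>E cells G'.
     \<phi> ` Inl ` verts G = Inl ` verts G' \<and>
     (\<forall>e\<in>edges G. \<phi> ` bdry G (Inr e) = bdry G' (\<phi> (Inr e))) \<and>
     bij_betw \<phi> {c \<in> cells G. \<phi> c \<in> Inr ` edges G'} (Inr ` edges G') \<and>
     (\<forall>e\<in>edges G. \<forall>e'\<in>edges G'. \<phi> (Inr e) = Inr e' \<longrightarrow> label G' e' = label G e) \<and>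
     (\<forall>v\<in>verts G'. cells_subtree G {c \<in> cells G. \<phi> c = Inl v})}"


section \<open>Modules\<close>

definition module_span :: "('r, 'x) ring_scheme \<Rightarrow> ('r, 'm) module \<Rightarrow> 'm set \<Rightarrow> 'm set" where
  "module_span R M A = \<Inter> {H. submodule H R M \<and> A \<subseteq> H}"

definition fg_module :: "('r, 'x) ring_scheme \<Rightarrow> ('r, 'm) module \<Rightarrow> bool" where
  "fg_module R M \<longleftrightarrow> module R M \<and>
     (\<exists>A \<subseteq> carrier M. finite A \<and> module_span R M A = carrier M)"

definition linear_maps ::
  "('r, 'x) ring_scheme \<Rightarrow> ('r, 'm) module \<Rightarrow> ('r, 'm) module \<Rightarrow> ('m \<Rightarrow> 'm) set" where
  "linear_maps R M N = {f \<in> hom (add_monoid M) (add_monoid N).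
     \<forall>a\<in>carrier R. \<forall>x\<in>carrier M. f (a \<odot>\<^bsub>M\<^esub> x) = a \<odot>\<^bsub>N\<^esub> f x}"

text \<open>
  A contravariant functor on the category of graphs: \<open>M\<close> is its action on objects, and
  \<open>P G G' \<phi>\<close> is the map from \<open>M G'\<close> to \<open>M G\<close> induced by a contraction \<open>\<phi>\<close> from \<open>G\<close> to \<open>G'\<close>.
\<close>

locale graph_op_module =
  fixes R :: "('r, 'x) ring_scheme"
    and S :: "'l set"
    and g :: nat
    and M :: "('v, 'e, 'l) labeled_graph \<Rightarrow> ('r, 'm) module"
    and P :: "('v, 'e, 'l) labeled_graph \<Rightarrow> ('v, 'e, 'l) labeled_graph \<Rightarrow>
                ('v + 'e \<Rightarrow> 'v + 'e) \<Rightarrow> 'm \<Rightarrow> 'm"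
  assumes fg_module_obj: "G \<in> graph_obj g S \<Longrightarrow> fg_module R (M G)"
    and pullback_linear:
      "\<lbrakk>G \<in> graph_obj g S; G' \<in> graph_obj g S; \<phi> \<in> contractions G G'\<rbrakk> \<Longrightarrow>
         P G G' \<phi> \<in> linear_maps R (M G') (M G)"
    and pullback_id:
      "\<lbrakk>G \<in> graph_obj g S; x \<in> carrier (M G)\<rbrakk> \<Longrightarrow> P G G (\<lambda>c\<in>cells G. c) x = x"
    and pullback_comp:
      "\<lbrakk>G \<in> graph_obj g S; G' \<in> graph_obj g S; G'' \<in> graph_obj g S;
        \<phi> \<in> contractions G G'; \<psi> \<in> contractions G' G''; x \<in> carrier (M G'')\<rbrakk> \<Longrightarrow>
         P G G'' (compose (cells G) \<psi> \<phi>) x = P G G' \<phi> (P G' G'' \<psi> x)"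

locale fg_graph_op_module = graph_op_module +
  assumes finitely_generated:
    "\<exists>\<G> \<subseteq> graph_obj g S. finite \<G> \<and> (\<forall>G \<in> graph_obj g S.
       module_span R (M G) (\<Union>H\<in>\<G>. \<Union>\<phi>\<in>contractions G H. P G H \<phi> ` carrier (M H))
         = carrier (M G))"

locale graph_op_submodule = graph_op_module +
  fixes N :: "('v, 'e, 'l) labeled_graph \<Rightarrow> 'm set"
  assumes submodule_obj: "G \<in> graph_obj g S \<Longrightarrow> submodule (N G) R (M G)"
    and pullback_closed:
      "\<lbrakk>G \<in> graph_obj g S; G' \<in> graph_obj g S; \<phi> \<in> contractions G G'; x \<in> N G'\<rbrakk> \<Longrightarrow>
         P G G' \<phi> x \<in> N G"

end

theory Submission
  imports Defs "HOL-Library.Ramsey" "HOL-Library.Sublist" "HOL-Library.List_Lexorder"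
begin

text \<open>
  A Groebner basis argument.  Choose in every graph a rooted spanning tree and an order of its
  edges, tree edges in preorder first.  Let \<open>M\<close> be generated by \<open>m\<^sub>i \<in> M(H\<^sub>i)\<close>; the
  monomials of a graph \<open>G\<close> are the contractions \<open>\<phi>\<close> from \<open>G\<close> to some \<open>H\<^sub>i\<close>.  Such a \<open>\<phi>\<close> is
  recorded by finitely many labels on the nodes of the spanning tree of \<open>G\<close>.  By Kruskal's
  tree theorem, in every sequence of monomials some spanning tree embeds into a later one with
  equal labels, and the embedding gives a contraction \<open>\<psi>\<close> between the graphs, along tree edges
  only, through which the later monomial factors.  The spanning tree need not contain the edges
  that \<open>\<phi>\<close> contracts: \<open>\<psi>\<close> contracts only tree edges that \<open>\<phi>\<close> contracts as well.

  Compare monomials lexicographically by the positions of the edges of \<open>G\<close> that lie over the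
  edges of \<open>H\<^sub>i\<close>.  As \<open>\<psi>\<close> preserves the orders of edges, composition with \<open>\<psi>\<close> preserves the
  order of monomials, so the ideals of leading coefficients of \<open>N\<close> can only grow along \<open>\<psi>\<close>.
  By the ascending chain condition in \<open>R\<close>, finitely many monomials determine all these ideals,
  and the graphs carrying them generate \<open>N\<close>.
\<close>

section \<open>Almost full relations\<close>

text \<open>Spanning trees chosen in different graphs are unrelated, and a contraction need not
  respect them or the edge orders; so monotonicity is claimed only for the particular
  \<open>\<psi>\<close> that a tree embedding yields. Its fibres must be subtrees, which is awkward
  to check and to compose. Between graphs of equal genus it suffices that the fibres are connected,
  as their genera are nonnegative and add up to zero. The node labels must come from one finite set
  although the graphs are unbounded. This works because exactly \<open>g\<close> edges lie outside a
  spanning tree, \<open>S\<close> is finite and there are finitely many targets \<open>H i\<close>;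
  the incidences of these \<open>g\<close> edges are distributed over the node labels. Finally, a
  monomial is not determined by the edges over those of its target: a target with two vertices may
  have a symmetry that exchanges them and fixes every edge. Hence the order also compares the image
  of the root, from which the values at the other vertices follow.\<close>

definition good :: "('a \<Rightarrow> 'a \<Rightarrow> bool) \<Rightarrow> (nat \<Rightarrow> 'a) \<Rightarrow> bool" where
  "good P f \<longleftrightarrow> (\<exists>i j. i < j \<and> P (f i) (f j))"

text \<open>Transitivity is not built in, so none has to be proved for \<open>tree_emb\<close> or
  \<open>factors\<close>; arguments that would rest on it go through Ramsey's theorem
  instead.\<close>

definition almost_full_on :: "('a \<Rightarrow> 'a \<Rightarrow> bool) \<Rightarrow> 'a set \<Rightarrow> bool" where
  "almost_full_on P A \<longleftrightarrow> (\<forall>f. (\<forall>i. f i \<in> A) \<longrightarrow> good P f)"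

lemma almost_full_onD:
  fixes f :: "nat \<Rightarrow> 'a"
  assumes "almost_full_on P A" and "\<And>i. f i \<in> A"
  shows "\<exists>i j. i < j \<and> P (f i) (f j)"
  using assms by (simp add: almost_full_on_def good_def)

text \<open>Ramsey's theorem for pairs of indices, coloured by whether \<open>P\<close> holds from
  the earlier entry to the later one. A homogeneous set on which \<open>P\<close> always fails would
  give a sequence without a good pair.\<close>

lemma almost_full_on_subseq:
  assumes af: "almost_full_on P A" and f: "\<And>i. f i \<in> A"
  obtains h :: "nat \<Rightarrow> nat" where "strict_mono h" and "\<And>i j. i < j \<Longrightarrow> P (f (h i)) (f (h j))"
proof -
  \<comment> \<open>\<open>Ramsey2\<close> colours two-element sets; \<open>Min\<close> and
    \<open>Max\<close> restore the order of the two indices. Colour 0 means that \<open>P\<close>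
    holds.\<close>
  define c where "c X = (if P (f (Min X)) (f (Max X)) then 0 else (1::nat))" for X
  obtain Y t where Y: "infinite Y" and t: "\<forall>x\<in>Y. \<forall>y\<in>Y. x \<noteq> y \<longrightarrow> c {x, y} = t"
  proof -
    have "\<forall>x\<in>UNIV. \<forall>y\<in>UNIV. x \<noteq> y \<longrightarrow> c {x, y} < 2" by (simp add: c_def)
    from Ramsey2[OF infinite_UNIV_nat this] show thesis using that by blast
  qed
  have col: "P (f x) (f y) \<longleftrightarrow> t = 0" if "x \<in> Y" "y \<in> Y" "x < y" for x y
  proof -
    have "c {x, y} = t" using t that by auto
    moreover have "Min {x, y} = x" "Max {x, y} = y" using that by auto
    ultimately show ?thesis by (auto simp: c_def split: if_splits)
  qed
  define h where "h = enumerate Y"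
  have hY: "h i \<in> Y" and h: "strict_mono h" for i
    unfolding h_def using Y by (simp_all add: enumerate_in_set strict_mono_enumerate)
  obtain i j where "i < j" "P (f (h i)) (f (h j))"
    using almost_full_onD[OF af, of "f \<circ> h"] f by auto
  then have "t = 0" using col hY h by (auto simp: strict_mono_def)
  then show thesis using that[OF h] col hY h by (auto simp: strict_mono_def)
qed

text \<open>On a subsequence where \<open>P\<close> holds for all pairs, any pair that is good for
  \<open>Q\<close> is good for both.\<close>

lemma almost_full_on_conj:
  fixes f :: "nat \<Rightarrow> 'a" and g :: "nat \<Rightarrow> 'b"
  assumes "almost_full_on P A" and "almost_full_on Q B" and "\<And>i. f i \<in> A" and "\<And>i. g i \<in> B"
  shows "\<exists>i j. i < j \<and> P (f i) (f j) \<and> Q (g i) (g j)"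
proof -
  obtain h :: "nat \<Rightarrow> nat" where h: "strict_mono h" "\<And>i j. i < j \<Longrightarrow> P (f (h i)) (f (h j))"
    using almost_full_on_subseq[of P A f] assms by blast
  obtain i j where "i < j" "Q (g (h i)) (g (h j))"
    using almost_full_onD[OF assms(2), of "g \<circ> h"] assms(4) by auto
  moreover from this have "h i < h j" "P (f (h i)) (f (h j))" using h by (auto simp: strict_mono_def)
  ultimately show ?thesis by blast
qed

lemma almost_full_on_eq_finite:
  fixes A :: "'a set"
  assumes "finite (k ` A)"
  shows "almost_full_on (\<lambda>x y. k x = k y) A"
proof -
  have "good (\<lambda>x y. k x = k y) f" if f: "\<forall>i. f i \<in> A" for f :: "nat \<Rightarrow> 'a"
  proof -
    have "finite (range (k \<circ> f))" by (rule finite_subset[OF _ assms]) (use f in auto)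
    then have "\<not> inj (k \<circ> f)" using finite_imageD infinite_UNIV_nat by blast
    then show ?thesis unfolding good_def inj_def by (metis comp_apply linorder_neqE_nat)
  qed
  then show ?thesis unfolding almost_full_on_def by blast
qed

text \<open>If no finite set served, one could keep choosing an element that is above none of its
  predecessors, and the resulting sequence would have no good pair.\<close>

lemma almost_full_on_finite_basis:
  assumes af: "almost_full_on P A"
  shows "\<exists>F\<subseteq>A. finite F \<and> (\<forall>a\<in>A. \<exists>b\<in>F. b = a \<or> P b a)"
proof (rule ccontr)
  assume "\<not> ?thesis"
  then have no: "\<exists>a\<in>A. \<forall>b\<in>F. b \<noteq> a \<and> \<not> P b a" if "finite F" "F \<subseteq> A" for F
    using that by metis
  \<comment> \<open>The state of the dependent choice is the set of all earlier entries together
    with the current one; a single entry would not remember which elements have to be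
    avoided.\<close>
  define ok where "ok X \<longleftrightarrow> finite (fst X) \<and> fst X \<subseteq> A \<and> snd X \<in> A \<and>
    (\<forall>b\<in>fst X. \<not> P b (snd X))" for X :: "'a set \<times> 'a"
  have "\<exists>X. ok X" using no[of "{}"] by (auto simp: ok_def)
  moreover have "\<exists>Y. ok Y \<and> fst Y = insert (snd X) (fst X)" if "ok X" for X
    using no[of "insert (snd X) (fst X)"] that unfolding ok_def by auto
  ultimately have "\<exists>h. \<forall>n. ok (h n) \<and> fst (h (Suc n)) = insert (snd (h n)) (fst (h n))"
    by (rule dependent_nat_choice[of "\<lambda>_. ok"])
  then obtain h where h: "\<And>n. ok (h n)" "\<And>n. fst (h (Suc n)) = insert (snd (h n)) (fst (h n))"
    by blast
  have mem: "snd (h i) \<in> fst (h j)" if "i < j" for i j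
    using that by (induction j) (auto simp: h(2) less_Suc_eq)
  obtain i j where "i < j" "P (snd (h i)) (snd (h j))"
    using almost_full_onD[OF af, of "\<lambda>n. snd (h n)"] h(1) by (auto simp: ok_def)
  then show False using mem h(1)[of j] by (auto simp: ok_def)
qed

text \<open>Entries are fixed one after the other: entry \<open>n\<close> has least size among all
  bad sequences that share the entries fixed before.\<close>

lemma minimal_bad_sequence:
  fixes sz :: "'a \<Rightarrow> nat"
  assumes "\<not> almost_full_on P A"
  obtains f where "\<And>i. f i \<in> A" and "\<not> good P f"
    and "\<And>n g. \<lbrakk>\<And>i. g i \<in> A; \<And>i. i < n \<Longrightarrow> g i = f i; sz (g n) < sz (f n)\<rbrakk> \<Longrightarrow> good P g"
proof -
  define bad where "bad g \<longleftrightarrow> (\<forall>i. g i \<in> A) \<and> \<not> good P g" for g :: "nat \<Rightarrow> 'a"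
  have ex: "\<exists>h'. bad h' \<and> (\<forall>i<n. h' i = h i) \<and>
      (\<forall>g. bad g \<longrightarrow> (\<forall>i<n. g i = h i) \<longrightarrow> sz (h' n) \<le> sz (g n))" if "bad h" for h n
    using ex_has_least_nat[of "\<lambda>g. bad g \<and> (\<forall>i<n. g i = h i)" h "\<lambda>g. sz (g n)"] that by auto
  have "\<exists>h. bad h" using assms unfolding almost_full_on_def bad_def by blast
  then have "\<exists>h. \<forall>n. bad (h n) \<and> ((\<forall>i<n. h (Suc n) i = h n i) \<and>
      (\<forall>g. bad g \<longrightarrow> (\<forall>i<n. g i = h n i) \<longrightarrow> sz (h (Suc n) n) \<le> sz (g n)))"
    by (rule dependent_nat_choice[of "\<lambda>n. bad"]) (use ex in blast)
  then obtain h where h: "\<And>n. bad (h n)" and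
    step: "\<And>n. (\<forall>i<n. h (Suc n) i = h n i) \<and>
      (\<forall>g. bad g \<longrightarrow> (\<forall>i<n. g i = h n i) \<longrightarrow> sz (h (Suc n) n) \<le> sz (g n))"
    by blast
  \<comment> \<open>\<open>h (Suc n)\<close> agrees with \<open>h n\<close> before \<open>n\<close>
    and is least at \<open>n\<close>, so entry \<open>n\<close> is final from stage
    \<open>Suc n\<close> on, and the diagonal inherits badness from the stages.\<close>
  define f where "f n = h (Suc n) n" for n
  have agree: "h m i = f i" if "i < m" for m i
    using that
  proof (induction m)
    case (Suc m)
    show ?case
    proof (cases "i = m")
      case False
      then have "i < m" using Suc.prems by simp
      then show ?thesis using Suc.IH step[of m] by simp
    qed (simp add: f_def)
  qed simp
  have fA: "f i \<in> A" for i using h[of "Suc i"] by (simp add: f_def bad_def)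
  have bad: "\<not> good P f"
  proof
    assume "good P f"
    then obtain i j where "i < j" "P (f i) (f j)" unfolding good_def by blast
    then have "P (h (Suc j) i) (h (Suc j) j)" by (simp add: agree)
    then show False using h[of "Suc j"] \<open>i < j\<close> unfolding bad_def good_def by blast
  qed
  have "good P g" if "\<And>i. g i \<in> A" "\<And>i. i < n \<Longrightarrow> g i = f i" "sz (g n) < sz (f n)" for n g
  proof (rule ccontr)
    assume "\<not> good P g"
    then have "bad g" using that by (simp add: bad_def)
    moreover have "\<forall>i<n. g i = h n i" using that agree by simp
    ultimately have "sz (f n) \<le> sz (g n)" using step[of n] by (simp add: f_def)
    then show False using that by simp
  qed
  then show thesis using that fA bad by blast
qed

text \<open>The Nash-Williams argument: splicing a sequence of proper parts of the entries of a minimal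
  bad sequence onto an initial segment of it gives a good sequence.\<close>

lemma minimal_bad_parts:
  fixes sz :: "'a \<Rightarrow> nat"
  assumes f: "\<And>i. f i \<in> A" and bad: "\<not> good P f"
    and min: "\<And>n g. \<lbrakk>\<And>i. g i \<in> A; \<And>i. i < n \<Longrightarrow> g i = f i; sz (g n) < sz (f n)\<rbrakk> \<Longrightarrow> good P g"
    and part: "\<And>n x. x \<in> D n \<Longrightarrow> x \<in> A \<and> sz x < sz (f n) \<and> (\<forall>y. P y x \<longrightarrow> P y (f n))"
  shows "almost_full_on P (\<Union>n. D n)"
proof -
  have "good P b" if b: "\<And>i. b i \<in> (\<Union>n. D n)" for b
  proof -
    have "\<forall>i. \<exists>n. b i \<in> D n" using b by simp
    then obtain m where m: "\<And>i. b i \<in> D (m i)" by metis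
    \<comment> \<open>With \<open>m k\<close> least, every part comes from an entry with index at
      least \<open>m k\<close>. A good pair that joins an entry before \<open>m k\<close> to a part
      then lifts to the entry containing this part, which still stands further right.\<close>
    obtain k where k: "\<And>i. m k \<le> m i" using ex_has_least_nat[of "\<lambda>_. True" 0 m] by auto
    define g where "g i = (if i < m k then f i else b (k + (i - m k)))" for i
    have "good P g"
    proof (rule min)
      show "g i \<in> A" for i using f m part by (auto simp: g_def)
      show "i < m k \<Longrightarrow> g i = f i" for i by (simp add: g_def)
      show "sz (g (m k)) < sz (f (m k))" using m part by (simp add: g_def)
    qed
    then obtain i j where ij: "i < j" "P (g i) (g j)" unfolding good_def by blast
    show ?thesis
    proof (cases "i < m k")
      case True
      have "\<exists>j'. i < j' \<and> P (f i) (f j')"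
      proof (cases "j < m k")
        case True
        then show ?thesis using ij by (auto simp: g_def)
      next
        case False
        then have "P (f i) (b (k + (j - m k)))" using ij True by (simp add: g_def)
        then have "P (f i) (f (m (k + (j - m k))))" using m part by blast
        moreover have "i < m (k + (j - m k))" using True k by (meson order_less_le_trans)
        ultimately show ?thesis by blast
      qed
      then show ?thesis using bad unfolding good_def by blast
    next
      case False
      then have "P (b (k + (i - m k))) (b (k + (j - m k)))" using ij by (simp add: g_def)
      moreover have "k + (i - m k) < k + (j - m k)" using ij False by simp
      ultimately show ?thesis unfolding good_def by blast
    qed
  qed
  then show ?thesis unfolding almost_full_on_def by blast
qed

text \<open>A minimal bad sequence contains no empty list, and its tails form an almost full set. A
  pair of indices that is good both for the heads and for the tails embeds one list into the
  other.\<close>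

theorem higman:
  assumes af: "almost_full_on P A"
  shows "almost_full_on (list_emb P) (lists A)"
proof (rule ccontr)
  assume "\<not> ?thesis"
  then obtain f where f: "\<And>i. f i \<in> lists A" and bad: "\<not> good (list_emb P) f"
    and min: "\<And>n g. \<lbrakk>\<And>i. g i \<in> lists A; \<And>i. i < n \<Longrightarrow> g i = f i; length (g n) < length (f n)\<rbrakk>
      \<Longrightarrow> good (list_emb P) g"
    using minimal_bad_sequence[of "list_emb P" "lists A" length] by blast
  have ne: "f n \<noteq> []" for n
    using bad unfolding good_def by (metis lessI list_emb_Nil)
  have hd: "hd (f n) \<in> A" and tl: "tl (f n) \<in> lists A" for n
    using f[of n] ne[of n] by (cases "f n"; auto)+
  have "almost_full_on (list_emb P) (\<Union>n. {tl (f n)})"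
  proof (rule minimal_bad_parts[where f = f and sz = length and A = "lists A"])
    fix n x assume "x \<in> {tl (f n)}"
    then show "x \<in> lists A \<and> length x < length (f n) \<and> (\<forall>y. list_emb P y x \<longrightarrow> list_emb P y (f n))"
      using tl[of n] ne[of n] by (cases "f n") auto
  qed (fact f bad min)+
  from almost_full_on_conj[OF af this, of "\<lambda>n. hd (f n)" "\<lambda>n. tl (f n)"] hd
  obtain i j where "i < j" "P (hd (f i)) (hd (f j))" "list_emb P (tl (f i)) (tl (f j))" by auto
  then have "list_emb P (hd (f i) # tl (f i)) (hd (f j) # tl (f j))" by (intro list_emb_Cons2)
  then show False using ne bad \<open>i < j\<close> unfolding good_def by auto
qed

section \<open>Embeddings of ordered rooted trees\<close>

datatype 'a rtree = Node (root_of: 'a) (branches: "'a rtree list")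

text \<open>Kruskal's embedding of ordered trees: a node may be matched deep inside a branch, so an
  arc of the source becomes a path in the target. Since \<open>list_emb\<close> keeps the branches
  in order, preorder is respected, which later makes the induced map on edges increasing.\<close>

inductive tree_emb :: "('a \<Rightarrow> 'a \<Rightarrow> bool) \<Rightarrow> 'a rtree \<Rightarrow> 'a rtree \<Rightarrow> bool" for Q where
  tree_emb_branch: "t \<in> set ts \<Longrightarrow> tree_emb Q s t \<Longrightarrow> tree_emb Q s (Node y ts)"
| tree_emb_Node: "Q x y \<Longrightarrow> list_emb (tree_emb Q) ss ts \<Longrightarrow> tree_emb Q (Node x ss) (Node y ts)"
monos list_emb_mono

text \<open>The parts of a tree are its branches: what embeds into a branch embeds into the whole
  tree. So the branches in a minimal bad sequence are almost full, by \<open>higman\<close> the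
  lists of branches are, and this is combined with the relation at the roots.\<close>

theorem kruskal:
  assumes af: "almost_full_on Q A"
  shows "almost_full_on (tree_emb Q) {t. set_rtree t \<subseteq> A}" (is "almost_full_on _ ?T")
proof (rule ccontr)
  assume "\<not> ?thesis"
  then obtain f where f: "\<And>i. f i \<in> ?T" and bad: "\<not> good (tree_emb Q) f"
    and min: "\<And>n g. \<lbrakk>\<And>i. g i \<in> ?T; \<And>i. i < n \<Longrightarrow> g i = f i; size (g n) < size (f n)\<rbrakk>
      \<Longrightarrow> good (tree_emb Q) g"
    using minimal_bad_sequence[of "tree_emb Q" ?T size] by blast
  have "almost_full_on (tree_emb Q) (\<Union>n. set (branches (f n)))"
  proof (rule minimal_bad_parts[where f = f and sz = size and A = ?T])
    fix n x assume x: "x \<in> set (branches (f n))"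
    obtain r ts where t: "f n = Node r ts" by (cases "f n")
    have "size x < size (f n)" using x t size_list_estimation'[of x ts "size x" size] by simp
    then show "x \<in> ?T \<and> size x < size (f n) \<and> (\<forall>y. tree_emb Q y x \<longrightarrow> tree_emb Q y (f n))"
      using x t f[of n] tree_emb_branch[of x ts Q] by fastforce
  qed (fact f bad min)+
  note higman[OF this]
  from almost_full_on_conj[OF af this, of "\<lambda>n. root_of (f n)" "\<lambda>n. branches (f n)"]
  obtain i j where "i < j" "Q (root_of (f i)) (root_of (f j))"
    "list_emb (tree_emb Q) (branches (f i)) (branches (f j))"
    using f by (fastforce intro: rtree.set_sel(1))
  then have "tree_emb Q (Node (root_of (f i)) (branches (f i))) (Node (root_of (f j)) (branches (f j)))"
    by (intro tree_emb_Node)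
  then show False using bad \<open>i < j\<close> unfolding good_def by auto
qed

section \<open>Preorder, arcs and retractions of embedded forests\<close>

fun nodes :: "'a rtree \<Rightarrow> 'a list" where
  "nodes (Node x ts) = x # concat (map nodes ts)"

fun arcs :: "'a rtree \<Rightarrow> ('a \<times> 'a) set" where
  "arcs (Node x ts) = (\<Union>t\<in>set ts. insert (x, root_of t) (arcs t))"

definition forest_arcs :: "'a \<Rightarrow> 'a rtree list \<Rightarrow> ('a \<times> 'a) set" where
  "forest_arcs z ts = (\<Union>t\<in>set ts. insert (z, root_of t) (arcs t))"

lemma root_in_nodes: "root_of t \<in> set (nodes t)"
  by (cases t) simp

lemma arcs_in_nodes: "(a, b) \<in> arcs t \<Longrightarrow> a \<in> set (nodes t) \<and> b \<in> set (nodes t)"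
proof (induction t rule: arcs.induct)
  case (1 x ts)
  then obtain t where "t \<in> set ts" "(a, b) = (x, root_of t) \<or> (a, b) \<in> arcs t" by auto
  then show ?case using 1 root_in_nodes[of t] by auto
qed

lemma set_nodes: "set (nodes t) = set_rtree t"
  by (induction t rule: nodes.induct) simp

text \<open>An embedding \<open>f\<close> of forests comes with a retraction \<open>p\<close> that maps a node to the nearest
  embedded node on its path from the root, and to \<open>z\<close> if there is none.  So \<open>z\<close> acts as the parent
  of the roots on both sides, and in the induction it is replaced by the actual parent.\<close>

definition arc_image ::
  "'a \<Rightarrow> 'a rtree list \<Rightarrow> ('a \<Rightarrow> 'a) \<Rightarrow> ('a \<Rightarrow> 'a) \<Rightarrow> 'a \<Rightarrow> 'a \<Rightarrow> bool" where
  "arc_image z ss f p c b \<longleftrightarrow>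
     (if b \<in> f ` set (concat (map nodes ss)) then (c, p b) \<in> forest_arcs z ss else p b = c)"

text \<open>The clauses on arcs prepare the contraction of graphs: \<open>p\<close> sends an arc
  into an embedded node to an arc of the source and is constant along every other arc. Collapsing
  the latter arcs turns the target forest into the source forest.\<close>

definition forest_map ::
  "('a \<Rightarrow> 'a \<Rightarrow> bool) \<Rightarrow> 'a \<Rightarrow> 'a rtree list \<Rightarrow> 'a rtree list \<Rightarrow> ('a \<Rightarrow> 'a) \<Rightarrow> ('a \<Rightarrow> 'a) \<Rightarrow> bool" where
  "forest_map Q z ss ts f p \<longleftrightarrow>
     subseq (map f (concat (map nodes ss))) (concat (map nodes ts)) \<and>
     (\<forall>x\<in>set (concat (map nodes ss)). Q x (f x) \<and> p (f x) = x) \<and>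
     (\<forall>y\<in>set (concat (map nodes ts)). p y \<in> insert z (set (concat (map nodes ss)))) \<and>
     (\<forall>t\<in>set ts. arc_image z ss f p z (root_of t) \<and>
        (\<forall>(a, b)\<in>arcs t. arc_image z ss f p (p a) b))"

lemma subseq_set: "subseq xs ys \<Longrightarrow> set xs \<subseteq> set ys"
  by (induction rule: list_emb.induct) auto

lemma forest_map_image:
  assumes "forest_map Q z ss ts f p"
  shows "f ` set (concat (map nodes ss)) \<subseteq> set (concat (map nodes ts))"
  using subseq_set assms unfolding forest_map_def by (metis set_map)

lemma forest_mapI:
  assumes "subseq (map f (concat (map nodes ss))) (concat (map nodes ts))"
    and "\<And>x. x \<in> set (concat (map nodes ss)) \<Longrightarrow> Q x (f x) \<and> p (f x) = x"
    and "\<And>y. y \<in> set (concat (map nodes ts)) \<Longrightarrow> p y \<in> insert z (set (concat (map nodes ss)))"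
    and "\<And>t. t \<in> set ts \<Longrightarrow> arc_image z ss f p z (root_of t)"
    and "\<And>t a b. t \<in> set ts \<Longrightarrow> (a, b) \<in> arcs t \<Longrightarrow> arc_image z ss f p (p a) b"
  shows "forest_map Q z ss ts f p"
  using assms unfolding forest_map_def by blast

lemma forest_mapD:
  assumes "forest_map Q z ss ts f p"
  shows "subseq (map f (concat (map nodes ss))) (concat (map nodes ts))"
    and "\<And>x. x \<in> set (concat (map nodes ss)) \<Longrightarrow> Q x (f x)"
    and "\<And>x. x \<in> set (concat (map nodes ss)) \<Longrightarrow> p (f x) = x"
    and "\<And>y. y \<in> set (concat (map nodes ts)) \<Longrightarrow> p y \<in> insert z (set (concat (map nodes ss)))"
    and "\<And>t. t \<in> set ts \<Longrightarrow> arc_image z ss f p z (root_of t)"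
    and "\<And>t a b. t \<in> set ts \<Longrightarrow> (a, b) \<in> arcs t \<Longrightarrow> arc_image z ss f p (p a) b"
  using assms unfolding forest_map_def by blast+

lemma forest_map_Nil: "forest_map Q z [] ts f (\<lambda>_. z)"
  by (rule forest_mapI) (auto simp: arc_image_def)

lemma forest_nodesI:
  assumes "t \<in> set ts"
  shows "root_of t \<in> set (concat (map nodes ts))"
    and "(a, b) \<in> arcs t \<Longrightarrow> a \<in> set (concat (map nodes ts)) \<and> b \<in> set (concat (map nodes ts))"
  using assms root_in_nodes[of t] arcs_in_nodes[of a b t] by auto

text \<open>The skipped tree contains no embedded node, so all its nodes retract to the common
  parent \<open>z\<close>.\<close>

lemma forest_map_skip:
  assumes m: "forest_map Q z ss ts f p" and d: "distinct (concat (map nodes (t # ts)))"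
  shows "forest_map Q z ss (t # ts) f (\<lambda>y. if y \<in> set (nodes t) then z else p y)"
    (is "forest_map _ _ _ _ _ ?q")
proof -
  let ?S = "set (concat (map nodes ss))" and ?T = "set (concat (map nodes ts))"
  have im: "f ` ?S \<subseteq> ?T" using forest_map_image[OF m] .
  have dj: "set (nodes t) \<inter> ?T = {}" using d by auto
  have q: "?q y = p y" if "y \<in> ?T" for y using dj that by auto
  have skip: "arc_image z ss f ?q z b" if "b \<in> set (nodes t)" for b
    using that im dj by (auto simp: arc_image_def)
  have keep: "arc_image z ss f ?q c b \<longleftrightarrow> arc_image z ss f p c b" if "b \<in> ?T" for b c
    using q[OF that] by (simp only: arc_image_def)
  show ?thesis
  proof (rule forest_mapI)
    show "subseq (map f (concat (map nodes ss))) (concat (map nodes (t # ts)))"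
      using forest_mapD(1)[OF m] by (simp add: list_emb_append2)
    show "Q x (f x) \<and> ?q (f x) = x" if "x \<in> ?S" for x
    proof -
      have "f x \<notin> set (nodes t)" using im that dj by blast
      then show ?thesis using forest_mapD(2,3)[OF m that] by simp
    qed
    show "?q y \<in> insert z ?S" if "y \<in> set (concat (map nodes (t # ts)))" for y
      using forest_mapD(4)[OF m, of y] that by auto
    show "arc_image z ss f ?q z (root_of t')" if "t' \<in> set (t # ts)" for t'
      using that skip[OF root_in_nodes] keep[OF forest_nodesI(1)] forest_mapD(5)[OF m]
      by (cases "t' = t") auto
    show "arc_image z ss f ?q (?q a) b" if t': "t' \<in> set (t # ts)" and ab: "(a, b) \<in> arcs t'" for t' a b
    proof (cases "t' = t")
      case True
      then show ?thesis using skip arcs_in_nodes[OF ab] by auto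
    next
      case False
      then have t': "t' \<in> set ts" using t' by simp
      note ab' = forest_nodesI(2)[OF t' ab]
      then have q: "?q a = p a" using q by blast
      have "b \<in> ?T" using ab' by blast
      from keep[OF this] forest_mapD(6)[OF m t' ab] show ?thesis unfolding q by blast
    qed
  qed
qed

text \<open>The node sets of \<open>t\<close> and \<open>ts\<close> are disjoint, as are those of
  \<open>s\<close> and \<open>ss\<close>, so both pairs of maps can be glued by membership. Whether
  a node is embedded is decided within its own part.\<close>

lemma forest_map_Cons:
  assumes m1: "forest_map Q z [s] [t] f1 p1" and m2: "forest_map Q z ss ts f2 p2"
    and ds: "distinct (concat (map nodes (s # ss)))" and d: "distinct (concat (map nodes (t # ts)))"
  shows "forest_map Q z (s # ss) (t # ts)
    (\<lambda>x. if x \<in> set (nodes s) then f1 x else f2 x) (\<lambda>y. if y \<in> set (nodes t) then p1 y else p2 y)"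
    (is "forest_map _ _ _ _ ?f ?q")
proof -
  let ?S = "set (concat (map nodes ss))" and ?T = "set (concat (map nodes ts))"
  let ?s = "set (nodes s)" and ?t = "set (nodes t)"
  have im1: "f1 ` ?s \<subseteq> ?t" and im2: "f2 ` ?S \<subseteq> ?T"
    using forest_map_image[OF m1] forest_map_image[OF m2] by auto
  have djt: "?t \<inter> ?T = {}" and djs: "?s \<inter> ?S = {}" using d ds by auto
  have q1: "?q y = p1 y" if "y \<in> ?t" for y using that by auto
  have q2: "?q y = p2 y" if "y \<in> ?T" for y using djt that by auto
  have f2: "?f x = f2 x" if "x \<in> ?S" for x using djs that by auto
  have "?f ` ?S = f2 ` ?S" by (rule image_cong) (use f2 in auto)
  moreover have "?f ` ?s = f1 ` ?s" by auto
  moreover have "set (concat (map nodes (s # ss))) = ?s \<union> ?S" by simp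
  ultimately have fim: "?f ` set (concat (map nodes (s # ss))) = f1 ` ?s \<union> f2 ` ?S"
    by (simp only: image_Un)
  have fa: "forest_arcs z (s # ss) = forest_arcs z [s] \<union> forest_arcs z ss"
    by (simp add: forest_arcs_def)
  have arc1: "arc_image z (s # ss) ?f ?q c b" if "b \<in> ?t" "arc_image z [s] f1 p1 c b" for b c
  proof -
    have "b \<notin> f2 ` ?S" using that im2 djt by auto
    then show ?thesis using that q1[of b] unfolding arc_image_def fim fa
      by (auto split: if_splits)
  qed
  have arc2: "arc_image z (s # ss) ?f ?q c b" if "b \<in> ?T" "arc_image z ss f2 p2 c b" for b c
  proof -
    have "b \<notin> f1 ` ?s" using that im1 djt by auto
    then show ?thesis using that q2[of b] unfolding arc_image_def fim fa
      by (auto split: if_splits)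
  qed
  show ?thesis
  proof (rule forest_mapI)
    have "map ?f (concat (map nodes ss)) = map f2 (concat (map nodes ss))" using f2 by simp
    moreover have "map ?f (nodes s) = map f1 (nodes s)" by simp
    ultimately have feq: "map ?f (concat (map nodes (s # ss))) =
        map f1 (nodes s) @ map f2 (concat (map nodes ss))"
      by (simp only: concat.simps list.map map_append)
    have "subseq (map f1 (nodes s)) (nodes t)" using forest_mapD(1)[OF m1] by simp
    then show "subseq (map ?f (concat (map nodes (s # ss)))) (concat (map nodes (t # ts)))"
      unfolding feq using list_emb_append_mono[OF _ forest_mapD(1)[OF m2]] by simp
    show "Q x (?f x) \<and> ?q (?f x) = x" if x: "x \<in> set (concat (map nodes (s # ss)))" for x
    proof (cases "x \<in> ?s")
      case True
      then have "Q x (f1 x)" "p1 (f1 x) = x" using forest_mapD(2,3)[OF m1] by auto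
      then show ?thesis using True im1 by auto
    next
      case False
      then have S: "x \<in> ?S" using x by auto
      then have "Q x (f2 x)" "p2 (f2 x) = x" "f2 x \<in> ?T" using forest_mapD(2,3)[OF m2] im2 by blast+
      moreover have "f2 x \<notin> ?t" using calculation djt by blast
      ultimately show ?thesis using False by simp
    qed
    show "?q y \<in> insert z (set (concat (map nodes (s # ss))))"
      if y: "y \<in> set (concat (map nodes (t # ts)))" for y
      using forest_mapD(4)[OF m1, of y] forest_mapD(4)[OF m2, of y] y by auto
    show "arc_image z (s # ss) ?f ?q z (root_of t')" if t': "t' \<in> set (t # ts)" for t'
      using that arc1[OF root_in_nodes] arc2[OF forest_nodesI(1)] forest_mapD(5)[OF m1]
        forest_mapD(5)[OF m2] by (cases "t' = t") auto
    show "arc_image z (s # ss) ?f ?q (?q a) b" if t': "t' \<in> set (t # ts)" and ab: "(a, b) \<in> arcs t'" for t' a b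
    proof (cases "t' = t")
      case True
      then have "a \<in> ?t" "b \<in> ?t" using arcs_in_nodes[OF ab] by auto
      moreover have "arc_image z [s] f1 p1 (p1 a) b" using forest_mapD(6)[OF m1, of t] True ab by simp
      ultimately show ?thesis using arc1[of b "p1 a"] by simp
    next
      case False
      then have t': "t' \<in> set ts" using t' by simp
      note ab' = forest_nodesI(2)[OF t' ab]
      then have q: "?q a = p2 a" using q2 by blast
      have "b \<in> ?T" using ab' by blast
      from arc2[OF this forest_mapD(6)[OF m2 t' ab]] show ?thesis unfolding q .
    qed
  qed
qed

text \<open>The parent changes from \<open>x\<close> to \<open>z\<close>: on the branches the
  retraction falls back to \<open>x\<close>, which becomes a genuine node once the roots are added
  and is then the value at \<open>y\<close>.\<close>

lemma forest_map_Node: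
  assumes m: "forest_map Q x ss ts f p" and Q: "Q x y"
    and ds: "distinct (nodes (Node x ss))" and d: "distinct (nodes (Node y ts))"
  shows "forest_map Q z [Node x ss] [Node y ts] (f(x := y)) (p(y := x))"
proof -
  let ?S = "set (concat (map nodes ss))" and ?T = "set (concat (map nodes ts))"
  let ?f = "f(x := y)" and ?q = "p(y := x)"
  have im: "f ` ?S \<subseteq> ?T" using forest_map_image[OF m] .
  have x: "x \<notin> ?S" and y: "y \<notin> ?T" using d ds by auto
  have feq: "map ?f (concat (map nodes ss)) = map f (concat (map nodes ss))"
    using x by auto
  have "?f ` ?S = f ` ?S" using x by auto
  moreover have "set (concat (map nodes [Node x ss])) = insert x ?S" by simp
  ultimately have fim: "?f ` set (concat (map nodes [Node x ss])) = insert y (f ` ?S)"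
    by (simp only: image_insert fun_upd_same)
  have fa: "forest_arcs z [Node x ss] = insert (z, x) (forest_arcs x ss)"
    by (simp add: forest_arcs_def)
  have q: "?q a = p a" if "a \<in> ?T" for a using that y by auto
  have arc: "arc_image z [Node x ss] ?f ?q c b" if "b \<in> ?T" "arc_image x ss f p c b" for b c
  proof -
    have "b \<noteq> y" using that y by auto
    then show ?thesis using that unfolding arc_image_def fim fa by (auto split: if_splits)
  qed
  show ?thesis
  proof (rule forest_mapI)
    have "subseq (y # map ?f (concat (map nodes ss))) (y # concat (map nodes ts))"
      unfolding feq using forest_mapD(1)[OF m] by simp
    then show "subseq (map ?f (concat (map nodes [Node x ss]))) (concat (map nodes [Node y ts]))"
      by simp
    show "Q w (?f w) \<and> ?q (?f w) = w" if "w \<in> set (concat (map nodes [Node x ss]))" for w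
    proof (cases "w = x")
      case False
      then have "w \<in> ?S" using that by auto
      moreover have "f w \<noteq> y" using calculation im y by auto
      ultimately show ?thesis using forest_mapD(2,3)[OF m] False by auto
    qed (simp add: Q)
    show "?q w \<in> insert z (set (concat (map nodes [Node x ss])))"
      if "w \<in> set (concat (map nodes [Node y ts]))" for w
      using forest_mapD(4)[OF m, of w] that by auto
    show "arc_image z [Node x ss] ?f ?q z (root_of t')" if "t' \<in> set [Node y ts]" for t'
      using that unfolding arc_image_def fim fa by simp
    show "arc_image z [Node x ss] ?f ?q (?q a) b" if ab: "t' \<in> set [Node y ts]" "(a, b) \<in> arcs t'" for t' a b
    proof -
      obtain t where t: "t \<in> set ts" "(a, b) = (y, root_of t) \<or> (a, b) \<in> arcs t" using ab by auto
      show ?thesis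
      proof (cases "(a, b) \<in> arcs t")
        case True
        note ab = forest_nodesI(2)[OF t(1) True]
        then show ?thesis using arc[OF _ forest_mapD(6)[OF m t(1) True]] q by simp
      next
        case False
        then show ?thesis using t arc[OF forest_nodesI(1) forest_mapD(5)[OF m]] by simp
      qed
    qed
  qed
qed

text \<open>The new root \<open>y\<close> is not embedded and retracts to \<open>z\<close>. The
  roots of \<open>ts\<close>, whose parent was taken to be \<open>z\<close>, now have the parent
  \<open>y\<close> with the same value, so their conditions carry over.\<close>

lemma forest_map_branch:
  assumes m: "forest_map Q z [s] ts f p" and d: "distinct (nodes (Node y ts))"
  shows "forest_map Q z [s] [Node y ts] f (p(y := z))"
proof -
  let ?S = "set (concat (map nodes [s]))" and ?T = "set (concat (map nodes ts))"
  let ?q = "p(y := z)"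
  have im: "f ` ?S \<subseteq> ?T" using forest_map_image[OF m] .
  have y: "y \<notin> ?T" using d by auto
  then have yim: "y \<notin> f ` ?S" using im by blast
  have q: "?q a = p a" if "a \<in> ?T" for a using that y by auto
  have arc: "arc_image z [s] f ?q c b" if "b \<in> ?T" "arc_image z [s] f p c b" for b c
    using that q[of b] unfolding arc_image_def by simp
  show ?thesis
  proof (rule forest_mapI)
    show "subseq (map f (concat (map nodes [s]))) (concat (map nodes [Node y ts]))"
      using forest_mapD(1)[OF m] by (simp add: list_emb_Cons)
    show "Q w (f w) \<and> ?q (f w) = w" if w: "w \<in> ?S" for w
      using forest_mapD(2,3)[OF m w] yim w by auto
    show "?q w \<in> insert z ?S" if "w \<in> set (concat (map nodes [Node y ts]))" for w
      using forest_mapD(4)[OF m, of w] that by auto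
    show "arc_image z [s] f ?q z (root_of t')" if "t' \<in> set [Node y ts]" for t'
      using that yim unfolding arc_image_def by simp
    show "arc_image z [s] f ?q (?q a) b" if ab: "t' \<in> set [Node y ts]" "(a, b) \<in> arcs t'" for t' a b
    proof -
      obtain t where t: "t \<in> set ts" "(a, b) = (y, root_of t) \<or> (a, b) \<in> arcs t" using ab by auto
      show ?thesis
      proof (cases "(a, b) \<in> arcs t")
        case True
        note ab = forest_nodesI(2)[OF t(1) True]
        then show ?thesis using arc[OF _ forest_mapD(6)[OF m t(1) True]] q by simp
      next
        case False
        then show ?thesis using t arc[OF forest_nodesI(1) forest_mapD(5)[OF m]] by simp
      qed
    qed
  qed
qed

text \<open>The hypothesis has the shape that induction over \<open>tree_emb\<close> supplies for
  lists of branches. It quantifies over \<open>z\<close> because the branches of a node need that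
  node as their parent.\<close>

lemma list_emb_forest_map:
  assumes "list_emb (\<lambda>s t. distinct (nodes s) \<longrightarrow> distinct (nodes t) \<longrightarrow>
      (\<forall>z. \<exists>f p. forest_map Q z [s] [t] f p)) ss ts"
    and "distinct (concat (map nodes ss))" and "distinct (concat (map nodes ts))"
  shows "\<exists>f p. forest_map Q z ss ts f p"
  using assms
proof (induction rule: list_emb.induct)
  case (list_emb_Nil ts)
  show ?case using forest_map_Nil[of Q z ts] by blast
next
  case (list_emb_Cons ss ts t)
  then obtain f p where "forest_map Q z ss ts f p" by auto
  from forest_map_skip[OF this list_emb_Cons.prems(2)] show ?case by blast
next
  case (list_emb_Cons2 s t ss ts)
  have "\<exists>f p. forest_map Q z ss ts f p" using list_emb_Cons2.IH list_emb_Cons2.prems by simp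
  moreover have "\<exists>f p. forest_map Q z [s] [t] f p"
    using list_emb_Cons2.hyps(1) list_emb_Cons2.prems by simp
  ultimately obtain f1 p1 f2 p2
    where "forest_map Q z [s] [t] f1 p1" "forest_map Q z ss ts f2 p2" by blast
  from forest_map_Cons[OF this list_emb_Cons2.prems] show ?case by blast
qed

lemma tree_emb_forest_map:
  assumes "tree_emb Q s t" and "distinct (nodes s)" and "distinct (nodes t)"
  shows "\<exists>f p. forest_map Q z [s] [t] f p"
  using assms
proof (induction arbitrary: z rule: tree_emb.induct)
  case (tree_emb_branch t ts s y)
  obtain us vs where "ts = us @ t # vs" using tree_emb_branch.hyps split_list by metis
  \<comment> \<open>An embedding into one branch counts as an embedding of a forest with a single
    tree that skips the branches on both sides of \<open>t\<close>.\<close>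
  then have "list_emb (\<lambda>s t. distinct (nodes s) \<longrightarrow> distinct (nodes t) \<longrightarrow>
      (\<forall>z. \<exists>f p. forest_map Q z [s] [t] f p)) [s] ts"
    using tree_emb_branch.IH by (auto intro!: list_emb_append2 list_emb_Cons2)
  then have "\<exists>f p. forest_map Q z [s] ts f p"
    using list_emb_forest_map tree_emb_branch.prems by fastforce
  then obtain f p where "forest_map Q z [s] ts f p" by blast
  from forest_map_branch[OF this tree_emb_branch.prems(2)] show ?case by blast
next
  case (tree_emb_Node x y ss ts)
  have "list_emb (\<lambda>s t. distinct (nodes s) \<longrightarrow> distinct (nodes t) \<longrightarrow>
      (\<forall>z. \<exists>f p. forest_map Q z [s] [t] f p)) ss ts"
    by (rule list_emb_mono[THEN mp, OF _ tree_emb_Node.IH]) blast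
  then have "\<exists>f p. forest_map Q x ss ts f p"
    using list_emb_forest_map tree_emb_Node.prems by fastforce
  then obtain f p where "forest_map Q x ss ts f p" by blast
  from forest_map_Node[OF this tree_emb_Node.hyps(1) tree_emb_Node.prems] show ?case by blast
qed

section \<open>Positions in preorder lists\<close>

lemma arcs_subseq: "(a, b) \<in> arcs t \<Longrightarrow> subseq [a, b] (nodes t)"
proof (induction t rule: arcs.induct)
  case (1 x ts)
  then obtain t where t: "t \<in> set ts" "(a, b) = (x, root_of t) \<or> (a, b) \<in> arcs t" by auto
  show ?case
  proof (cases "(a, b) = (x, root_of t)")
    case True
    then have "b \<in> set (concat (map nodes ts))" using t root_in_nodes by auto
    then show ?thesis using True by (simp add: subseq_singleton_left)
  next
    case False
    then have "subseq [a, b] (nodes t)" using 1 t by blast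
    moreover obtain us vs where "ts = us @ t # vs" using t split_list by metis
    ultimately have "subseq [a, b] (concat (map nodes ts))"
      by (simp add: list_emb_append2 list_emb_prefix)
    then show ?thesis unfolding nodes.simps by (rule list_emb_Cons)
  qed
qed

lemma subseq_pair_antisym: "\<lbrakk>distinct xs; subseq [a, b] xs\<rbrakk> \<Longrightarrow> \<not> subseq [b, a] xs"
  by (induction xs) (auto simp: subseq_singleton_left split: if_splits dest: list_emb_ConsD)

definition pos :: "'a list \<Rightarrow> 'a \<Rightarrow> nat" where
  "pos xs x = length (takeWhile (\<lambda>y. y \<noteq> x) xs)"

lemma pos_Cons: "pos (y # xs) x = (if x = y then 0 else Suc (pos xs x))"
  by (auto simp: pos_def)

lemma nth_pos: "x \<in> set xs \<Longrightarrow> xs ! pos xs x = x"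
  by (induction xs) (auto simp: pos_Cons)

lemma subseq_distinct: "subseq xs ys \<Longrightarrow> distinct ys \<Longrightarrow> distinct xs"
  by (induction rule: list_emb.induct) (use subseq_set in auto)

lemma pos_nth: "\<lbrakk>distinct xs; k < length xs\<rbrakk> \<Longrightarrow> pos xs (xs ! k) = k"
proof (induction xs arbitrary: k)
  case (Cons x xs)
  then show ?case by (cases k) (auto simp: pos_Cons)
qed simp

lemma pos_less_iff:
  "\<lbrakk>distinct xs; a \<in> set xs; b \<in> set xs\<rbrakk> \<Longrightarrow> pos xs a < pos xs b \<longleftrightarrow> subseq [a, b] xs"
proof (induction xs)
  case (Cons y xs)
  show ?case
  proof (cases "a = y \<or> b = y")
    case True
    then show ?thesis using Cons.prems
      by (auto simp: pos_Cons subseq_singleton_left dest: subseq_set)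
  next
    case False
    then show ?thesis using Cons by (auto simp: pos_Cons)
  qed
qed simp

lemma pos_map_mono:
  assumes sub: "subseq (map f xs) ys" and d: "distinct xs" "distinct ys"
    and "a \<in> set xs" "b \<in> set xs" and lt: "pos xs a < pos xs b"
  shows "pos ys (f a) < pos ys (f b)"
proof -
  have "subseq (map f [a, b]) (map f xs)" using assms pos_less_iff by (metis subseq_map)
  then have "subseq [f a, f b] ys" using sub subseq_order.order_trans by auto
  then show ?thesis using pos_less_iff[OF d(2), of "f a" "f b"] subseq_set[of _ ys] by fastforce
qed

lemma root_no_arc:
  assumes "distinct (nodes t)"
  shows "(a, root_of t) \<notin> arcs t"
proof
  assume "(a, root_of t) \<in> arcs t"
  then have "subseq [a, root_of t] (nodes t)" by (rule arcs_subseq)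
  with assms show False by (cases t) (auto simp: subseq_singleton_left split: if_splits dest: subseq_set)
qed

lemma rtree_arc_induct [consumes 1, case_names root arc]:
  assumes "x \<in> set (nodes t)" and "P (root_of t)" and "\<And>a b. \<lbrakk>(a, b) \<in> arcs t; P a\<rbrakk> \<Longrightarrow> P b"
  shows "P x"
  using assms
proof (induction t rule: nodes.induct)
  case (1 y ts)
  show ?case
  proof (cases "x = y")
    case False
    then obtain t where t: "t \<in> set ts" "x \<in> set (nodes t)" using 1 by auto
    have "P (root_of t)" using 1(3,4) t by auto
    then show ?thesis using 1(1)[OF t] 1(4) t by auto
  qed (use 1 in simp)
qed

lemma parent_arc:
  assumes "x \<in> set (nodes t)" and "x \<noteq> root_of t"
  obtains a where "(a, x) \<in> arcs t"
  using assms(1) assms(2) that by (induction rule: rtree_arc_induct) auto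

text \<open>The last assumption, which the root labels will ensure, forces the embedding to preserve
  the root. Then every node of \<open>t\<close> lies at or below an embedded one, and the auxiliary
  parent can be eliminated.\<close>

lemma tree_emb_maps:
  assumes emb: "tree_emb Q s t" and ds: "distinct (nodes s)" and dt: "distinct (nodes t)"
    and root_of: "\<And>y. \<lbrakk>y \<in> set (nodes t); Q (root_of s) y\<rbrakk> \<Longrightarrow> y = root_of t"
  shows "\<exists>f p. subseq (map f (nodes s)) (nodes t) \<and> f (root_of s) = root_of t \<and>
     (\<forall>x\<in>set (nodes s). Q x (f x) \<and> p (f x) = x) \<and> p ` set (nodes t) \<subseteq> set (nodes s) \<and>
     (\<forall>(a, b)\<in>arcs t. if b \<in> f ` set (nodes s) then (p a, p b) \<in> arcs s else p b = p a)"
proof -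
  \<comment> \<open>Taking the root of \<open>s\<close> as its own parent adds only the arc
    \<open>(root_of s, root_of s)\<close>. It never arises: its lower end would belong to the root
    of \<open>t\<close>, into which no arc leads.\<close>
  obtain f p where m: "forest_map Q (root_of s) [s] [t] f p"
    using tree_emb_forest_map[OF emb ds dt] by blast
  have sub: "subseq (map f (nodes s)) (nodes t)" using forest_mapD(1)[OF m] by simp
  have Q: "Q x (f x) \<and> p (f x) = x" if "x \<in> set (nodes s)" for x
    using forest_mapD(2,3)[OF m, of x] that by simp
  have "f (root_of s) \<in> set (nodes t)" using forest_map_image[OF m] root_in_nodes[of s] by auto
  then have froot: "f (root_of s) = root_of t" using root_of Q root_in_nodes by blast
  have "(p a, p b) \<in> arcs s" if ab: "(a, b) \<in> arcs t" and b: "b \<in> f ` set (nodes s)" for a b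
  proof -
    have "(p a, p b) \<in> forest_arcs (root_of s) [s]"
      using forest_mapD(6)[OF m _ ab] b by (simp add: arc_image_def)
    moreover have "p b \<noteq> root_of s"
    proof
      assume "p b = root_of s"
      then have "b = root_of t" using b Q froot by auto
      then show False using ab root_no_arc[OF dt] by simp
    qed
    ultimately show ?thesis by (auto simp: forest_arcs_def)
  qed
  moreover have "p b = p a" if "(a, b) \<in> arcs t" "b \<notin> f ` set (nodes s)" for a b
    using forest_mapD(6)[OF m _ that(1)] that(2) by (simp add: arc_image_def)
  moreover have "p y \<in> set (nodes s)" if "y \<in> set (nodes t)" for y
    using forest_mapD(4)[OF m, of y] that root_in_nodes[of s] by auto
  ultimately show ?thesis using sub froot Q by (intro exI[of _ f] exI[of _ p]) auto
qed

lemma nodes_map: "nodes (map_rtree h t) = map h (nodes t)"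
  by (induction t rule: nodes.induct) (simp add: map_concat cong: map_cong)

lemma root_of_map: "root_of (map_rtree h t) = h (root_of t)"
  by (cases t) simp

lemma arcs_map: "arcs (map_rtree h t) = map_prod h h ` arcs t"
  by (induction t rule: arcs.induct) (simp add: image_UN root_of_map)

text \<open>Labels repeat, whereas the retraction needs distinct nodes. So the nodes carry pairs of
  a name and a label, the embedding compares only labels, and the maps on pairs are read back as
  maps on names.\<close>

lemma labeled_tree_emb_maps:
  assumes emb: "tree_emb (\<lambda>x y. snd x = snd y) (map_rtree (\<lambda>v. (v, l v)) s) (map_rtree (\<lambda>v. (v, l' v)) t)"
    and ds: "distinct (nodes s)" and dt: "distinct (nodes t)"
    and root: "\<And>y. \<lbrakk>y \<in> set (nodes t); l' y = l (root_of s)\<rbrakk> \<Longrightarrow> y = root_of t"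
  shows "\<exists>f p. subseq (map f (nodes s)) (nodes t) \<and> f (root_of s) = root_of t \<and>
     (\<forall>x\<in>set (nodes s). l' (f x) = l x \<and> p (f x) = x) \<and> p ` set (nodes t) \<subseteq> set (nodes s) \<and>
     (\<forall>(a, b)\<in>arcs t. if b \<in> f ` set (nodes s) then (p a, p b) \<in> arcs s else p b = p a)"
proof -
  let ?i = "\<lambda>v. (v, l v)" and ?j = "\<lambda>v. (v, l' v)"
  let ?S = "map_rtree ?i s" and ?T = "map_rtree ?j t"
  have dS: "distinct (nodes ?S)" using ds by (simp add: nodes_map distinct_map inj_on_def)
  have dT: "distinct (nodes ?T)" using dt by (simp add: nodes_map distinct_map inj_on_def)
  have rT: "y = root_of ?T" if "y \<in> set (nodes ?T)" "snd (root_of ?S) = snd y" for y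
    using that root by (auto simp: nodes_map root_of_map)
  obtain F P where
    F: "subseq (map F (nodes ?S)) (nodes ?T)" and Froot: "F (root_of ?S) = root_of ?T"
    and PF: "\<forall>x\<in>set (nodes ?S). snd x = snd (F x) \<and> P (F x) = x"
    and P: "P ` set (nodes ?T) \<subseteq> set (nodes ?S)"
    and arc: "\<forall>(a, b)\<in>arcs ?T. if b \<in> F ` set (nodes ?S) then (P a, P b) \<in> arcs ?S else P b = P a"
    using tree_emb_maps[OF emb dS dT] rT by blast
  define f where "f v = fst (F (?i v))" for v
  define p where "p v = fst (P (?j v))" for v
  have FT: "F (?i x) \<in> set (nodes ?T)" if "x \<in> set (nodes s)" for x
    using subseq_set[OF F] that by (auto simp: nodes_map)
  have Ff: "F (?i x) = ?j (f x)" if "x \<in> set (nodes s)" for x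
    using FT[OF that] by (auto simp: nodes_map f_def)
  have Pp: "P (?j y) = ?i (p y)" if "y \<in> set (nodes t)" for y
  proof -
    have "P (?j y) \<in> set (nodes ?S)" using P that by (auto simp: nodes_map)
    then show ?thesis by (auto simp: nodes_map p_def)
  qed
  have im: "?j b \<in> F ` set (nodes ?S) \<longleftrightarrow> b \<in> f ` set (nodes s)" for b
    using Ff by (auto simp: nodes_map image_iff)
  have "map F (nodes ?S) = map ?j (map f (nodes s))" using Ff by (simp add: nodes_map)
  then have "subseq (map fst (map ?j (map f (nodes s)))) (map fst (map ?j (nodes t)))"
    using F by (simp only: nodes_map subseq_map)
  then have "subseq (map f (nodes s)) (nodes t)" by (simp add: comp_def)
  moreover have "f (root_of s) = root_of t" using Froot by (simp add: root_of_map f_def)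
  moreover have "\<forall>x\<in>set (nodes s). l' (f x) = l x \<and> p (f x) = x"
  proof
    fix x assume x: "x \<in> set (nodes s)"
    then have "?i x \<in> set (nodes ?S)" by (simp add: nodes_map)
    with PF have "snd (?i x) = snd (F (?i x)) \<and> P (F (?i x)) = ?i x" by blast
    then show "l' (f x) = l x \<and> p (f x) = x" using Ff[OF x] by (simp add: p_def)
  qed
  moreover have "p ` set (nodes t) \<subseteq> set (nodes s)"
  proof clarify
    fix y assume y: "y \<in> set (nodes t)"
    have "P (?j y) \<in> set (nodes ?S)" using P y by (auto simp: nodes_map)
    then show "p y \<in> set (nodes s)" by (auto simp: nodes_map p_def)
  qed
  moreover have "\<forall>(a, b)\<in>arcs t. if b \<in> f ` set (nodes s) then (p a, p b) \<in> arcs s else p b = p a"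
  proof (rule ballI, clarify)
    fix a b assume ab: "(a, b) \<in> arcs t"
    have "(?j a, ?j b) \<in> arcs ?T" using ab by (force simp: arcs_map)
    with arc have "if ?j b \<in> F ` set (nodes ?S) then (P (?j a), P (?j b)) \<in> arcs ?S else P (?j b) = P (?j a)"
      by blast
    moreover have "a \<in> set (nodes t)" "b \<in> set (nodes t)" using arcs_in_nodes[OF ab] by auto
    ultimately show "if b \<in> f ` set (nodes s) then (p a, p b) \<in> arcs s else p b = p a"
      using im Pp by (auto simp: arcs_map split: if_splits)
  qed
  ultimately show ?thesis by blast
qed

text \<open>A lexicographic comparison consults only order and equality of entries, and the change
  from \<open>m\<close> to \<open>m'\<close> preserves both.\<close>

lemma list_less_map_mono:
  fixes m m' :: "'a \<Rightarrow> nat"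
  assumes "\<And>a b. \<lbrakk>a \<in> A; b \<in> A; m a < m b\<rbrakk> \<Longrightarrow> m' a < m' b"
    and "\<And>a b. \<lbrakk>a \<in> A; b \<in> A; m a = m b\<rbrakk> \<Longrightarrow> m' a = m' b"
    and "set xs \<subseteq> A" and "set ys \<subseteq> A" and "map m xs < map m ys"
  shows "map m' xs < map m' ys"
  using assms(3-)
proof (induction xs arbitrary: ys)
  case Nil
  then show ?case by (cases ys) auto
next
  case (Cons x xs)
  then obtain y ys' where ys: "ys = y # ys'" by (cases ys) auto
  then show ?case using Cons.IH[of ys'] Cons.prems assms(1)[of x y] assms(2)[of x y] by auto
qed

section \<open>Spanning trees and contractions\<close>

lemma graft_leaf:
  assumes "distinct (nodes t)" and "p \<in> set (nodes t)" and "c \<notin> set (nodes t)"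
  shows "\<exists>t'. distinct (nodes t') \<and> set (nodes t') = insert c (set (nodes t)) \<and>
    arcs t' = insert (p, c) (arcs t) \<and> root_of t' = root_of t"
  using assms
proof (induction t rule: nodes.induct)
  case (1 x ts)
  show ?case
  proof (cases "p = x")
    case True
    then show ?thesis using "1.prems" by (intro exI[of _ "Node x (Node c [] # ts)"]) auto
  next
    case False
    then obtain t where t: "t \<in> set ts" "p \<in> set (nodes t)" using "1.prems" by auto
    then obtain us vs where ts: "ts = us @ t # vs" using split_list by metis
    obtain t' where "distinct (nodes t')" "set (nodes t') = insert c (set (nodes t))"
      "arcs t' = insert (p, c) (arcs t)" "root_of t' = root_of t"
      using "1.IH"[OF t(1)] "1.prems" t ts by auto
    then show ?thesis using "1.prems" ts by (intro exI[of _ "Node x (us @ t' # vs)"]) auto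
  qed
qed

text \<open>\<open>\<epsilon> b\<close> is the edge that joins \<open>b\<close> to its parent; with
  parallel edges the arc alone would not determine it. At the root \<open>\<epsilon>\<close> is
  unconstrained, so the tree edges are the image of the other vertices.\<close>

definition spanning_tree :: "('v, 'e, 'z) multigraph_scheme \<Rightarrow> 'v rtree \<Rightarrow> ('v \<Rightarrow> 'e) \<Rightarrow> bool" where
  "spanning_tree G t \<epsilon> \<longleftrightarrow> distinct (nodes t) \<and> set (nodes t) = verts G \<and>
     (\<forall>(a, b)\<in>arcs t. \<epsilon> b \<in> edges G \<and> ends G (\<epsilon> b) = {a, b})"

lemma finite_graphD:
  assumes "finite_graph G"
  shows "finite (verts G)" and "finite (edges G)"
    and "e \<in> edges G \<Longrightarrow> ends G e \<subseteq> verts G"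
    and "e \<in> edges G \<Longrightarrow> card (ends G e) = 1 \<or> card (ends G e) = 2"
    and "ends G \<in> extensional (edges G)"
  using assms unfolding finite_graph_def by (auto simp: PiE_def Pi_def)

lemma connected_graph_leave:
  assumes "connected_graph G" and "W \<subseteq> verts G" and "r \<in> W" and "W \<noteq> verts G"
  obtains e a b where "e \<in> edges G" and "ends G e = {a, b}" and "a \<in> W" and "b \<in> verts G - W"
proof -
  have fin: "finite_graph G" using assms(1) by (simp add: connected_graph_def)
  obtain v where v: "v \<in> verts G" "v \<notin> W" using assms by blast
  have "(r, v) \<in> (adjacency G)\<^sup>*" using assms v by (auto simp: connected_graph_def)
  then have "v \<in> W \<or> (\<exists>a b. (a, b) \<in> adjacency G \<and> a \<in> W \<and> b \<notin> W)"
    by (induction rule: rtrancl_induct) (use \<open>r \<in> W\<close> in auto)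
  then obtain a b e where "e \<in> edges G" "ends G e = {a, b}" "a \<in> W" "b \<notin> W"
    using v by (auto simp: adjacency_def)
  then show thesis using that finite_graphD(3)[OF fin, of e] by auto
qed

text \<open>A subtree with the largest number of nodes spans \<open>G\<close>: if vertices were
  missing, connectedness would yield an edge leaving it, whose far end could be grafted as a
  leaf.\<close>

lemma spanning_tree_exists:
  assumes G: "connected_graph G"
  shows "\<exists>t \<epsilon>. spanning_tree G t \<epsilon>"
proof -
  define P where "P t \<longleftrightarrow> distinct (nodes t) \<and> set (nodes t) \<subseteq> verts G \<and>
    (\<exists>\<epsilon>. \<forall>(a, b)\<in>arcs t. \<epsilon> b \<in> edges G \<and> ends G (\<epsilon> b) = {a, b})" for t
  have fin: "finite_graph G" using G by (simp add: connected_graph_def)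
  obtain r where "r \<in> verts G" using G by (auto simp: connected_graph_def)
  then have "P (Node r [])" by (simp add: P_def)
  moreover have "length (nodes t) < Suc (card (verts G))" if "P t" for t
    using that card_mono[OF finite_graphD(1)[OF fin], of "set (nodes t)"]
    by (simp add: P_def distinct_card less_Suc_eq_le)
  ultimately obtain t where t: "P t" and max: "\<And>s. P s \<Longrightarrow> length (nodes s) \<le> length (nodes t)"
    using ex_has_greatest_nat[of P "Node r []" "\<lambda>t. length (nodes t)" "Suc (card (verts G))"] by blast
  obtain \<epsilon> where \<epsilon>: "\<forall>(a, b)\<in>arcs t. \<epsilon> b \<in> edges G \<and> ends G (\<epsilon> b) = {a, b}"
    using t by (auto simp: P_def)
  have "set (nodes t) = verts G"
  proof (rule ccontr)
    assume "set (nodes t) \<noteq> verts G"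
    moreover have "set (nodes t) \<subseteq> verts G" using t by (simp add: P_def)
    ultimately obtain e a b where e: "e \<in> edges G" "ends G e = {a, b}" "a \<in> set (nodes t)"
        "b \<in> verts G - set (nodes t)"
      using connected_graph_leave[OF G _ root_in_nodes] by metis
    obtain t' where t': "distinct (nodes t')" "set (nodes t') = insert b (set (nodes t))"
        "arcs t' = insert (a, b) (arcs t)"
      using graft_leaf[of t a b] e t by (auto simp: P_def)
    have "(\<epsilon>(b := e)) y \<in> edges G \<and> ends G ((\<epsilon>(b := e)) y) = {x, y}" if "(x, y) \<in> arcs t'" for x y
    proof (cases "(x, y) \<in> arcs t")
      case True
      then have "y \<noteq> b" using e(4) arcs_in_nodes[OF True] by auto
      then show ?thesis using \<epsilon> True by auto
    next
      case False
      then show ?thesis using that e t' by auto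
    qed
    then have "\<forall>(x, y)\<in>arcs t'. (\<epsilon>(b := e)) y \<in> edges G \<and> ends G ((\<epsilon>(b := e)) y) = {x, y}"
      by blast
    moreover have "set (nodes t') \<subseteq> verts G" using t t' e by (simp add: P_def)
    ultimately have "P t'" using t' unfolding P_def by blast
    moreover have "length (nodes t') = Suc (length (nodes t))"
      using t t' e distinct_card[of "nodes t'"] distinct_card[of "nodes t"] by (simp add: P_def)
    ultimately show False using max by fastforce
  qed
  then show ?thesis using t \<epsilon> unfolding spanning_tree_def P_def by blast
qed

lemma spanning_tree_ends:
  assumes "spanning_tree G t \<epsilon>" and "v \<in> verts G" and "v \<noteq> root_of t"
  obtains a where "(a, v) \<in> arcs t" and "\<epsilon> v \<in> edges G" and "ends G (\<epsilon> v) = {a, v}"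
    and "a \<in> verts G"
proof -
  obtain a where "(a, v) \<in> arcs t" using assms parent_arc by (metis spanning_tree_def)
  then show thesis using that assms arcs_in_nodes[of a v t] unfolding spanning_tree_def by fastforce
qed

text \<open>If one edge joined two vertices to their parents, each would be the parent of the other,
  although parents precede children in preorder.\<close>

lemma spanning_tree_inj:
  assumes st: "spanning_tree G t \<epsilon>"
  shows "inj_on \<epsilon> (verts G - {root_of t})"
proof (rule inj_onI)
  fix v w assume v: "v \<in> verts G - {root_of t}" and w: "w \<in> verts G - {root_of t}" and eq: "\<epsilon> v = \<epsilon> w"
  obtain a where a: "(a, v) \<in> arcs t" "ends G (\<epsilon> v) = {a, v}" using spanning_tree_ends[OF st] v by blast
  obtain b where b: "(b, w) \<in> arcs t" "ends G (\<epsilon> w) = {b, w}" using spanning_tree_ends[OF st] w by blast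
  show "v = w"
  proof (rule ccontr)
    assume "v \<noteq> w"
    then have "a = w" "b = v" using a b eq by (auto simp: doubleton_eq_iff)
    then show False using arcs_subseq[OF a(1)] arcs_subseq[OF b(1)] subseq_pair_antisym st
      by (metis spanning_tree_def)
  qed
qed

lemma spanning_tree_card:
  assumes st: "spanning_tree G t \<epsilon>" and fin: "finite (verts G)"
  shows "Suc (card (\<epsilon> ` (verts G - {root_of t}))) = card (verts G)"
    and "\<epsilon> ` (verts G - {root_of t}) \<subseteq> edges G"
proof -
  have r: "root_of t \<in> verts G" using st root_in_nodes[of t] by (auto simp: spanning_tree_def)
  show "Suc (card (\<epsilon> ` (verts G - {root_of t}))) = card (verts G)"
    using card_image[OF spanning_tree_inj[OF st]] card.remove[OF fin r] by simp
  show "\<epsilon> ` (verts G - {root_of t}) \<subseteq> edges G"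
    using spanning_tree_ends[OF st] by blast
qed

lemma connected_graph_card:
  assumes "connected_graph G"
  shows "card (verts G) \<le> Suc (card (edges G))"
proof -
  have fin: "finite (verts G)" "finite (edges G)"
    using assms finite_graphD by (auto simp: connected_graph_def)
  obtain t \<epsilon> where st: "spanning_tree G t \<epsilon>" using spanning_tree_exists[OF assms] by blast
  show ?thesis
    using spanning_tree_card[OF st fin(1)] card_mono[OF fin(2)] by (metis Suc_le_mono)
qed

text \<open>In a cycle of tree edges, both edges at the vertex that is last in preorder would have to be
  the edge to its parent.\<close>

lemma spanning_tree_acyclic:
  assumes st: "spanning_tree G t \<epsilon>" and E: "edges G \<subseteq> \<epsilon> ` (verts G - {root_of t})"
  shows "\<not> cycle_in G vs es"
proof
  assume cyc: "cycle_in G vs es"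
  then have vs: "vs \<noteq> []" "length es = length vs" "distinct es" "set vs \<subseteq> verts G" "set es \<subseteq> edges G"
    and dvs: "distinct vs"
    and ends: "\<And>i. i < length vs \<Longrightarrow> ends G (es ! i) = {vs ! i, vs ! (Suc i mod length vs)}"
    by (auto simp: cycle_in_def)
  have d: "distinct (nodes t)" using st by (simp add: spanning_tree_def)
  have nodes: "set vs \<subseteq> set (nodes t)" using vs st by (simp add: spanning_tree_def)
  have edge: "\<exists>b a. e = \<epsilon> b \<and> (a, b) \<in> arcs t \<and> ends G e = {a, b}" if e: "e \<in> edges G" for e
  proof -
    obtain b where b: "b \<in> verts G" "b \<noteq> root_of t" "e = \<epsilon> b" using E e by auto
    then show ?thesis using spanning_tree_ends[OF st b(1,2)] by metis
  qed
  let ?pos = "pos (nodes t)"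
  obtain i where i: "i < length vs" and max: "\<And>y. y \<in> set vs \<Longrightarrow> ?pos y \<le> ?pos (vs ! i)"
  proof -
    obtain x where "x \<in> set vs" "?pos x = Max (?pos ` set vs)"
      using Max_in[of "?pos ` set vs"] vs(1) by (metis (no_types, lifting) finite_imageI
        finite_set image_iff image_is_empty set_empty)
    then show thesis using that by (metis (no_types, lifting) List.finite_set Max_ge finite_imageI
        imageI in_set_conv_nth)
  qed
  let ?x = "vs ! i" and ?n = "length vs"
  have last: "e = \<epsilon> ?x \<and> y \<noteq> ?x" if e: "e \<in> edges G" "ends G e = {?x, y}" "y \<in> set vs" for e y
  proof -
    obtain a b where ab: "e = \<epsilon> b" "(a, b) \<in> arcs t" "{a, b} = {?x, y}"
      using edge[OF e(1)] e(2) by metis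
    have lt: "?pos a < ?pos b" using arcs_subseq[OF ab(2)] arcs_in_nodes[OF ab(2)] pos_less_iff[OF d] by blast
    have "b \<in> {?x, y}" using ab(3) by blast
    then have "?pos b \<le> ?pos ?x" using max e(3) by auto
    then have "a \<noteq> ?x" using lt by auto
    then show ?thesis using ab by (metis doubleton_eq_iff)
  qed
  have in_es: "es ! j \<in> edges G" if "j < ?n" for j using vs that nth_mem by (metis subsetD)
  have 1: "es ! i = \<epsilon> ?x \<and> vs ! (Suc i mod ?n) \<noteq> ?x"
  proof (rule last[OF in_es[OF i] ends[OF i]])
    show "vs ! (Suc i mod ?n) \<in> set vs" using i by (intro nth_mem mod_less_divisor) auto
  qed
  define j where "j = (if i = 0 then ?n - 1 else i - 1)"
  have j: "j < ?n" "Suc j mod ?n = i" using i by (auto simp: j_def)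
  have 2: "es ! j = \<epsilon> ?x"
    using last[OF in_es[OF j(1)], of "vs ! j"] ends[OF j(1)] j by (simp add: insert_commute)
  \<comment> \<open>Both edges at the last vertex are \<open>\<epsilon> ?x\<close>, so distinctness
    of \<open>es\<close> makes \<open>i\<close> its own cyclic predecessor. The cycle is then a
    loop, but a tree edge joins two different vertices.\<close>
  have "i = j" using 1 2 i j vs by (metis nth_eq_iff_index_eq)
  then have "?n = 1" using i vs(1) by (auto simp: j_def le_Suc_eq split: if_splits)
  then show False using 1 i by simp
qed

text \<open>A spanning tree has one edge fewer than there are vertices, so here it contains every
  edge of \<open>G\<close>.\<close>

lemma tree_if_card:
  assumes G: "connected_graph G" and card: "Suc (card (edges G)) = card (verts G)"
  shows "tree G"
proof -
  have fin: "finite (verts G)" "finite (edges G)"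
    using G finite_graphD by (auto simp: connected_graph_def)
  obtain t \<epsilon> where st: "spanning_tree G t \<epsilon>" using spanning_tree_exists[OF G] by blast
  have "\<epsilon> ` (verts G - {root_of t}) = edges G"
    using spanning_tree_card[OF st fin(1)] card card_subset_eq[OF fin(2)] by simp
  then show ?thesis using spanning_tree_acyclic[OF st] G by (auto simp: tree_def)
qed

section \<open>Contractions as maps with connected fibres\<close>

definition collapsed :: "('v, 'e, 'z) multigraph_scheme \<Rightarrow> ('v + 'e \<Rightarrow> 'w + 'f) \<Rightarrow> 'v rel" where
  "collapsed G \<phi> = {(a, b). \<exists>e\<in>edges G. \<phi> (Inr e) \<in> range Inl \<and> ends G e = {a, b}}"

text \<open>Contractions with the subtree condition weakened to connected fibres, the form in which
  maps are built and composed below; \<open>contractions_iff\<close> shows that nothing is lost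
  between graphs of the same genus. Connectedness is expressed by paths of collapsed edges in
  \<open>G\<close>, without forming the fibre as a graph of its own.\<close>

definition connected_contraction ::
  "('v, 'e, 'l) labeled_graph \<Rightarrow> ('v, 'e, 'l) labeled_graph \<Rightarrow> ('v + 'e \<Rightarrow> 'v + 'e) \<Rightarrow> bool" where
  "connected_contraction G G' \<phi> \<longleftrightarrow> \<phi> \<in> cells G \<rightarrow>\<^sub>E cells G' \<and>
     (\<forall>v\<in>verts G. \<phi> (Inl v) \<in> Inl ` verts G') \<and>
     (\<forall>v'\<in>verts G'. \<exists>v\<in>verts G. \<phi> (Inl v) = Inl v') \<and>
     (\<forall>e\<in>edges G. \<forall>x. \<phi> (Inr e) = Inl x \<longrightarrow> (\<forall>a\<in>ends G e. \<phi> (Inl a) = Inl x)) \<and>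
     (\<forall>e\<in>edges G. \<forall>h. \<phi> (Inr e) = Inr h \<longrightarrow>
        (\<lambda>a. \<phi> (Inl a)) ` ends G e = Inl ` ends G' h \<and> label G' h = label G e) \<and>
     (\<forall>h\<in>edges G'. \<exists>!e. e \<in> edges G \<and> \<phi> (Inr e) = Inr h) \<and>
     (\<forall>a\<in>verts G. \<forall>b\<in>verts G. \<phi> (Inl a) = \<phi> (Inl b) \<longrightarrow> (a, b) \<in> (collapsed G \<phi>)\<^sup>*)"

lemma cells_Inl [simp]: "Inl v \<in> cells G \<longleftrightarrow> v \<in> verts G"
  and cells_Inr [simp]: "Inr e \<in> cells G \<longleftrightarrow> e \<in> edges G"
  by (auto simp: cells_def)

lemma connected_contractionD:
  assumes "connected_contraction G G' \<phi>"
  shows "\<phi> \<in> cells G \<rightarrow>\<^sub>E cells G'"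
    and "\<And>x. x \<in> cells G \<Longrightarrow> \<phi> x \<in> cells G'"
    and "\<And>v. v \<in> verts G \<Longrightarrow> \<phi> (Inl v) \<in> Inl ` verts G'"
    and "\<And>v'. v' \<in> verts G' \<Longrightarrow> \<exists>v\<in>verts G. \<phi> (Inl v) = Inl v'"
    and "\<And>e x a. \<lbrakk>e \<in> edges G; \<phi> (Inr e) = Inl x; a \<in> ends G e\<rbrakk> \<Longrightarrow> \<phi> (Inl a) = Inl x"
    and "\<And>e h. \<lbrakk>e \<in> edges G; \<phi> (Inr e) = Inr h\<rbrakk> \<Longrightarrow> (\<lambda>a. \<phi> (Inl a)) ` ends G e = Inl ` ends G' h"
    and "\<And>e h. \<lbrakk>e \<in> edges G; \<phi> (Inr e) = Inr h\<rbrakk> \<Longrightarrow> label G' h = label G e"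
    and "\<And>h. h \<in> edges G' \<Longrightarrow> \<exists>!e. e \<in> edges G \<and> \<phi> (Inr e) = Inr h"
    and "\<And>a b. \<lbrakk>a \<in> verts G; b \<in> verts G; \<phi> (Inl a) = \<phi> (Inl b)\<rbrakk> \<Longrightarrow> (a, b) \<in> (collapsed G \<phi>)\<^sup>*"
  using assms by (simp_all add: connected_contraction_def PiE_iff)

lemma connected_contractionI:
  assumes "\<phi> \<in> cells G \<rightarrow>\<^sub>E cells G'"
    and "\<And>v. v \<in> verts G \<Longrightarrow> \<phi> (Inl v) \<in> Inl ` verts G'"
    and "\<And>v'. v' \<in> verts G' \<Longrightarrow> \<exists>v\<in>verts G. \<phi> (Inl v) = Inl v'"
    and "\<And>e x a. \<lbrakk>e \<in> edges G; \<phi> (Inr e) = Inl x; a \<in> ends G e\<rbrakk> \<Longrightarrow> \<phi> (Inl a) = Inl x"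
    and "\<And>e h. \<lbrakk>e \<in> edges G; \<phi> (Inr e) = Inr h\<rbrakk> \<Longrightarrow> (\<lambda>a. \<phi> (Inl a)) ` ends G e = Inl ` ends G' h"
    and "\<And>e h. \<lbrakk>e \<in> edges G; \<phi> (Inr e) = Inr h\<rbrakk> \<Longrightarrow> label G' h = label G e"
    and "\<And>h. h \<in> edges G' \<Longrightarrow> \<exists>!e. e \<in> edges G \<and> \<phi> (Inr e) = Inr h"
    and "\<And>a b. \<lbrakk>a \<in> verts G; b \<in> verts G; \<phi> (Inl a) = \<phi> (Inl b)\<rbrakk> \<Longrightarrow> (a, b) \<in> (collapsed G \<phi>)\<^sup>*"
  shows "connected_contraction G G' \<phi>"
  unfolding connected_contraction_def by (intro conjI ballI allI impI) (rule assms; assumption)+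

lemma contractions_imp_connected:
  assumes c: "\<phi> \<in> contractions G G'"
  shows "connected_contraction G G' \<phi>"
proof -
  have \<phi>: "\<phi> \<in> cells G \<rightarrow>\<^sub>E cells G'"
    and im: "\<phi> ` Inl ` verts G = Inl ` verts G'"
    and bd: "\<And>e. e \<in> edges G \<Longrightarrow> \<phi> ` bdry G (Inr e) = bdry G' (\<phi> (Inr e))"
    and bij: "bij_betw \<phi> {c \<in> cells G. \<phi> c \<in> Inr ` edges G'} (Inr ` edges G')"
    and lab: "\<And>e e'. \<lbrakk>e \<in> edges G; e' \<in> edges G'; \<phi> (Inr e) = Inr e'\<rbrakk> \<Longrightarrow> label G' e' = label G e"
    and tr: "\<And>v. v \<in> verts G' \<Longrightarrow> cells_subtree G {c \<in> cells G. \<phi> c = Inl v}"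
    using c unfolding contractions_def by blast+
  have v: "\<phi> (Inl v) \<in> Inl ` verts G'" if "v \<in> verts G" for v using im that by auto
  have 6: "\<exists>!e. e \<in> edges G \<and> \<phi> (Inr e) = Inr h" if h: "h \<in> edges G'" for h
  proof -
    have "Inr h \<in> \<phi> ` {c \<in> cells G. \<phi> c \<in> Inr ` edges G'}" using bij h by (simp add: bij_betw_def)
    then obtain x where x: "x \<in> cells G" "\<phi> x = Inr h" by auto
    then obtain e where e: "x = Inr e" using v[of "projl x"] by (cases x) force+
    show ?thesis
    proof (rule ex1I[of _ e])
      show "e \<in> edges G \<and> \<phi> (Inr e) = Inr h" using x e by simp
      fix e' assume e': "e' \<in> edges G \<and> \<phi> (Inr e') = Inr h"
      have "inj_on \<phi> {c \<in> cells G. \<phi> c \<in> Inr ` edges G'}" using bij by (simp add: bij_betw_def)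
      from inj_onD[OF this, of "Inr e'" "Inr e"] show "e' = e" using e' x e h by auto
    qed
  qed
  have 7: "(a, b) \<in> (collapsed G \<phi>)\<^sup>*"
    if ab: "a \<in> verts G" "b \<in> verts G" "\<phi> (Inl a) = \<phi> (Inl b)" for a b
  proof -
    obtain x where x: "x \<in> verts G'" "\<phi> (Inl a) = Inl x" using v ab by blast
    let ?C = "{c \<in> cells G. \<phi> c = Inl x}"
    let ?F = "\<lparr>verts = Inl -` ?C, edges = Inr -` ?C, ends = restrict (ends G) (Inr -` ?C)\<rparr>"
    have "connected_graph ?F" using tr[OF x(1)] by (simp add: cells_subtree_def tree_def)
    then have "(a, b) \<in> (adjacency ?F)\<^sup>*" using ab x unfolding connected_graph_def by simp
    moreover have "adjacency ?F \<subseteq> collapsed G \<phi>"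
      by (auto simp: adjacency_def collapsed_def)
    ultimately show ?thesis using rtrancl_mono by blast
  qed
  have 4: "\<phi> (Inl a) = Inl x" if "e \<in> edges G" "\<phi> (Inr e) = Inl x" "a \<in> ends G e" for e x a
    using bd[OF that(1)] that by auto
  have 5: "(\<lambda>a. \<phi> (Inl a)) ` ends G e = Inl ` ends G' h \<and> label G' h = label G e"
    if e: "e \<in> edges G" "\<phi> (Inr e) = Inr h" for e h
  proof -
    have "\<phi> (Inr e) \<in> cells G'" using \<phi> e(1) by (auto simp: PiE_iff)
    then have "h \<in> edges G'" using e by simp
    then show ?thesis using lab bd[OF e(1)] e by (simp add: image_image)
  qed
  have 3: "\<exists>v\<in>verts G. \<phi> (Inl v) = Inl v'" if "v' \<in> verts G'" for v'
  proof -
    have "Inl v' \<in> \<phi> ` Inl ` verts G" using im that by simp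
    then show ?thesis by auto
  qed
  show ?thesis
    by (rule connected_contractionI)
      (fact \<phi> | erule v | erule 3 | erule (2) 4 | erule (1) 5[THEN conjunct1] |
        erule (1) 5[THEN conjunct2] | erule 6 | erule (2) 7)+
qed

text \<open>The work lies in the connectedness of fibres. A path of collapsed edges in
  \<open>G'\<close> lifts edge by edge to \<open>G\<close>; the lifted edges are linked inside
  fibres of \<open>\<psi>\<close>, which are connected and whose edges remain collapsed.\<close>

lemma connected_contraction_compose:
  assumes \<psi>: "connected_contraction G G' \<psi>" and \<phi>: "connected_contraction G' G'' \<phi>"
    and fin: "finite_graph G" "finite_graph G'"
  shows "connected_contraction G G'' (compose (cells G) \<phi> \<psi>)" (is "connected_contraction _ _ ?c")
proof -
  have \<psi>_cells: "\<psi> x \<in> cells G'" if "x \<in> cells G" for x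
    using connected_contractionD(2)[OF \<psi> that] .
  have cv: "?c (Inl v) = \<phi> (\<psi> (Inl v))" if "v \<in> verts G" for v using that by (simp add: compose_def)
  have ce: "?c (Inr e) = \<phi> (\<psi> (Inr e))" if "e \<in> edges G" for e using that by (simp add: compose_def)
  have ends: "v \<in> verts G" if "e \<in> edges G" "v \<in> ends G e" for e v
    using finite_graphD(3)[OF fin(1)] that by blast
  have 1: "?c \<in> cells G \<rightarrow>\<^sub>E cells G''"
    using connected_contractionD(2)[OF \<psi>] connected_contractionD(2)[OF \<phi>]
    by (auto simp: compose_def PiE_iff)
  have \<psi>v: "\<exists>v'\<in>verts G'. \<psi> (Inl v) = Inl v'" if "v \<in> verts G" for v
    using connected_contractionD(3)[OF \<psi> that] by blast
  have \<phi>v: "\<exists>v'\<in>verts G''. \<phi> (Inl v) = Inl v'" if "v \<in> verts G'" for v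
    using connected_contractionD(3)[OF \<phi> that] by blast
  have 2: "?c (Inl v) \<in> Inl ` verts G''" if "v \<in> verts G" for v
    using \<psi>v[OF that] connected_contractionD(3)[OF \<phi>] cv[OF that] by auto
  have 3: "\<exists>v\<in>verts G. ?c (Inl v) = Inl w" if w: "w \<in> verts G''" for w
  proof -
    obtain u where "u \<in> verts G'" "\<phi> (Inl u) = Inl w"
      using connected_contractionD(4)[OF \<phi> w] by blast
    moreover obtain v where "v \<in> verts G" "\<psi> (Inl v) = Inl u"
      using connected_contractionD(4)[OF \<psi>] calculation by blast
    ultimately show ?thesis using cv by metis
  qed
  have \<psi>collapse: "\<psi> (Inl a) = Inl x" if "e \<in> edges G" "\<psi> (Inr e) = Inl x" "a \<in> ends G e" for e x a
    using connected_contractionD(5)[OF \<psi> that] .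
  have \<psi>edge: "(\<lambda>a. \<psi> (Inl a)) ` ends G e = Inl ` ends G' h" "label G' h = label G e" "h \<in> edges G'"
    if "e \<in> edges G" "\<psi> (Inr e) = Inr h" for e h
    using connected_contractionD(6,7)[OF \<psi> that] \<psi>_cells[of "Inr e"] that by auto
  have 4: "?c (Inl a) = Inl x" if e: "e \<in> edges G" "?c (Inr e) = Inl x" "a \<in> ends G e" for e x a
  proof (cases "\<psi> (Inr e)")
    case (Inl y)
    then show ?thesis using \<psi>collapse[OF e(1) Inl e(3)] e ce cv ends by simp
  next
    case (Inr h)
    have "\<psi> (Inl a) \<in> Inl ` ends G' h" using \<psi>edge(1)[OF e(1) Inr] e(3) by blast
    then obtain b where b: "b \<in> ends G' h" "\<psi> (Inl a) = Inl b" by blast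
    have "\<phi> (Inr h) = Inl x" using ce e Inr by simp
    then have "\<phi> (Inl b) = Inl x"
      using connected_contractionD(5)[OF \<phi> \<psi>edge(3)[OF e(1) Inr]] b by blast
    then show ?thesis using cv ends e b by simp
  qed
  have 5: "(\<lambda>a. ?c (Inl a)) ` ends G e = Inl ` ends G'' k \<and> label G'' k = label G e"
    if e: "e \<in> edges G" "?c (Inr e) = Inr k" for e k
  proof (cases "\<psi> (Inr e)")
    case (Inl y)
    have "y \<in> verts G'" using \<psi>_cells[of "Inr e"] e(1) Inl by simp
    then show ?thesis using \<phi>v ce[OF e(1)] Inl e(2) by force
  next
    case (Inr h)
    note h = \<psi>edge[OF e(1) Inr]
    have "\<phi> (Inr h) = Inr k" using ce e Inr by simp
    then have k: "(\<lambda>a. \<phi> (Inl a)) ` ends G' h = Inl ` ends G'' k" "label G'' k = label G' h"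
      using connected_contractionD(6,7)[OF \<phi> h(3)] by blast+
    have "(\<lambda>a. ?c (Inl a)) ` ends G e = \<phi> ` (\<lambda>a. \<psi> (Inl a)) ` ends G e"
      using cv ends[OF e(1)] by (simp add: image_image)
    then show ?thesis using h k by (simp add: image_image)
  qed
  have 6: "\<exists>!e. e \<in> edges G \<and> ?c (Inr e) = Inr k" if k: "k \<in> edges G''" for k
  proof -
    have ex1: "\<exists>!h. h \<in> edges G' \<and> \<phi> (Inr h) = Inr k"
      using connected_contractionD(8)[OF \<phi> k] .
    then obtain h where h: "h \<in> edges G'" "\<phi> (Inr h) = Inr k" by blast
    have ex1': "\<exists>!e. e \<in> edges G \<and> \<psi> (Inr e) = Inr h"
      using connected_contractionD(8)[OF \<psi> h(1)] .
    then obtain e where e: "e \<in> edges G" "\<psi> (Inr e) = Inr h" by blast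
    show ?thesis
    proof (rule ex1I[of _ e])
      show "e \<in> edges G \<and> ?c (Inr e) = Inr k" using e h ce by simp
      fix e' assume e': "e' \<in> edges G \<and> ?c (Inr e') = Inr k"
      have "\<psi> (Inr e') = Inr h"
      proof (cases "\<psi> (Inr e')")
        case (Inl y)
        then have "y \<in> verts G'" using \<psi>_cells[of "Inr e'"] e' by simp
        then show ?thesis using \<phi>v[of y] e' ce[of e'] Inl by auto
      next
        case (Inr h')
        then have "h' \<in> edges G'" using \<psi>_cells[of "Inr e'"] e' by simp
        then show ?thesis using ex1 h e' ce[of e'] Inr by auto
      qed
      then show "e' = e" using e e' ex1' by blast
    qed
  qed
  have lift\<psi>: "(a, b) \<in> (collapsed G ?c)\<^sup>*"
    if ab: "a \<in> verts G" "b \<in> verts G" "\<psi> (Inl a) = \<psi> (Inl b)" for a b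
  proof -
    have "collapsed G \<psi> \<subseteq> collapsed G ?c"
    proof (rule subrelI)
      fix a b assume "(a, b) \<in> collapsed G \<psi>"
      then obtain e x where e: "e \<in> edges G" "ends G e = {a, b}" "\<psi> (Inr e) = Inl x"
        by (auto simp: collapsed_def)
      then have "x \<in> verts G'" using \<psi>_cells[of "Inr e"] by simp
      then have "?c (Inr e) \<in> range Inl" using \<phi>v ce[OF e(1)] e(3) by auto
      then show "(a, b) \<in> collapsed G ?c" using e by (auto simp: collapsed_def)
    qed
    moreover have "(a, b) \<in> (collapsed G \<psi>)\<^sup>*"
      using connected_contractionD(9)[OF \<psi> ab] .
    ultimately show ?thesis using rtrancl_mono by blast
  qed
  have 7: "(a, b) \<in> (collapsed G ?c)\<^sup>*"
    if ab: "a \<in> verts G" "b \<in> verts G" "?c (Inl a) = ?c (Inl b)" for a b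
  proof -
    obtain x y where x: "x \<in> verts G'" "\<psi> (Inl a) = Inl x" and y: "y \<in> verts G'" "\<psi> (Inl b) = Inl y"
      using \<psi>v ab by meson
    have "(x, y) \<in> (collapsed G' \<phi>)\<^sup>*"
      using connected_contractionD(9)[OF \<phi>] x y ab cv by simp
    then have "\<forall>b\<in>verts G. \<psi> (Inl b) = Inl y \<longrightarrow> (a, b) \<in> (collapsed G ?c)\<^sup>*"
    proof (induction rule: rtrancl_induct)
      case base
      then show ?case using lift\<psi> ab x by metis
    next
      case (step y z)
      show ?case
      proof (cases "y = z")
        case True
        then show ?thesis using step.IH by simp
      next
        case False
        obtain h where h: "h \<in> edges G'" "\<phi> (Inr h) \<in> range Inl" "ends G' h = {y, z}"
          using step.hyps(2) by (auto simp: collapsed_def)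
        obtain e where e: "e \<in> edges G" "\<psi> (Inr e) = Inr h"
          using connected_contractionD(8)[OF \<psi> h(1)] by blast
        have im: "(\<lambda>a. \<psi> (Inl a)) ` ends G e = {Inl y, Inl z}" using \<psi>edge(1)[OF e] h(3) by simp
        then obtain a1 b1 where a1: "a1 \<in> ends G e" "\<psi> (Inl a1) = Inl y"
          and b1: "b1 \<in> ends G e" "\<psi> (Inl b1) = Inl z" by (smt (verit) imageE insertI1 insertI2)
        \<comment> \<open>An edge has at most two ends, and those of \<open>e\<close> map onto the
          different vertices \<open>y\<close> and \<open>z\<close>, so \<open>a1\<close> and
          \<open>b1\<close> are all of them.\<close>
        have ne: "a1 \<noteq> b1" using a1 b1 False by auto
        have "ends G e = {a1, b1}"
        proof -
          have "card {a1, b1} = 2" using ne by simp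
          moreover have "{a1, b1} \<subseteq> ends G e" using a1 b1 by simp
          moreover have "finite (ends G e)" "card (ends G e) \<le> 2"
            using finite_graphD(4)[OF fin(1) e(1)] by (auto intro: card_ge_0_finite)
          ultimately show ?thesis by (metis card_seteq)
        qed
        moreover have "?c (Inr e) \<in> range Inl" using ce e h by simp
        ultimately have "(a1, b1) \<in> collapsed G ?c" using e(1) by (auto simp: collapsed_def)
        moreover have "(a, a1) \<in> (collapsed G ?c)\<^sup>*" using step.IH a1 ends e(1) by blast
        ultimately have "(a, b1) \<in> (collapsed G ?c)\<^sup>*" by simp
        moreover have "(b1, b) \<in> (collapsed G ?c)\<^sup>*" if "b \<in> verts G" "\<psi> (Inl b) = Inl z" for b
          using lift\<psi>[of b1 b] that b1 ends e(1) by simp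
        ultimately show ?thesis by (meson rtrancl_trans)
      qed
    qed
    then show ?thesis using ab y by blast
  qed
  show ?thesis
    by (rule connected_contractionI)
      (fact 1 | erule 2 | erule 3 | erule (2) 4 | erule (1) 5[THEN conjunct1] |
        erule (1) 5[THEN conjunct2] | erule 6 | erule (2) 7)+
qed

text \<open>The vertices of \<open>G\<close> and the edges mapped to vertices are distributed over
  the fibres; the remaining edges match the edges of \<open>G'\<close>. The sum is therefore
  \<open>|E| - |E'| - |V| + |V'|\<close>, where the summands \<open>1\<close> account for
  \<open>|V'|\<close>.\<close>

lemma fibres_genus:
  assumes c: "connected_contraction G G' \<phi>" and fin: "finite_graph G" "finite_graph G'"
  shows "(\<Sum>v\<in>verts G'. int (card {e \<in> edges G. \<phi> (Inr e) = Inl v})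
      - int (card {u \<in> verts G. \<phi> (Inl u) = Inl v}) + 1) = genus G - genus G'"
proof -
  let ?E = "\<lambda>v. {e \<in> edges G. \<phi> (Inr e) = Inl v}" and ?V = "\<lambda>v. {u \<in> verts G. \<phi> (Inl u) = Inl v}"
  let ?H = "{e \<in> edges G. \<phi> (Inr e) \<in> range Inr}"
  note f = finite_graphD(1,2)[OF fin(1)] finite_graphD(1,2)[OF fin(2)]
  have "verts G = (\<Union>v\<in>verts G'. ?V v)" using connected_contractionD(3)[OF c] by blast
  then have V: "card (verts G) = (\<Sum>v\<in>verts G'. card (?V v))"
    by (rule trans[OF arg_cong[of _ _ card] card_UN_disjoint]) (use f in auto)
  have "edges G - ?H = (\<Union>v\<in>verts G'. ?E v)"
  proof -
    have "\<exists>v\<in>verts G'. \<phi> (Inr e) = Inl v" if "e \<in> edges G" "\<phi> (Inr e) \<notin> range Inr" for e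
      using connected_contractionD(2)[OF c, of "Inr e"] that by (cases "\<phi> (Inr e)") auto
    then show ?thesis by auto
  qed
  then have E: "card (edges G - ?H) = (\<Sum>v\<in>verts G'. card (?E v))"
    by (rule trans[OF arg_cong[of _ _ card] card_UN_disjoint]) (use f in auto)
  have "bij_betw (\<lambda>e. projr (\<phi> (Inr e))) ?H (edges G')"
  proof (rule bij_betw_imageI)
    have mem: "\<exists>h\<in>edges G'. \<phi> (Inr e) = Inr h" if "e \<in> ?H" for e
      using connected_contractionD(2)[OF c, of "Inr e"] that by auto
    show "inj_on (\<lambda>e. projr (\<phi> (Inr e))) ?H"
    proof (rule inj_onI)
      fix e e' assume e: "e \<in> ?H" "e' \<in> ?H" "projr (\<phi> (Inr e)) = projr (\<phi> (Inr e'))"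
      then obtain h where h: "h \<in> edges G'" "\<phi> (Inr e) = Inr h" "\<phi> (Inr e') = Inr h"
        using mem[OF e(1)] mem[OF e(2)] by auto
      then show "e = e'" using connected_contractionD(8)[OF c h(1)] e by blast
    qed
    show "(\<lambda>e. projr (\<phi> (Inr e))) ` ?H = edges G'"
    proof
      show "(\<lambda>e. projr (\<phi> (Inr e))) ` ?H \<subseteq> edges G'" using mem by fastforce
      show "edges G' \<subseteq> (\<lambda>e. projr (\<phi> (Inr e))) ` ?H"
      proof
        fix h assume "h \<in> edges G'"
        then obtain e where "e \<in> edges G" "\<phi> (Inr e) = Inr h"
          using connected_contractionD(8)[OF c] by blast
        then show "h \<in> (\<lambda>e. projr (\<phi> (Inr e))) ` ?H" by (intro image_eqI[of _ _ e]) auto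
      qed
    qed
  qed
  then have "card ?H = card (edges G')" by (rule bij_betw_same_card)
  moreover have "card (edges G) = card (edges G - ?H) + card ?H"
    using card_Diff_subset[of ?H "edges G"] card_mono[of "edges G" ?H] f by auto
  ultimately show ?thesis
    unfolding genus_def V E by (simp add: sum_subtractf sum.distrib E)
qed

text \<open>The fibres are connected, so their genera are nonnegative.  As these add up to the difference of
  the genera of the two graphs, they vanish, that is, the fibres are trees.\<close>

lemma connected_contraction_imp_contraction:
  assumes c: "connected_contraction G G' \<phi>" and fin: "finite_graph G" "finite_graph G'"
    and genus: "genus G = genus G'"
  shows "\<phi> \<in> contractions G G'"
proof -
  let ?E = "\<lambda>v. {e \<in> edges G. \<phi> (Inr e) = Inl v}" and ?V = "\<lambda>v. {u \<in> verts G. \<phi> (Inl u) = Inl v}"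
  let ?C = "\<lambda>v. {c \<in> cells G. \<phi> c = Inl v}"
  let ?F = "\<lambda>v. \<lparr>verts = Inl -` ?C v, edges = Inr -` ?C v, ends = restrict (ends G) (Inr -` ?C v)\<rparr>"
  note f = finite_graphD[OF fin(1)]
  have FV: "verts (?F v) = ?V v" and FE: "edges (?F v) = ?E v" for v by auto
  have conn: "connected_graph (?F v)" if v: "v \<in> verts G'" for v
  proof -
    have "finite_graph (?F v)"
    proof -
      have "ends G e \<subseteq> {u \<in> verts G. \<phi> (Inl u) = Inl v} \<and> (card (ends G e) = 1 \<or> card (ends G e) = 2)"
        if "e \<in> edges G" "\<phi> (Inr e) = Inl v" for e
        using connected_contractionD(5)[OF c that] f(3,4)[of e] that by auto
      then have "restrict (ends G) (Inr -` ?C v) \<in> Inr -` ?C v \<rightarrow>\<^sub>E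
          {B. B \<subseteq> Inl -` ?C v \<and> (card B = 1 \<or> card B = 2)}"
        by (auto simp: PiE_iff)
      moreover have "finite (Inl -` ?C v)" "finite (Inr -` ?C v)"
        using f(1,2) by (auto simp: vimage_def)
      ultimately show ?thesis unfolding finite_graph_def by simp
    qed
    moreover have "verts (?F v) \<noteq> {}" using connected_contractionD(4)[OF c v] by auto
    moreover have "(a, b) \<in> (adjacency (?F v))\<^sup>*" if ab: "a \<in> ?V v" "b \<in> ?V v" for a b
    proof -
      have "(a, b) \<in> (collapsed G \<phi>)\<^sup>*" using connected_contractionD(9)[OF c] ab by simp
      then have "\<phi> (Inl b) = Inl v \<and> (a, b) \<in> (adjacency (?F v))\<^sup>*"
      proof (induction rule: rtrancl_induct)
        case base
        then show ?case using ab by simp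
      next
        case (step y z)
        obtain e x where e: "e \<in> edges G" "\<phi> (Inr e) = Inl x" "ends G e = {y, z}"
          using step.hyps(2) by (auto simp: collapsed_def)
        then have "\<phi> (Inl y) = Inl x" "\<phi> (Inl z) = Inl x" using connected_contractionD(5)[OF c e(1,2)] by auto
        then have "\<phi> (Inl z) = Inl v" "x = v" using conjunct1[OF step.IH] by auto
        have "(y, z) \<in> adjacency (?F v)"
          using e \<open>x = v\<close> by (auto simp: adjacency_def intro!: bexI[of _ e])
        with conjunct2[OF step.IH] have "(a, z) \<in> (adjacency (?F v))\<^sup>*"
          by (rule rtrancl.rtrancl_into_rtrancl)
        with \<open>\<phi> (Inl z) = Inl v\<close> show ?case by (rule conjI)
      qed
      then show ?thesis by blast
    qed
    ultimately show ?thesis unfolding connected_graph_def FV by blast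
  qed
  have nonneg: "0 \<le> int (card (?E v)) - int (card (?V v)) + 1" if "v \<in> verts G'" for v
    using connected_graph_card[OF conn[OF that]] unfolding FV FE by linarith
  have sum0: "(\<Sum>v\<in>verts G'. int (card (?E v)) - int (card (?V v)) + 1) = 0"
    using fibres_genus[OF c fin] genus by simp
  have zero: "int (card (?E v)) - int (card (?V v)) + 1 = 0" if "v \<in> verts G'" for v
    by (rule sum_nonneg_0[OF finite_graphD(1)[OF fin(2)] nonneg sum0 that])
  have tr: "cells_subtree G (?C v)" if "v \<in> verts G'" for v
  proof -
    have "Suc (card (edges (?F v))) = card (verts (?F v))" using zero[OF that] unfolding FV FE by linarith
    then show ?thesis unfolding cells_subtree_def using tree_if_card[OF conn[OF that]] by auto
  qed
  have img: "\<phi> ` Inl ` verts G = Inl ` verts G'"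
  proof
    show "\<phi> ` Inl ` verts G \<subseteq> Inl ` verts G'" using connected_contractionD(3)[OF c] by blast
    show "Inl ` verts G' \<subseteq> \<phi> ` Inl ` verts G"
      using connected_contractionD(4)[OF c] by (metis (no_types, lifting) image_eqI image_subsetI)
  qed
  have bd: "\<phi> ` bdry G (Inr e) = bdry G' (\<phi> (Inr e))" if e: "e \<in> edges G" for e
  proof (cases "\<phi> (Inr e)")
    case (Inl x)
    have "ends G e \<noteq> {}" using f(4)[OF e] by auto
    then have "(\<lambda>a. \<phi> (Inl a)) ` ends G e = {Inl x}"
      using connected_contractionD(5)[OF c e Inl] by (simp add: image_constant_conv cong: image_cong)
    then show ?thesis using Inl by (simp add: image_image)
  next
    case (Inr h)
    then show ?thesis using connected_contractionD(6)[OF c e Inr] by (simp add: image_image)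
  qed
  have bij: "bij_betw \<phi> {c \<in> cells G. \<phi> c \<in> Inr ` edges G'} (Inr ` edges G')"
  proof (rule bij_betw_imageI)
    have shape: "\<exists>e h. x = Inr e \<and> e \<in> edges G \<and> h \<in> edges G' \<and> \<phi> x = Inr h"
      if "x \<in> {c \<in> cells G. \<phi> c \<in> Inr ` edges G'}" for x
      using that connected_contractionD(3)[OF c, of "projl x"] by (cases x) auto
    show "inj_on \<phi> {c \<in> cells G. \<phi> c \<in> Inr ` edges G'}"
    proof (rule inj_onI)
      fix x y assume x: "x \<in> {c \<in> cells G. \<phi> c \<in> Inr ` edges G'}"
        and y: "y \<in> {c \<in> cells G. \<phi> c \<in> Inr ` edges G'}" and eq: "\<phi> x = \<phi> y"
      obtain e h where e: "x = Inr e" "e \<in> edges G" "h \<in> edges G'" "\<phi> x = Inr h" using shape[OF x] by blast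
      obtain e' where e': "y = Inr e'" "e' \<in> edges G" using shape[OF y] by blast
      have "e = e'" using connected_contractionD(8)[OF c e(3)] e e' eq by metis
      then show "x = y" using e e' by simp
    qed
    show "\<phi> ` {c \<in> cells G. \<phi> c \<in> Inr ` edges G'} = Inr ` edges G'"
    proof
      show "Inr ` edges G' \<subseteq> \<phi> ` {c \<in> cells G. \<phi> c \<in> Inr ` edges G'}"
      proof clarify
        fix h assume h: "h \<in> edges G'"
        then obtain e where "e \<in> edges G" "\<phi> (Inr e) = Inr h"
          using connected_contractionD(8)[OF c] by blast
        then show "Inr h \<in> \<phi> ` {c \<in> cells G. \<phi> c \<in> Inr ` edges G'}"
          using h by (intro image_eqI[of _ _ "Inr e"]) auto
      qed
    qed auto
  qed
  have "label G' e' = label G e" if "e \<in> edges G" "\<phi> (Inr e) = Inr e'" for e e'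
    using connected_contractionD(7)[OF c that] .
  then show ?thesis
    unfolding contractions_def using connected_contractionD(1)[OF c] img bd bij tr by simp
qed

lemma graph_objD:
  assumes "G \<in> graph_obj g S"
  shows "connected_graph G" and "finite_graph G" and "genus G = int g"
    and "e \<in> edges G \<Longrightarrow> label G e \<in> S"
  using assms by (auto simp: graph_obj_def connected_graph_def PiE_iff)

lemma contractions_iff:
  assumes "G \<in> graph_obj g S" and "G' \<in> graph_obj g S"
  shows "\<phi> \<in> contractions G G' \<longleftrightarrow> connected_contraction G G' \<phi>"
  using contractions_imp_connected[of \<phi> G G'] connected_contraction_imp_contraction[of G G' \<phi>]
    graph_objD[OF assms(1)] graph_objD[OF assms(2)] by auto

lemma contractions_compose:
  assumes "G \<in> graph_obj g S" and "G' \<in> graph_obj g S" and "G'' \<in> graph_obj g S"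
    and "\<psi> \<in> contractions G G'" and "\<phi> \<in> contractions G' G''"
  shows "compose (cells G) \<phi> \<psi> \<in> contractions G G''"
  using assms connected_contraction_compose[of G G' \<psi> G'' \<phi>] contractions_iff graph_objD(2) by metis

section \<open>Rigidified graphs\<close>

definition rigidification ::
  "('v, 'e, 'z) multigraph_scheme \<Rightarrow> 'v rtree \<Rightarrow> ('v \<Rightarrow> 'e) \<Rightarrow> 'e list \<Rightarrow> bool" where
  "rigidification G t \<epsilon> xs \<longleftrightarrow> spanning_tree G t \<epsilon> \<and> distinct xs \<and>
     set xs = edges G - \<epsilon> ` (verts G - {root_of t})"

lemma rigidification_exists:
  assumes "connected_graph G"
  shows "\<exists>t \<epsilon> xs. rigidification G t \<epsilon> xs"
proof -
  obtain t \<epsilon> where st: "spanning_tree G t \<epsilon>" using spanning_tree_exists[OF assms] by blast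
  have "finite (edges G - \<epsilon> ` (verts G - {root_of t}))"
    using assms finite_graphD(2)[of G] by (simp add: connected_graph_def)
  then obtain xs where "set xs = edges G - \<epsilon> ` (verts G - {root_of t})" "distinct xs"
    using finite_distinct_list by metis
  then have "rigidification G t \<epsilon> xs" using st by (simp add: rigidification_def)
  then show ?thesis by blast
qed

text \<open>Outside a spanning tree there are \<open>|E| - (|V| - 1) = g\<close> edges. This common
  length keeps the set of node labels finite and lets the edges outside the trees of two graphs be
  matched by index.\<close>

lemma rigidification_length:
  assumes G: "G \<in> graph_obj g S" and r: "rigidification G t \<epsilon> xs"
  shows "length xs = g"
proof -
  have fin: "finite (verts G)" "finite (edges G)" using finite_graphD graph_objD(2)[OF G] by auto
  have st: "spanning_tree G t \<epsilon>" using r by (simp add: rigidification_def)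
  note c = spanning_tree_card[OF st fin(1)]
  have "length xs = card (edges G - \<epsilon> ` (verts G - {root_of t}))"
    using r distinct_card[of xs] by (simp add: rigidification_def)
  also have "\<dots> = card (edges G) - card (\<epsilon> ` (verts G - {root_of t}))"
    using c(2) fin by (intro card_Diff_subset) (auto intro: finite_subset)
  finally show ?thesis
    using c card_mono[OF fin(2) c(2)] graph_objD(3)[OF G] by (simp add: genus_def)
qed

text \<open>A vertex other than the root stands for the edge to its parent, and \<open>tl\<close>
  removes the root. A vertex map that preserves preorder thus preserves this part of the edge
  order.\<close>

definition edge_order :: "'v rtree \<Rightarrow> ('v \<Rightarrow> 'e) \<Rightarrow> 'e list \<Rightarrow> 'e list" where
  "edge_order t \<epsilon> xs = map \<epsilon> (tl (nodes t)) @ xs"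

lemma nodes_eq: "nodes t = root_of t # tl (nodes t)"
  by (cases t) simp

lemma tl_nodes: "distinct (nodes t) \<Longrightarrow> set (tl (nodes t)) = set (nodes t) - {root_of t}"
  by (cases t) auto

lemma edge_order:
  assumes "rigidification G t \<epsilon> xs" and "finite (verts G)"
  shows "distinct (edge_order t \<epsilon> xs)" and "set (edge_order t \<epsilon> xs) = edges G"
proof -
  have st: "spanning_tree G t \<epsilon>" using assms by (simp add: rigidification_def)
  then have t: "set (tl (nodes t)) = verts G - {root_of t}" "distinct (tl (nodes t))"
    using tl_nodes[of t] distinct_tl by (auto simp: spanning_tree_def)
  show "distinct (edge_order t \<epsilon> xs)"
    using spanning_tree_inj[OF st] assms t by (auto simp: edge_order_def rigidification_def distinct_map)
  show "set (edge_order t \<epsilon> xs) = edges G"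
    using spanning_tree_card(2)[OF st assms(2)] assms t by (auto simp: edge_order_def rigidification_def)
qed

text \<open>The label of a node \<open>v\<close> also describes the edge \<open>\<epsilon> v\<close> to its parent; the value \<^term>\<open>None\<close>
  at the root makes embeddings preserve the root.  The first component is the same at all nodes and
  describes the edges \<open>xs\<close> outside the spanning tree.\<close>

definition node_label ::
  "('v, 'e, 'l) labeled_graph \<Rightarrow> 'v rtree \<Rightarrow> ('v \<Rightarrow> 'e) \<Rightarrow> 'e list \<Rightarrow> 'i \<Rightarrow> ('v + 'e \<Rightarrow> 'v + 'e) \<Rightarrow> 'v \<Rightarrow>
     ('i \<times> ('v + 'e) list \<times> 'l list \<times> nat list) \<times> ('v + 'e) \<times> (('v + 'e) \<times> 'l) option \<times> nat set" where
  "node_label G t \<epsilon> xs i \<phi> v =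
     ((i, map (\<lambda>e. \<phi> (Inr e)) xs, map (label G) xs, map (\<lambda>e. card (ends G e)) xs),
      \<phi> (Inl v), if v = root_of t then None else Some (\<phi> (Inr (\<epsilon> v)), label G (\<epsilon> v)),
      {k. k < length xs \<and> v \<in> ends G (xs ! k)})"

text \<open>The contraction \<open>\<psi>\<close> is the retraction \<open>p\<close> on vertices and
  undoes an embedding \<open>\<eta>\<close> of edges, which follows \<open>f\<close> on tree edges
  and matches the other edges by index. An edge outside the image of \<open>\<eta>\<close> is a tree
  edge into a vertex outside the image of \<open>f\<close>, so \<open>p\<close> is constant along
  it. It is collapsed by \<open>\<phi>'\<close> as well: the labels show that the image of
  \<open>\<eta>\<close> already contains an edge over each edge of \<open>H\<close>, and there is
  only one. Hence \<open>\<phi>' = \<phi> \<circ> \<psi>\<close>.\<close>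

lemma contraction_of_tree_maps:
  assumes G: "G \<in> graph_obj g S" and G': "G' \<in> graph_obj g S"
    and \<phi>: "connected_contraction G H \<phi>" and \<phi>': "connected_contraction G' H \<phi>'"
    and rig: "rigidification G t \<epsilon> xs" and rig': "rigidification G' t' \<epsilon>' xs'"
    and sub: "subseq (map f (nodes t)) (nodes t')" and froot: "f (root_of t) = root_of t'"
    and f: "\<And>v. v \<in> verts G \<Longrightarrow>
      node_label G' t' \<epsilon>' xs' i \<phi>' (f v) = node_label G t \<epsilon> xs i \<phi> v \<and> p (f v) = v"
    and p: "\<And>w. w \<in> verts G' \<Longrightarrow> p w \<in> verts G"
    and arc_in: "\<And>a b. \<lbrakk>(a, b) \<in> arcs t'; b \<in> f ` verts G\<rbrakk> \<Longrightarrow> (p a, p b) \<in> arcs t"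
    and arc_out: "\<And>a b. \<lbrakk>(a, b) \<in> arcs t'; b \<notin> f ` verts G\<rbrakk> \<Longrightarrow> p b = p a"
  shows "\<exists>\<psi> \<eta>. \<psi> \<in> contractions G' G \<and> compose (cells G') \<phi> \<psi> = \<phi>' \<and>
     \<psi> (Inl (root_of t')) = Inl (root_of t) \<and>
     subseq (map \<eta> (edge_order t \<epsilon> xs)) (edge_order t' \<epsilon>' xs') \<and>
     (\<forall>e\<in>edges G. \<forall>e'\<in>edges G'. \<psi> (Inr e') = Inr e \<longleftrightarrow> e' = \<eta> e)"
proof -
  let ?r = "root_of t" and ?r' = "root_of t'"
  have st: "spanning_tree G t \<epsilon>" and st': "spanning_tree G' t' \<epsilon>'"
    using rig rig' by (auto simp: rigidification_def)
  have d: "distinct (nodes t)" "set (nodes t) = verts G" "distinct (nodes t')" "set (nodes t') = verts G'"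
    using st st' by (auto simp: spanning_tree_def)
  have fin: "finite_graph G" "finite_graph G'" using graph_objD(2) G G' by auto
  note fG = finite_graphD[OF fin(1)] and fG' = finite_graphD[OF fin(2)]
  have rV: "?r \<in> verts G" "?r' \<in> verts G'" using root_in_nodes d by metis+
  have fV: "f v \<in> verts G'" if "v \<in> verts G" for v using subseq_set[OF sub] d that by auto
  have pf: "p (f v) = v" if "v \<in> verts G" for v using f[OF that] by blast
  have lab: "node_label G' t' \<epsilon>' xs' i \<phi>' (f v) = node_label G t \<epsilon> xs i \<phi> v" if "v \<in> verts G" for v
    using f[OF that] by blast
  have fr: "f v = ?r' \<longleftrightarrow> v = ?r" if "v \<in> verts G" for v using pf[OF that] pf[OF rV(1)] froot by auto
  have xs: "distinct xs" "set xs = edges G - \<epsilon> ` (verts G - {?r})"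
    and xs': "distinct xs'" "set xs' = edges G' - \<epsilon>' ` (verts G' - {?r'})"
    using rig rig' by (auto simp: rigidification_def)
  have len: "length xs = g" "length xs' = g" using rigidification_length[OF G rig] rigidification_length[OF G' rig'] by simp_all

  \<comment> \<open>The first component of a label does not depend on the node, so it is read off at
    the root.\<close>
  have glob: "map (\<lambda>e. \<phi>' (Inr e)) xs' = map (\<lambda>e. \<phi> (Inr e)) xs" "map (label G') xs' = map (label G) xs"
    "map (\<lambda>e. card (ends G' e)) xs' = map (\<lambda>e. card (ends G e)) xs"
    using lab[OF rV(1)] by (auto simp: node_label_def)
  have xs_\<phi>: "\<phi>' (Inr (xs' ! k)) = \<phi> (Inr (xs ! k))" and xs_label: "label G' (xs' ! k) = label G (xs ! k)"
    and xs_card: "card (ends G' (xs' ! k)) = card (ends G (xs ! k))" if "k < g" for k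
    using arg_cong[OF glob(1), of "\<lambda>l. l ! k"] arg_cong[OF glob(2), of "\<lambda>l. l ! k"]
      arg_cong[OF glob(3), of "\<lambda>l. l ! k"] that len by auto
  have v_\<phi>: "\<phi>' (Inl (f v)) = \<phi> (Inl v)" if "v \<in> verts G" for v
    using lab[OF that] by (auto simp: node_label_def)
  have xs_inc: "f v \<in> ends G' (xs' ! k)" if "v \<in> verts G" "v \<in> ends G (xs ! k)" "k < g" for v k
    using lab[OF that(1)] that len by (auto simp: node_label_def)
  have \<epsilon>_\<phi>: "\<phi>' (Inr (\<epsilon>' (f v))) = \<phi> (Inr (\<epsilon> v))" and \<epsilon>_label: "label G' (\<epsilon>' (f v)) = label G (\<epsilon> v)"
    if "v \<in> verts G" "v \<noteq> ?r" for v
    using lab[OF that(1)] that fr[OF that(1)] by (auto simp: node_label_def)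

  define \<eta> where "\<eta> e = (if e \<in> set xs then xs' ! pos xs e else \<epsilon>' (f (inv_into (verts G - {?r}) \<epsilon> e)))" for e
  have pos_k: "pos xs (xs ! k) = k" if "k < g" for k
    using pos_nth that xs(1) len by metis
  have \<eta>x: "\<eta> (xs ! k) = xs' ! k" if "k < g" for k using that len pos_k by (simp add: \<eta>_def)
  have \<eta>\<epsilon>: "\<eta> (\<epsilon> v) = \<epsilon>' (f v)" if "v \<in> verts G" "v \<noteq> ?r" for v
    using that spanning_tree_inj[OF st] xs(2) by (simp add: \<eta>_def)
  have edge_cases: "(\<exists>v\<in>verts G. v \<noteq> ?r \<and> e = \<epsilon> v) \<or> (\<exists>k<g. e = xs ! k)" if "e \<in> edges G" for e
  proof (cases "e \<in> set xs")
    case True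
    then show ?thesis using len by (metis in_set_conv_nth)
  next
    case False
    then show ?thesis using that xs(2) by auto
  qed
  have \<eta>E: "\<eta> e \<in> edges G'" if "e \<in> edges G" for e
    using edge_cases[OF that]
  proof
    assume "\<exists>v\<in>verts G. v \<noteq> ?r \<and> e = \<epsilon> v"
    then obtain v where v: "v \<in> verts G" "v \<noteq> ?r" "e = \<epsilon> v" by blast
    then have "f v \<in> verts G' - {?r'}" using fV fr by blast
    then show ?thesis using spanning_tree_card(2)[OF st' fG'(1)] v \<eta>\<epsilon> by auto
  next
    assume "\<exists>k<g. e = xs ! k"
    then obtain k where "k < g" "e = xs ! k" by blast
    then have "\<eta> e \<in> set xs'" using \<eta>x len by simp
    then show ?thesis using xs'(2) by blast
  qed

  have ord: "subseq (map \<eta> (edge_order t \<epsilon> xs)) (edge_order t' \<epsilon>' xs')"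
  proof -
    have "subseq (map f (tl (nodes t))) (tl (nodes t'))"
      using sub nodes_eq[of t] nodes_eq[of t'] froot by (metis list.simps(9) subseq_Cons2_iff)
    then have sub_t: "subseq (map \<epsilon>' (map f (tl (nodes t)))) (map \<epsilon>' (tl (nodes t')))" by (rule subseq_map)
    have "map \<eta> (map \<epsilon> (tl (nodes t))) = map \<epsilon>' (map f (tl (nodes t)))"
      using \<eta>\<epsilon> tl_nodes[OF d(1)] d(2) by auto
    moreover have "map \<eta> xs = xs'" by (rule nth_equalityI) (use \<eta>x len in auto)
    ultimately have "map \<eta> (edge_order t \<epsilon> xs) = map \<epsilon>' (map f (tl (nodes t))) @ xs'"
      by (simp only: edge_order_def map_append)
    moreover have "subseq (map \<epsilon>' (map f (tl (nodes t))) @ xs') (edge_order t' \<epsilon>' xs')"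
      unfolding edge_order_def by (rule list_emb_append_mono[OF sub_t]) simp
    ultimately show ?thesis by (simp only:)
  qed
  have \<eta>_inj: "inj_on \<eta> (edges G)"
    using subseq_distinct[OF ord edge_order(1)[OF rig' fG'(1)]] edge_order(2)[OF rig fG(1)]
    by (simp add: distinct_map)
  have not_im: "\<exists>a b. e' = \<epsilon>' b \<and> (a, b) \<in> arcs t' \<and> b \<notin> f ` verts G \<and> ends G' e' = {a, b} \<and>
      p a = p b \<and> a \<in> verts G' \<and> b \<in> verts G'" if e': "e' \<in> edges G'" "e' \<notin> \<eta> ` edges G" for e'
  proof -
    have "e' \<notin> set xs'"
    proof
      assume "e' \<in> set xs'"
      then obtain k where "k < g" "e' = xs' ! k" using len by (metis in_set_conv_nth)
      moreover have "xs ! k \<in> edges G" using xs(2) len calculation(1) nth_mem by fastforce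
      ultimately show False using e'(2) \<eta>x by (metis imageI)
    qed
    then obtain b where b: "b \<in> verts G'" "b \<noteq> ?r'" "e' = \<epsilon>' b" using xs'(2) e'(1) by auto
    have "b \<notin> f ` verts G"
    proof
      assume "b \<in> f ` verts G"
      then obtain v where v: "v \<in> verts G" "b = f v" by blast
      then have "v \<noteq> ?r" using b froot by auto
      then have "\<epsilon> v \<in> edges G" "\<eta> (\<epsilon> v) = e'" using v b \<eta>\<epsilon> spanning_tree_card(2)[OF st fG(1)] by auto
      then show False using e'(2) by blast
    qed
    moreover obtain a where "(a, b) \<in> arcs t'" "ends G' (\<epsilon>' b) = {a, b}" "a \<in> verts G'"
      using spanning_tree_ends[OF st' b(1,2)] by metis
    ultimately show ?thesis using b arc_out by metis
  qed
  have \<eta>_ends: "p ` ends G' (\<eta> e) = ends G e" if e: "e \<in> edges G" for e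
    using edge_cases[OF e]
  proof
    assume "\<exists>v\<in>verts G. v \<noteq> ?r \<and> e = \<epsilon> v"
    then obtain v where v: "v \<in> verts G" "v \<noteq> ?r" "e = \<epsilon> v" by blast
    have "f v \<noteq> ?r'" using v fr by blast
    then obtain a where a: "(a, f v) \<in> arcs t'" "ends G' (\<epsilon>' (f v)) = {a, f v}"
      using spanning_tree_ends[OF st' fV[OF v(1)]] by metis
    then have "(p a, v) \<in> arcs t" using arc_in[OF a(1)] v(1) pf by auto
    then have "ends G (\<epsilon> v) = {p a, v}" using st unfolding spanning_tree_def by blast
    then show ?thesis using v \<eta>\<epsilon> a pf by simp
  next
    assume "\<exists>k<g. e = xs ! k"
    then obtain k where k: "k < g" "e = xs ! k" by blast
    then have ke: "xs ! k \<in> edges G" "xs' ! k \<in> edges G'" using e \<eta>E \<eta>x by metis+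
    have V: "v \<in> verts G" if "v \<in> ends G (xs ! k)" for v using fG(3) ke that by blast
    \<comment> \<open>The labels only say that \<open>f\<close> carries ends to ends. As
      \<open>f\<close> is injective and the recorded numbers of ends agree, no end of the edge in
      \<open>G'\<close> is missed; in particular loops correspond to loops.\<close>
    have "f ` ends G (xs ! k) \<subseteq> ends G' (xs' ! k)" using xs_inc V k by blast
    moreover have "card (f ` ends G (xs ! k)) = card (ends G' (xs' ! k))"
      using xs_card[OF k(1)] V pf by (subst card_image) (auto intro: inj_on_inverseI[of _ p])
    moreover have "finite (ends G' (xs' ! k))" using fG'(4)[OF ke(2)] by (auto intro: card_ge_0_finite)
    ultimately have "f ` ends G (xs ! k) = ends G' (xs' ! k)" by (intro card_subset_eq)
    then have "p ` ends G' (xs' ! k) = p ` f ` ends G (xs ! k)" by simp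
    also have "\<dots> = ends G (xs ! k)" using V pf by (force simp: image_image)
    finally show ?thesis using k \<eta>x by simp
  qed
  have \<eta>_label: "label G' (\<eta> e) = label G e" and \<eta>_\<phi>: "\<phi>' (Inr (\<eta> e)) = \<phi> (Inr e)" if "e \<in> edges G" for e
    using edge_cases[OF that] \<eta>\<epsilon> \<eta>x \<epsilon>_label \<epsilon>_\<phi> xs_label xs_\<phi> by auto
  have \<phi>'_collapse: "\<phi>' (Inr e') \<in> range Inl" if e': "e' \<in> edges G'" "e' \<notin> \<eta> ` edges G" for e'
  proof (cases "\<phi>' (Inr e')")
    case (Inr h)
    have "h \<in> edges H" using connected_contractionD(2)[OF \<phi>', of "Inr e'"] e'(1) Inr by simp
    then obtain e where e: "e \<in> edges G" "\<phi> (Inr e) = Inr h"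
      using connected_contractionD(8)[OF \<phi>] by blast
    then have "\<phi>' (Inr (\<eta> e)) = Inr h" using \<eta>_\<phi> by simp
    then have "\<eta> e = e'"
      using connected_contractionD(8)[OF \<phi>' \<open>h \<in> edges H\<close>] \<eta>E[OF e(1)] Inr e'(1) by blast
    then show ?thesis using e' e(1) by blast
  qed simp
  have tree_edge_not_im: "\<epsilon>' b \<in> edges G' \<and> \<epsilon>' b \<notin> \<eta> ` edges G \<and> ends G' (\<epsilon>' b) = {a, b}"
    if ab: "(a, b) \<in> arcs t'" "b \<notin> f ` verts G" for a b
  proof -
    have b: "b \<in> verts G'" "b \<noteq> ?r'" using arcs_in_nodes[OF ab(1)] d root_no_arc[OF d(3)] ab(1) by auto
    have ne: "\<epsilon>' b \<noteq> \<eta> e" if "e \<in> edges G" for e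
      using edge_cases[OF that]
    proof
      assume "\<exists>v\<in>verts G. v \<noteq> ?r \<and> e = \<epsilon> v"
      then obtain v where v: "v \<in> verts G" "v \<noteq> ?r" "e = \<epsilon> v" by blast
      then have "f v \<in> verts G' - {?r'}" using fV fr by blast
      moreover have "b \<noteq> f v" using ab(2) v(1) by blast
      ultimately show ?thesis using spanning_tree_inj[OF st'] b v \<eta>\<epsilon> by (metis DiffI inj_on_def singletonD)
    next
      assume "\<exists>k<g. e = xs ! k"
      then obtain k where "k < g" "e = xs ! k" by blast
      then have "\<eta> e \<in> set xs'" using \<eta>x len by simp
      moreover have "\<epsilon>' b \<notin> set xs'" using b unfolding xs'(2) by simp
      ultimately show ?thesis by auto
    qed
    show ?thesis using st' ab(1) ne unfolding spanning_tree_def by blast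
  qed
  \<comment> \<open>Propagation from the root: at an embedded vertex the labels give the value
    directly; any other vertex is joined to its parent by an edge that \<open>\<phi>'\<close>
    collapses and along which \<open>p\<close> is constant.\<close>
  have \<phi>'_vert: "\<phi>' (Inl w) = \<phi> (Inl (p w))" if "w \<in> verts G'" for w
  proof -
    have "w \<in> set (nodes t')" using that d by simp
    then show ?thesis
    proof (induction rule: rtree_arc_induct)
      case root
      show ?case using v_\<phi>[OF rV(1)] froot pf[OF rV(1)] by simp
    next
      case (arc a b)
      show ?case
      proof (cases "b \<in> f ` verts G")
        case True
        then show ?thesis using v_\<phi> pf by auto
      next
        case False
        note e = tree_edge_not_im[OF arc(1) False]
        then obtain x where "\<phi>' (Inr (\<epsilon>' b)) = Inl x" using \<phi>'_collapse by blast
        then have "\<phi>' (Inl a) = Inl x" "\<phi>' (Inl b) = Inl x"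
          using connected_contractionD(5)[OF \<phi>', of "\<epsilon>' b" x] e by auto
        then show ?thesis using arc arc_out[OF arc(1) False] by simp
      qed
    qed
  qed

  \<comment> \<open>Any end of a collapsed edge may be chosen, as \<open>p\<close> takes the same
    value at both ends; \<open>restrict\<close> provides the extensionality required of
    morphisms.\<close>
  define \<psi> where "\<psi> = restrict (\<lambda>c. case c of Inl w \<Rightarrow> Inl (p w)
    | Inr e' \<Rightarrow> if e' \<in> \<eta> ` edges G then Inr (the_inv_into (edges G) \<eta> e')
        else Inl (p (SOME a. a \<in> ends G' e'))) (cells G')"
  have \<psi>v: "\<psi> (Inl w) = Inl (p w)" if "w \<in> verts G'" for w using that by (simp add: \<psi>_def)
  have \<psi>\<eta>: "\<psi> (Inr (\<eta> e)) = Inr e" if "e \<in> edges G" for e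
    using that \<eta>E[OF that] the_inv_into_f_f[OF \<eta>_inj that] by (simp add: \<psi>_def)
  have \<psi>out: "\<psi> (Inr e') = Inl (p a)" if e': "e' \<in> edges G'" "e' \<notin> \<eta> ` edges G" "a \<in> ends G' e'" for e' a
  proof -
    obtain x y where xy: "ends G' e' = {x, y}" "p x = p y" using not_im[OF e'(1,2)] by blast
    have "(SOME a. a \<in> ends G' e') \<in> ends G' e'" using e'(3) by (rule someI)
    then have "p (SOME a. a \<in> ends G' e') = p a" using xy e'(3) by auto
    then show ?thesis using e' by (simp add: \<psi>_def)
  qed
  have \<psi>Inr: "\<psi> (Inr e') = Inr e \<longleftrightarrow> e' = \<eta> e" if "e' \<in> edges G'" "e \<in> edges G" for e e'
  proof
    assume eq: "\<psi> (Inr e') = Inr e"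
    have "ends G' e' \<noteq> {}" using fG'(4)[OF that(1)] by auto
    then have "e' \<in> \<eta> ` edges G" using \<psi>out[OF that(1)] eq by fastforce
    then show "e' = \<eta> e" using \<psi>\<eta> eq by auto
  qed (use \<psi>\<eta> that in simp)
  have \<psi>_edge: "(\<exists>e\<in>edges G. e' = \<eta> e \<and> \<psi> (Inr e') = Inr e) \<or>
      (e' \<notin> \<eta> ` edges G \<and> (\<exists>a\<in>ends G' e'. \<psi> (Inr e') = Inl (p a)))" if "e' \<in> edges G'" for e'
  proof (cases "e' \<in> \<eta> ` edges G")
    case True
    then show ?thesis using \<psi>\<eta> by blast
  next
    case False
    have "ends G' e' \<noteq> {}" using fG'(4)[OF that] by auto
    then show ?thesis using \<psi>out[OF that False] False by blast
  qed
  have "connected_contraction G' G \<psi>"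
  proof (rule connected_contractionI)
    have "\<psi> c \<in> cells G" if "c \<in> cells G'" for c
    proof (cases c)
      case (Inl w)
      then show ?thesis using that \<psi>v p by simp
    next
      case (Inr e')
      then have e': "e' \<in> edges G'" using that by simp
      then show ?thesis using \<psi>_edge[OF e'] Inr p fG'(3)[OF e'] by auto
    qed
    then show "\<psi> \<in> cells G' \<rightarrow>\<^sub>E cells G" by (auto simp: \<psi>_def PiE_iff)
    show "\<psi> (Inl v) \<in> Inl ` verts G" if "v \<in> verts G'" for v using \<psi>v p that by simp
    show "\<exists>v\<in>verts G'. \<psi> (Inl v) = Inl v'" if "v' \<in> verts G" for v'
      using \<psi>v[OF fV[OF that]] pf[OF that] fV[OF that] by auto
    show "\<psi> (Inl a) = Inl x" if "e \<in> edges G'" "\<psi> (Inr e) = Inl x" "a \<in> ends G' e" for e x a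
    proof -
      have "e \<notin> \<eta> ` edges G" using \<psi>\<eta> that(2) by auto
      then show ?thesis using \<psi>out[OF that(1) _ that(3)] that fG'(3)[OF that(1)] \<psi>v by auto
    qed
    show "(\<lambda>a. \<psi> (Inl a)) ` ends G' e = Inl ` ends G h" if e: "e \<in> edges G'" "\<psi> (Inr e) = Inr h" for e h
    proof -
      have h: "h \<in> edges G" "e = \<eta> h" using \<psi>_edge[OF e(1)] e(2) by auto
      have "(\<lambda>a. \<psi> (Inl a)) ` ends G' e = Inl ` p ` ends G' e"
        using \<psi>v fG'(3)[OF e(1)] by (auto simp: image_image intro!: image_cong)
      then show ?thesis using \<eta>_ends[OF h(1)] h(2) by simp
    qed
    show "label G h = label G' e" if "e \<in> edges G'" "\<psi> (Inr e) = Inr h" for e h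
      using \<psi>_edge[OF that(1)] that(2) \<eta>_label by auto
    show "\<exists>!e. e \<in> edges G' \<and> \<psi> (Inr e) = Inr h" if "h \<in> edges G" for h
      using \<psi>Inr[OF _ that] \<eta>E[OF that] by blast
    have sym: "sym (collapsed G' \<psi>)" by (auto simp: sym_def collapsed_def insert_commute)
    \<comment> \<open>\<open>f (p w)\<close> is the nearest embedded vertex on the way from
      \<open>w\<close> to the root, and the tree edges in between are collapsed. Each fibre is thus
      connected through its embedded vertex.\<close>
    have to_section: "(w, f (p w)) \<in> (collapsed G' \<psi>)\<^sup>*" if "w \<in> verts G'" for w
    proof -
      have "w \<in> set (nodes t')" using that d by simp
      then show ?thesis
      proof (induction rule: rtree_arc_induct)
        case root
        show ?case using pf[OF rV(1)] froot by simp
      next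
        case (arc a b)
        show ?case
        proof (cases "b \<in> f ` verts G")
          case True
          then show ?thesis using pf by auto
        next
          case False
          note e = tree_edge_not_im[OF arc(1) False]
          then have "\<psi> (Inr (\<epsilon>' b)) = Inl (p a)" using \<psi>out[of "\<epsilon>' b" a] by blast
          then have "(a, b) \<in> collapsed G' \<psi>" using e by (auto simp: collapsed_def)
          then have "(b, a) \<in> collapsed G' \<psi>" using sym by (auto dest: symD)
          then have "(b, f (p a)) \<in> (collapsed G' \<psi>)\<^sup>*" using arc(2) by (rule converse_rtrancl_into_rtrancl)
          then show ?thesis using arc_out[OF arc(1) False] by simp
        qed
      qed
    qed
    show "(a, b) \<in> (collapsed G' \<psi>)\<^sup>*" if ab: "a \<in> verts G'" "b \<in> verts G'" "\<psi> (Inl a) = \<psi> (Inl b)" for a b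
    proof -
      have "p a = p b" using ab \<psi>v by simp
      then have "(b, f (p a)) \<in> (collapsed G' \<psi>)\<^sup>*" using to_section[OF ab(2)] by simp
      then have "(f (p a), b) \<in> (collapsed G' \<psi>)\<^sup>*" using sym_rtrancl[OF sym] by (rule symD[rotated])
      then show ?thesis using to_section[OF ab(1)] by (meson rtrancl_trans)
    qed
  qed
  then have "\<psi> \<in> contractions G' G" using contractions_iff[OF G' G] by blast
  moreover have "compose (cells G') \<phi> \<psi> = \<phi>'"
  proof (rule extensionalityI[of _ "cells G'"])
    show "\<phi>' \<in> extensional (cells G')" using connected_contractionD(1)[OF \<phi>'] by (simp add: PiE_iff)
    fix c assume c: "c \<in> cells G'"
    have "\<phi> (\<psi> c) = \<phi>' c"
    proof (cases c)
      case (Inl w)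
      then show ?thesis using c \<psi>v \<phi>'_vert by simp
    next
      case (Inr e')
      then have e': "e' \<in> edges G'" using c by simp
      show ?thesis
      proof (cases "e' \<in> \<eta> ` edges G")
        case True
        then show ?thesis using Inr \<psi>\<eta> \<eta>_\<phi> by auto
      next
        case False
        obtain x where x: "\<phi>' (Inr e') = Inl x" using \<phi>'_collapse[OF e' False] by blast
        obtain a where a: "a \<in> ends G' e'" "\<psi> (Inr e') = Inl (p a)" using \<psi>_edge[OF e'] False by auto
        have "\<phi>' (Inl a) = Inl x" using connected_contractionD(5)[OF \<phi>' e' x a(1)] .
        then show ?thesis using Inr a x \<phi>'_vert fG'(3)[OF e'] by auto
      qed
    qed
    then show "compose (cells G') \<phi> \<psi> c = \<phi>' c" using c by (simp add: compose_def)
  qed simp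
  moreover have "\<psi> (Inl ?r') = Inl ?r" using \<psi>v[OF rV(2)] froot pf[OF rV(1)] by simp
  ultimately show ?thesis using ord \<psi>Inr by blast
qed

text \<open>The bound depends only on \<open>I\<close>, \<open>C\<close>, \<open>S\<close> and
  \<open>g\<close> and is finite once these sets are, so Kruskal's theorem applies to graphs of
  unbounded size.\<close>

lemma node_label_range:
  assumes G: "G \<in> graph_obj g S" and rig: "rigidification G t \<epsilon> xs"
    and \<phi>: "connected_contraction G H \<phi>" and v: "v \<in> verts G" and C: "cells H \<subseteq> C" and i: "i \<in> I"
  shows "node_label G t \<epsilon> xs i \<phi> v \<in>
    (I \<times> {l. set l \<subseteq> C \<and> length l = g} \<times> {l. set l \<subseteq> S \<and> length l = g} \<times>
      {l. set l \<subseteq> {1, 2} \<and> length l = g}) \<times> C \<times> insert None (Some ` (C \<times> S)) \<times> Pow {..<g}"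
proof -
  have fin: "finite_graph G" using graph_objD(2)[OF G] .
  have st: "spanning_tree G t \<epsilon>" and xs: "set xs \<subseteq> edges G" using rig by (auto simp: rigidification_def)
  have len: "length xs = g" using rigidification_length[OF G rig] .
  have cell: "\<phi> x \<in> C" if "x \<in> cells G" for x using connected_contractionD(2)[OF \<phi> that] C by blast
  have 1: "\<phi> (Inr e) \<in> C" "label G e \<in> S" "card (ends G e) \<in> {1, 2}" if "e \<in> edges G" for e
    using cell[of "Inr e"] graph_objD(4)[OF G that] finite_graphD(4)[OF fin that] that by auto
  have "\<phi> (Inl v) \<in> C" using cell[of "Inl v"] v by simp
  moreover have "\<phi> (Inr (\<epsilon> v)) \<in> C \<and> label G (\<epsilon> v) \<in> S" if "v \<noteq> root_of t"
    using spanning_tree_ends[OF st v that] 1 by metis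
  moreover have "set (map (\<lambda>e. \<phi> (Inr e)) xs) \<subseteq> C" "set (map (label G) xs) \<subseteq> S"
    "set (map (\<lambda>e. card (ends G e)) xs) \<subseteq> {1, 2}" using 1 xs by auto
  ultimately show ?thesis using len i unfolding node_label_def by auto
qed

lemma finite_contractions:
  assumes "finite_graph G" and "finite_graph H"
  shows "finite (contractions G H)"
proof (rule finite_subset)
  show "contractions G H \<subseteq> cells G \<rightarrow>\<^sub>E cells H" by (auto simp: contractions_def)
  show "finite (cells G \<rightarrow>\<^sub>E cells H)"
    using assms by (intro finite_PiE) (auto simp: cells_def finite_graphD(1,2))
qed

lemma id_contraction:
  assumes G: "G \<in> graph_obj g S"
  shows "(\<lambda>c\<in>cells G. c) \<in> contractions G G"
proof -
  have "connected_contraction G G (\<lambda>c\<in>cells G. c)"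
  proof (rule connected_contractionI)
    fix e h assume e: "e \<in> edges G" "(\<lambda>c\<in>cells G. c) (Inr e) = Inr h"
    have "ends G e \<subseteq> verts G" using finite_graphD(3)[OF graph_objD(2)[OF G] e(1)] .
    then show "(\<lambda>a. (\<lambda>c\<in>cells G. c) (Inl a)) ` ends G e = Inl ` ends G h" using e by force
  qed auto
  then show ?thesis using contractions_iff[OF G G] by blast
qed

text \<open>\<open>H i\<close> will carry the \<open>i\<close>-th generator of the module, so a
  graph may occur for several \<open>i\<close>. \<open>index\<close> numbers the cells of the
  targets, and \<open>targets i\<close> lists the edges of \<open>H i\<close> in an arbitrary order;
  both serve to make keys lists of natural numbers, compared lexicographically.\<close>

locale rigidified_system =
  fixes g :: nat and S :: "'l set" and n :: nat
    and H :: "nat \<Rightarrow> ('v, 'e, 'l) labeled_graph"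
    and t :: "('v, 'e, 'l) labeled_graph \<Rightarrow> 'v rtree"
    and \<epsilon> :: "('v, 'e, 'l) labeled_graph \<Rightarrow> 'v \<Rightarrow> 'e"
    and xs :: "('v, 'e, 'l) labeled_graph \<Rightarrow> 'e list"
    and index :: "'v + 'e \<Rightarrow> nat"
    and targets :: "nat \<Rightarrow> 'e list"
  assumes finite_S: "finite S"
    and H: "i < n \<Longrightarrow> H i \<in> graph_obj g S"
    and rigid: "G \<in> graph_obj g S \<Longrightarrow> rigidification G (t G) (\<epsilon> G) (xs G)"
    and index_inj: "inj_on index (\<Union>i<n. cells (H i))"
    and targets: "i < n \<Longrightarrow> set (targets i) = edges (H i)"
begin

section \<open>Monomials and their order\<close>

definition Mon :: "('v, 'e, 'l) labeled_graph \<Rightarrow> (nat \<times> ('v + 'e \<Rightarrow> 'v + 'e)) set" where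
  "Mon G = {(i, \<phi>). i < n \<and> \<phi> \<in> contractions G (H i)}"

definition ord :: "('v, 'e, 'l) labeled_graph \<Rightarrow> 'e list" where
  "ord G = edge_order (t G) (\<epsilon> G) (xs G)"

definition edge_over :: "('v, 'e, 'l) labeled_graph \<Rightarrow> ('v + 'e \<Rightarrow> 'v + 'e) \<Rightarrow> 'e \<Rightarrow> 'e" where
  "edge_over G \<phi> h = (THE e. e \<in> edges G \<and> \<phi> (Inr e) = Inr h)"

text \<open>The first two entries are unchanged by composition with a contraction that preserves
  roots, so monotonicity reduces to the positions of edges. Without them, monomials with different
  targets or different values at the root could receive equal keys.\<close>

definition key :: "('v, 'e, 'l) labeled_graph \<Rightarrow> nat \<times> ('v + 'e \<Rightarrow> 'v + 'e) \<Rightarrow> nat list" where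
  "key G \<mu> = fst \<mu> # index (snd \<mu> (Inl (root_of (t G)))) #
     map (\<lambda>h. pos (ord G) (edge_over G (snd \<mu>) h)) (targets (fst \<mu>))"

lemma MonD:
  assumes "G \<in> graph_obj g S" and "(i, \<phi>) \<in> Mon G"
  shows "i < n" and "\<phi> \<in> contractions G (H i)" and "connected_contraction G (H i) \<phi>"
  using assms contractions_iff[OF assms(1) H] by (auto simp: Mon_def)

lemma finite_Mon:
  assumes "G \<in> graph_obj g S"
  shows "finite (Mon G)"
proof -
  have "Mon G = Sigma {..<n} (\<lambda>i. contractions G (H i))" by (auto simp: Mon_def)
  moreover have "finite (contractions G (H i))" if "i < n" for i
    using finite_contractions[OF graph_objD(2)[OF assms] graph_objD(2)[OF H[OF that]]] .
  ultimately show ?thesis by auto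
qed

lemma edge_over:
  assumes "connected_contraction G (H i) \<phi>" and "h \<in> edges (H i)"
  shows "edge_over G \<phi> h \<in> edges G" and "\<phi> (Inr (edge_over G \<phi> h)) = Inr h"
    and "\<lbrakk>e \<in> edges G; \<phi> (Inr e) = Inr h\<rbrakk> \<Longrightarrow> edge_over G \<phi> h = e"
proof -
  note ex1 = connected_contractionD(8)[OF assms]
  show "edge_over G \<phi> h \<in> edges G" "\<phi> (Inr (edge_over G \<phi> h)) = Inr h"
    using theI'[OF ex1] by (simp_all add: edge_over_def)
  show "\<lbrakk>e \<in> edges G; \<phi> (Inr e) = Inr h\<rbrakk> \<Longrightarrow> edge_over G \<phi> h = e"
    unfolding edge_over_def using the1_equality[OF ex1] by blast
qed

lemma ord:
  assumes "G \<in> graph_obj g S"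
  shows "distinct (ord G)" and "set (ord G) = edges G"
  using edge_order[OF rigid[OF assms] finite_graphD(1)[OF graph_objD(2)[OF assms]]]
  by (simp_all add: ord_def)

lemma spanning:
  assumes "G \<in> graph_obj g S"
  shows "spanning_tree G (t G) (\<epsilon> G)" and "root_of (t G) \<in> verts G"
    and "distinct (nodes (t G))" and "set (nodes (t G)) = verts G"
  using rigid[OF assms] root_in_nodes[of "t G"] by (auto simp: rigidification_def spanning_tree_def)

text \<open>The values on vertices propagate along the spanning tree.\<close>

lemma contraction_eqI:
  assumes G: "G \<in> graph_obj g S" and \<phi>: "connected_contraction G K \<phi>" and \<phi>': "connected_contraction G K \<phi>'"
    and e: "\<And>e h. e \<in> edges G \<Longrightarrow> \<phi> (Inr e) = Inr h \<longleftrightarrow> \<phi>' (Inr e) = Inr h"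
    and r: "\<phi> (Inl (root_of (t G))) = \<phi>' (Inl (root_of (t G)))"
  shows "\<phi> = \<phi>'"
proof -
  note fG = finite_graphD[OF graph_objD(2)[OF G]]
  have collapse: "\<phi>' (Inr e') = Inl (projl (\<phi>' (Inr e')))" if "e' \<in> edges G" "\<phi> (Inr e') = Inl x" for e' x
    using e[OF that(1)] that(2) by (cases "\<phi>' (Inr e')") auto
  have vert: "\<phi> (Inl w) = \<phi>' (Inl w)" if w: "w \<in> verts G" for w
  proof -
    have "w \<in> set (nodes (t G))" using w spanning(4)[OF G] by simp
    then show ?thesis
    proof (induction rule: rtree_arc_induct)
      case root
      show ?case by (rule r)
    next
      case (arc a b)
      have b: "\<epsilon> G b \<in> edges G" "ends G (\<epsilon> G b) = {a, b}"
        using spanning(1)[OF G] arc(1) by (auto simp: spanning_tree_def)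
      show ?case
      proof (cases "\<phi> (Inr (\<epsilon> G b))")
        case (Inl x)
        have "\<phi> (Inl a) = \<phi> (Inl b)" using connected_contractionD(5)[OF \<phi> b(1) Inl] b(2) by simp
        moreover have "\<phi>' (Inl a) = \<phi>' (Inl b)"
          using connected_contractionD(5)[OF \<phi>' b(1) collapse[OF b(1) Inl]] b(2) by simp
        ultimately show ?thesis using arc(2) by simp
      next
        case (Inr h)
        have "\<phi>' (Inr (\<epsilon> G b)) = Inr h" using e[OF b(1)] Inr by blast
        then have "{\<phi> (Inl a), \<phi> (Inl b)} = {\<phi>' (Inl a), \<phi>' (Inl b)}"
          using connected_contractionD(6)[OF \<phi> b(1) Inr] connected_contractionD(6)[OF \<phi>' b(1)] b(2)
          by simp
        then show ?thesis using arc(2) by (metis doubleton_eq_iff)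
      qed
    qed
  qed
  show ?thesis
  proof (rule extensionalityI[of _ "cells G"])
    show "\<phi> \<in> extensional (cells G)" "\<phi>' \<in> extensional (cells G)"
      using connected_contractionD(1)[OF \<phi>] connected_contractionD(1)[OF \<phi>'] by (simp_all add: PiE_iff)
    fix c assume c: "c \<in> cells G"
    show "\<phi> c = \<phi>' c"
    proof (cases c)
      case (Inl w)
      then show ?thesis using c vert by simp
    next
      case (Inr e')
      then have e': "e' \<in> edges G" using c by simp
      show ?thesis
      proof (cases "\<phi> (Inr e')")
        case (Inl x)
        have "ends G e' \<noteq> {}" using fG(4)[OF e'] by auto
        then obtain a where a: "a \<in> ends G e'" by blast
        have "\<phi> (Inl a) = \<phi> (Inr e')" using connected_contractionD(5)[OF \<phi> e' Inl a] Inl by simp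
        moreover have "\<phi>' (Inl a) = \<phi>' (Inr e')"
          using connected_contractionD(5)[OF \<phi>' e' collapse[OF e' Inl] a] collapse[OF e' Inl] by simp
        moreover have "\<phi> (Inl a) = \<phi>' (Inl a)" using vert fG(3)[OF e'] a by blast
        ultimately show ?thesis using Inr by simp
      next
        case Inr': (Inr h)
        then show ?thesis using e[OF e', of h] Inr by simp
      qed
    qed
  qed
qed

text \<open>Distinct monomials must be comparable for leading terms to make sense. The key recovers
  the target, the edges over its edges and the image of the root, from which
  \<open>contraction_eqI\<close> reconstructs the contraction.\<close>

lemma key_inj:
  assumes G: "G \<in> graph_obj g S"
  shows "inj_on (key G) (Mon G)"
proof (rule inj_onI, clarify)
  fix i \<phi> j \<phi>' assume \<mu>: "(i, \<phi>) \<in> Mon G" and \<nu>: "(j, \<phi>') \<in> Mon G" and eq: "key G (i, \<phi>) = key G (j, \<phi>')"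
  then have j: "j = i" by (simp add: key_def)
  note M\<mu> = MonD[OF G \<mu>] and M\<nu> = MonD[OF G \<nu>, unfolded j]
  have r: "\<phi> (Inl (root_of (t G))) = \<phi>' (Inl (root_of (t G)))"
  proof (rule inj_onD[OF index_inj])
    show "index (\<phi> (Inl (root_of (t G)))) = index (\<phi>' (Inl (root_of (t G))))"
      using eq by (simp add: key_def)
  qed (use connected_contractionD(2)[OF M\<mu>(3), of "Inl (root_of (t G))"]
      connected_contractionD(2)[OF M\<nu>(3), of "Inl (root_of (t G))"] spanning(2)[OF G] M\<mu>(1) in auto)
  have over: "edge_over G \<phi> h = edge_over G \<phi>' h" if h: "h \<in> edges (H i)" for h
  proof -
    have "pos (ord G) (edge_over G \<phi> h) = pos (ord G) (edge_over G \<phi>' h)"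
      using eq h targets[OF M\<mu>(1)] j by (simp add: key_def)
    moreover have "edge_over G \<phi> h \<in> set (ord G)" "edge_over G \<phi>' h \<in> set (ord G)"
      using edge_over(1)[OF M\<mu>(3) h] edge_over(1)[OF M\<nu>(3) h] ord(2)[OF G] by auto
    ultimately show ?thesis using nth_pos by metis
  qed
  have hE: "h \<in> edges (H i)" if "e \<in> edges G" "\<phi> (Inr e) = Inr h \<or> \<phi>' (Inr e) = Inr h" for e h
    using connected_contractionD(2)[OF M\<mu>(3), of "Inr e"] connected_contractionD(2)[OF M\<nu>(3), of "Inr e"] that
    by auto
  have "\<phi> (Inr e) = Inr h \<longleftrightarrow> \<phi>' (Inr e) = Inr h" if "e \<in> edges G" for e h
    using edge_over(2,3)[OF M\<mu>(3)] edge_over(2,3)[OF M\<nu>(3)] over hE[OF that] that by metis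
  then have "\<phi> = \<phi>'" using contraction_eqI[OF G M\<mu>(3) M\<nu>(3) _ r] by blast
  then show "i = j \<and> \<phi> = \<phi>'" using j by simp
qed

text \<open>The edge over \<open>h\<close> for the composite is \<open>\<eta>\<close> of the edge
  over \<open>h\<close> for \<open>\<phi>\<close>, and roots are preserved. So the key changes only
  by replacing the position of each edge \<open>e\<close> by that of
  \<open>\<eta> e\<close>.\<close>

lemma key_compose:
  assumes G: "G \<in> graph_obj g S" and G': "G' \<in> graph_obj g S" and \<mu>: "(i, \<phi>) \<in> Mon G"
    and \<psi>: "\<psi> \<in> contractions G' G" and root: "\<psi> (Inl (root_of (t G'))) = Inl (root_of (t G))"
    and \<eta>: "\<And>e e'. \<lbrakk>e \<in> edges G; e' \<in> edges G'\<rbrakk> \<Longrightarrow> \<psi> (Inr e') = Inr e \<longleftrightarrow> e' = \<eta> e"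
  shows "(i, compose (cells G') \<phi> \<psi>) \<in> Mon G'"
    and "key G' (i, compose (cells G') \<phi> \<psi>) =
      i # index (\<phi> (Inl (root_of (t G)))) #
        map (\<lambda>e. pos (ord G') (\<eta> e)) (map (edge_over G \<phi>) (targets i))"
proof -
  note M = MonD[OF G \<mu>]
  have "compose (cells G') \<phi> \<psi> \<in> contractions G' (H i)"
    using contractions_compose[OF G' G H[OF M(1)] \<psi> M(2)] .
  then show mem: "(i, compose (cells G') \<phi> \<psi>) \<in> Mon G'" using M(1) by (simp add: Mon_def)
  note M' = MonD[OF G' mem]
  have c\<psi>: "connected_contraction G' G \<psi>" using \<psi> contractions_iff[OF G' G] by blast
  have over: "edge_over G' (compose (cells G') \<phi> \<psi>) h = \<eta> (edge_over G \<phi> h)" if h: "h \<in> edges (H i)" for h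
  proof (rule edge_over(3)[OF M'(3) h])
    note e = edge_over(1,2)[OF M(3) h]
    obtain e' where e': "e' \<in> edges G'" "\<psi> (Inr e') = Inr (edge_over G \<phi> h)"
      using connected_contractionD(8)[OF c\<psi> e(1)] by blast
    then have "e' = \<eta> (edge_over G \<phi> h)" using \<eta>[OF e(1)] by blast
    then show "\<eta> (edge_over G \<phi> h) \<in> edges G'"
      "compose (cells G') \<phi> \<psi> (Inr (\<eta> (edge_over G \<phi> h))) = Inr h"
      using e e' by (auto simp: compose_def)
  qed
  show "key G' (i, compose (cells G') \<phi> \<psi>) = i # index (\<phi> (Inl (root_of (t G)))) #
        map (\<lambda>e. pos (ord G') (\<eta> e)) (map (edge_over G \<phi>) (targets i))"
    using over targets[OF M(1)] root spanning(2)[OF G'] by (simp add: key_def compose_def)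
qed

text \<open>\<open>\<eta>\<close> is increasing for the two edge orders, so the lists of positions
  compare in the same way before and after composition, while the first two entries stay
  fixed.\<close>

lemma key_mono:
  assumes G: "G \<in> graph_obj g S" and G': "G' \<in> graph_obj g S"
    and \<mu>: "(i, \<phi>) \<in> Mon G" and \<nu>: "(j, \<phi>') \<in> Mon G"
    and \<psi>: "\<psi> \<in> contractions G' G" and root: "\<psi> (Inl (root_of (t G'))) = Inl (root_of (t G))"
    and \<eta>: "\<And>e e'. \<lbrakk>e \<in> edges G; e' \<in> edges G'\<rbrakk> \<Longrightarrow> \<psi> (Inr e') = Inr e \<longleftrightarrow> e' = \<eta> e"
    and sub: "subseq (map \<eta> (ord G)) (ord G')"
    and less: "key G (j, \<phi>') < key G (i, \<phi>)"
  shows "key G' (j, compose (cells G') \<phi>' \<psi>) < key G' (i, compose (cells G') \<phi> \<psi>)"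
proof -
  let ?m = "pos (ord G)" and ?m' = "\<lambda>e. pos (ord G') (\<eta> e)"
  let ?e = "\<lambda>i \<phi>. map (edge_over G \<phi>) (targets i)"
  have sets: "set (?e i \<phi>) \<subseteq> edges G" "set (?e j \<phi>') \<subseteq> edges G"
    using edge_over(1)[OF MonD(3)[OF G \<mu>]] targets[OF MonD(1)[OF G \<mu>]]
      edge_over(1)[OF MonD(3)[OF G \<nu>]] targets[OF MonD(1)[OF G \<nu>]] by auto
  have "map ?m' (?e j \<phi>') < map ?m' (?e i \<phi>)" if "map ?m (?e j \<phi>') < map ?m (?e i \<phi>)"
  proof (rule list_less_map_mono[of "edges G" ?m ?m'])
    show "?m' a < ?m' b" if "a \<in> edges G" "b \<in> edges G" "?m a < ?m b" for a b
      using pos_map_mono[OF sub ord(1)[OF G] ord(1)[OF G']] that ord(2)[OF G] by blast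
    show "?m' a = ?m' b" if "a \<in> edges G" "b \<in> edges G" "?m a = ?m b" for a b
    proof -
      have "a \<in> set (ord G)" "b \<in> set (ord G)" using that ord(2)[OF G] by auto
      then have "a = b" using that(3) nth_pos by metis
      then show ?thesis by simp
    qed
  qed (use sets that in auto)
  moreover have "key G (i, \<phi>) = i # index (\<phi> (Inl (root_of (t G)))) # map ?m (?e i \<phi>)"
    "key G (j, \<phi>') = j # index (\<phi>' (Inl (root_of (t G)))) # map ?m (?e j \<phi>')"
    by (simp_all add: key_def comp_def)
  moreover have "key G' (i, compose (cells G') \<phi> \<psi>) = i # index (\<phi> (Inl (root_of (t G)))) # map ?m' (?e i \<phi>)"
    "key G' (j, compose (cells G') \<phi>' \<psi>) = j # index (\<phi>' (Inl (root_of (t G)))) # map ?m' (?e j \<phi>')"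
    using key_compose(2)[OF G G' \<mu> \<psi> root, of \<eta>] key_compose(2)[OF G G' \<nu> \<psi> root, of \<eta>] \<eta>
    by blast+
  ultimately show ?thesis using less by (auto simp del: map_map)
qed

text \<open>One and the same \<open>\<psi>\<close> serves the monomial and all smaller ones. Pulling
  back along it therefore carries an expression with this leading monomial to one with the
  corresponding leading monomial and the same coefficient.\<close>

definition factors :: "('v, 'e, 'l) labeled_graph \<times> nat \<times> ('v + 'e \<Rightarrow> 'v + 'e) \<Rightarrow>
    ('v, 'e, 'l) labeled_graph \<times> nat \<times> ('v + 'e \<Rightarrow> 'v + 'e) \<Rightarrow> bool" where
  "factors = (\<lambda>(G, i, \<phi>) (G', i', \<phi>'). i' = i \<and> (\<exists>\<psi>\<in>contractions G' G. \<phi>' = compose (cells G') \<phi> \<psi> \<and>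
     (\<forall>(j, \<nu>)\<in>Mon G. key G (j, \<nu>) < key G (i, \<phi>) \<longrightarrow>
        (j, compose (cells G') \<nu> \<psi>) \<in> Mon G' \<and> key G' (j, compose (cells G') \<nu> \<psi>) < key G' (i, \<phi>'))))"

lemma factors_almost_full: "almost_full_on factors (Sigma (graph_obj g S) Mon)"
  unfolding almost_full_on_def
proof (intro allI impI)
  fix q :: "nat \<Rightarrow> ('v, 'e, 'l) labeled_graph \<times> nat \<times> ('v + 'e \<Rightarrow> 'v + 'e)"
  assume "\<forall>k. q k \<in> Sigma (graph_obj g S) Mon"
  then have "\<forall>k. \<exists>G i \<phi>. q k = (G, i, \<phi>) \<and> G \<in> graph_obj g S \<and> (i, \<phi>) \<in> Mon G" by fast
  then obtain G i \<phi> where q: "\<And>k. q k = (G k, i k, \<phi> k)" and G: "\<And>k. G k \<in> graph_obj g S"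
    and \<mu>: "\<And>k. (i k, \<phi> k) \<in> Mon (G k)" by metis
  let ?l = "\<lambda>k. node_label (G k) (t (G k)) (\<epsilon> (G k)) (xs (G k)) (i k) (\<phi> k)"
  let ?C = "\<Union>i<n. cells (H i)"
  define L where "L = ({..<n} \<times> {l. set l \<subseteq> ?C \<and> length l = g} \<times> {l. set l \<subseteq> S \<and> length l = g} \<times>
      {l. set l \<subseteq> {1, 2 :: nat} \<and> length l = g}) \<times> ?C \<times> insert None (Some ` (?C \<times> S)) \<times> Pow {..<g}"
  have finC: "finite ?C" using finite_graphD(1,2)[OF graph_objD(2)[OF H]] by (auto simp: cells_def)
  have finL: "finite L"
    unfolding L_def by (intro finite_cartesian_product finite.insertI finite_imageI finite_lists_length_eq
        finC finite_S) auto
  \<comment> \<open>Vertex names are unrestricted; only the labels come from a finite set, and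
    equality of labels is almost full by the pigeonhole principle.\<close>
  have "finite (snd ` (UNIV \<times> L))" by (rule finite_subset[OF _ finL]) auto
  then have "almost_full_on (\<lambda>x y. snd x = snd y) (UNIV \<times> L)" by (rule almost_full_on_eq_finite)
  note af = kruskal[OF this]
  have label: "?l k v \<in> L" if "v \<in> verts (G k)" for k v
    unfolding L_def by (rule node_label_range[OF G rigid[OF G] MonD(3)[OF G \<mu>] that]) (use MonD(1)[OF G \<mu>] in auto)
  have "set_rtree (map_rtree (\<lambda>v. (v, ?l k v)) (t (G k))) \<subseteq> UNIV \<times> L" for k
    using label[of _ k] spanning(4)[OF G[of k]] by (auto simp: rtree.set_map set_nodes)
  then obtain k k' where kk: "k < k'" and emb: "tree_emb (\<lambda>x y. snd x = snd y)
      (map_rtree (\<lambda>v. (v, ?l k v)) (t (G k))) (map_rtree (\<lambda>v. (v, ?l k' v)) (t (G k')))"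
    using almost_full_onD[OF af, of "\<lambda>k. map_rtree (\<lambda>v. (v, ?l k v)) (t (G k))"] by blast
  have rl: "y = root_of (t (G k'))" if "?l k' y = ?l k (root_of (t (G k)))" for y
    using that by (auto simp: node_label_def split: if_splits)
  obtain f p where sub: "subseq (map f (nodes (t (G k)))) (nodes (t (G k')))"
    and froot: "f (root_of (t (G k))) = root_of (t (G k'))"
    and f: "\<forall>x\<in>verts (G k). ?l k' (f x) = ?l k x \<and> p (f x) = x"
    and p: "p ` verts (G k') \<subseteq> verts (G k)"
    and arc: "\<forall>(a, b)\<in>arcs (t (G k')). if b \<in> f ` verts (G k) then (p a, p b) \<in> arcs (t (G k)) else p b = p a"
    using labeled_tree_emb_maps[OF emb spanning(3)[OF G] spanning(3)[OF G] rl]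
    unfolding spanning(4)[OF G] by blast
  \<comment> \<open>The index is part of every label, so equal labels at one vertex force equal
    targets.\<close>
  have ik: "i k' = i k" using f spanning(2)[OF G[of k]] by (auto simp: node_label_def)
  have f': "node_label (G k') (t (G k')) (\<epsilon> (G k')) (xs (G k')) (i k) (\<phi> k') (f v) = ?l k v \<and> p (f v) = v"
    if "v \<in> verts (G k)" for v using f that ik by simp
  have p': "p w \<in> verts (G k)" if "w \<in> verts (G k')" for w using p that by blast
  have arc_in: "(p a, p b) \<in> arcs (t (G k))" if "(a, b) \<in> arcs (t (G k'))" "b \<in> f ` verts (G k)" for a b
    using bspec[OF arc that(1)] that(2) by simp
  have arc_out: "p b = p a" if "(a, b) \<in> arcs (t (G k'))" "b \<notin> f ` verts (G k)" for a b
    using bspec[OF arc that(1)] that(2) by simp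
  note \<phi>k = MonD(3)[OF G \<mu>, of k] and \<phi>k' = MonD(3)[OF G \<mu>, of k', unfolded ik]
  obtain \<psi> \<eta> where \<psi>: "\<psi> \<in> contractions (G k') (G k)"
    and c: "compose (cells (G k')) (\<phi> k) \<psi> = \<phi> k'"
    and root: "\<psi> (Inl (root_of (t (G k')))) = Inl (root_of (t (G k)))"
    and sub_ord: "subseq (map \<eta> (ord (G k))) (ord (G k'))"
    and \<eta>: "\<forall>e\<in>edges (G k). \<forall>e'\<in>edges (G k'). \<psi> (Inr e') = Inr e \<longleftrightarrow> e' = \<eta> e"
    using contraction_of_tree_maps[OF G[of k] G[of k'] \<phi>k \<phi>k' rigid[OF G] rigid[OF G] sub froot
        f' p' arc_in arc_out] unfolding ord_def by blast
  have "(j, compose (cells (G k')) \<nu> \<psi>) \<in> Mon (G k') \<and>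
      key (G k') (j, compose (cells (G k')) \<nu> \<psi>) < key (G k') (i k, \<phi> k')"
    if "(j, \<nu>) \<in> Mon (G k)" "key (G k) (j, \<nu>) < key (G k) (i k, \<phi> k)" for j \<nu>
    using key_compose(1)[OF G G that(1) \<psi> root, of \<eta>] \<eta>
      key_mono[OF G G \<mu> that(1) \<psi> root _ sub_ord that(2)] c by auto
  then have "factors (q k) (q k')"
    unfolding q factors_def using \<psi> c ik by (auto intro!: bexI[of _ \<psi>])
  then show "good factors q" using kk unfolding good_def by blast
qed

end

section \<open>Modules over Noetherian rings\<close>

text \<open>The union of the chain is one of its members, which therefore equals its
  successor.\<close>

lemma (in noetherian_ring) ideal_sequence_stable:
  assumes I: "\<And>n. ideal (I n) R" and mono: "\<And>i j :: nat. i < j \<Longrightarrow> I i \<subseteq> I j"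
  shows "\<exists>i j. i < j \<and> I i = I j"
proof -
  have "subset.chain {I. ideal I R} (range I)"
    unfolding subset_chain_def using I mono by (auto, metis linorder_neqE_nat subsetD)
  then have "\<Union> (range I) \<in> range I" using ideal_chain_is_trivial by blast
  then obtain i where "\<Union> (range I) = I i" by blast
  then have "I (Suc i) \<subseteq> I i" by blast
  then show ?thesis using mono[of i "Suc i"] by blast
qed

text \<open>\<^const>\<open>module_span\<close> is defined for plain \<^type>\<open>module\<close> records only, while the locale
  \<^locale>\<open>module\<close> admits extended ones.\<close>

locale plain_module = module R M for R :: "('a, 'x) ring_scheme" (structure) and M :: "('a, 'c) module" (structure)
begin

lemma span_submodule:
  assumes "A \<subseteq> carrier M"
  shows "submodule (module_span R M A) R M"
proof (rule submoduleI)
  show "module_span R M A \<subseteq> carrier M"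
    unfolding module_span_def using carrier_is_submodule assms by blast
  show "\<zero>\<^bsub>M\<^esub> \<in> module_span R M A"
    unfolding module_span_def using submodule.axioms(1) subgroup.one_closed by fastforce
qed (auto simp: module_span_def submoduleE)

lemma span_incl: "A \<subseteq> module_span R M A"
  by (auto simp: module_span_def)

lemma span_least: "submodule H R M \<Longrightarrow> A \<subseteq> H \<Longrightarrow> module_span R M A \<subseteq> H"
  by (auto simp: module_span_def)

lemma span_mono: "A \<subseteq> B \<Longrightarrow> module_span R M A \<subseteq> module_span R M B"
  unfolding module_span_def by blast

lemma submodule_zero: "submodule H R M \<Longrightarrow> \<zero>\<^bsub>M\<^esub> \<in> H"
  using submodule.axioms(1) subgroup.one_closed by fastforce

lemma submodule_minus: "submodule H R M \<Longrightarrow> x \<in> H \<Longrightarrow> y \<in> H \<Longrightarrow> x \<ominus>\<^bsub>M\<^esub> y \<in> H"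
  by (simp add: a_minus_def submoduleE(3,5))

lemma submodule_inter:
  assumes "submodule H R M" and "submodule K R M"
  shows "submodule (H \<inter> K) R M"
  using submoduleE[OF assms(1)] submoduleE[OF assms(2)] assms
  by (intro submoduleI) (auto simp: submodule_zero)

text \<open>The elements of this form are a submodule that contains \<open>x\<close> and
  \<open>A\<close>.\<close>

lemma span_insertE:
  assumes "y \<in> module_span R M (insert x A)" and x: "x \<in> carrier M" and A: "A \<subseteq> carrier M"
  obtains r s where "r \<in> carrier R" and "s \<in> module_span R M A" and "y = r \<odot>\<^bsub>M\<^esub> x \<oplus>\<^bsub>M\<^esub> s"
proof -
  let ?S = "module_span R M A"
  let ?H = "{r \<odot>\<^bsub>M\<^esub> x \<oplus>\<^bsub>M\<^esub> s | r s. r \<in> carrier R \<and> s \<in> ?S}"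
  note S = span_submodule[OF A]
  note SE = submoduleE[OF S]
  have Sc: "s \<in> carrier M" if "s \<in> ?S" for s using SE(1) that by blast
  have "submodule ?H R M"
  proof (rule submoduleI)
    show "?H \<subseteq> carrier M" using x Sc by auto
    show "\<zero>\<^bsub>M\<^esub> \<in> ?H" using x submodule_zero[OF S] by (force intro!: exI[of _ "\<zero>"])
    fix a assume "a \<in> ?H"
    then obtain r s where a: "r \<in> carrier R" "s \<in> ?S" "a = r \<odot>\<^bsub>M\<^esub> x \<oplus>\<^bsub>M\<^esub> s" by blast
    have "\<ominus>\<^bsub>M\<^esub> a = (\<ominus> r) \<odot>\<^bsub>M\<^esub> x \<oplus>\<^bsub>M\<^esub> (\<ominus>\<^bsub>M\<^esub> s)"
      using a x Sc by (simp add: M.minus_add smult_l_minus)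
    then show "\<ominus>\<^bsub>M\<^esub> a \<in> ?H" using a SE(3) by blast
    fix b assume "b \<in> ?H"
    then obtain r' s' where b: "r' \<in> carrier R" "s' \<in> ?S" "b = r' \<odot>\<^bsub>M\<^esub> x \<oplus>\<^bsub>M\<^esub> s'" by blast
    have "a \<oplus>\<^bsub>M\<^esub> b = (r \<oplus> r') \<odot>\<^bsub>M\<^esub> x \<oplus>\<^bsub>M\<^esub> (s \<oplus>\<^bsub>M\<^esub> s')"
      using a b x Sc by (simp add: smult_l_distr M.a_ac)
    then show "a \<oplus>\<^bsub>M\<^esub> b \<in> ?H" using a b SE(5) by blast
  next
    fix c a assume c: "c \<in> carrier R" and "a \<in> ?H"
    then obtain r s where a: "r \<in> carrier R" "s \<in> ?S" "a = r \<odot>\<^bsub>M\<^esub> x \<oplus>\<^bsub>M\<^esub> s" by blast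
    have "c \<odot>\<^bsub>M\<^esub> a = (c \<otimes> r) \<odot>\<^bsub>M\<^esub> x \<oplus>\<^bsub>M\<^esub> (c \<odot>\<^bsub>M\<^esub> s)"
      using a c x Sc by (simp add: smult_r_distr smult_assoc1)
    then show "c \<odot>\<^bsub>M\<^esub> a \<in> ?H" using a c SE(4) by blast
  qed
  moreover have "insert x A \<subseteq> ?H"
  proof
    fix y assume "y \<in> insert x A"
    then consider "y = x" | "y \<in> A" by blast
    then show "y \<in> ?H"
    proof cases
      case 1
      have "x = \<one> \<odot>\<^bsub>M\<^esub> x \<oplus>\<^bsub>M\<^esub> \<zero>\<^bsub>M\<^esub>" using x by simp
      then show ?thesis using 1 submodule_zero[OF S] by blast
    next
      case 2
      then have "y \<in> ?S" using span_incl by blast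
      moreover have "y = \<zero> \<odot>\<^bsub>M\<^esub> x \<oplus>\<^bsub>M\<^esub> y" using x Sc[OF calculation] by simp
      ultimately show ?thesis by blast
    qed
  qed
  ultimately have "y \<in> ?H" using span_least assms(1) by blast
  then show thesis using that by blast
qed

text \<open>The coefficients of \<open>x\<close> in elements of \<open>N\<close>, modulo
  combinations of \<open>A\<close>. As \<open>x\<close> may depend linearly on \<open>A\<close>, one
  element can contribute several coefficients; collecting all of them keeps the set an
  ideal.\<close>

definition lead_coeffs :: "'c set \<Rightarrow> 'c set \<Rightarrow> 'c \<Rightarrow> 'a set" where
  "lead_coeffs N A x =
     {r \<in> carrier R. \<exists>s\<in>module_span R M A. r \<odot>\<^bsub>M\<^esub> x \<oplus>\<^bsub>M\<^esub> s \<in> N}"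

lemma lead_coeffs_ideal:
  assumes N: "submodule N R M" and A: "A \<subseteq> carrier M" and x: "x \<in> carrier M"
  shows "ideal (lead_coeffs N A x) R"
proof -
  note S = span_submodule[OF A]
  note SE = submoduleE[OF S] and NE = submoduleE[OF N]
  have Sc: "s \<in> carrier M" if "s \<in> module_span R M A" for s using SE(1) that by blast
  have mult: "c \<otimes> r \<in> lead_coeffs N A x" if c: "c \<in> carrier R" and r: "r \<in> lead_coeffs N A x" for c r
  proof -
    obtain s where s: "r \<in> carrier R" "s \<in> module_span R M A" "r \<odot>\<^bsub>M\<^esub> x \<oplus>\<^bsub>M\<^esub> s \<in> N"
      using r by (auto simp: lead_coeffs_def)
    have "c \<odot>\<^bsub>M\<^esub> (r \<odot>\<^bsub>M\<^esub> x \<oplus>\<^bsub>M\<^esub> s) = (c \<otimes> r) \<odot>\<^bsub>M\<^esub> x \<oplus>\<^bsub>M\<^esub> (c \<odot>\<^bsub>M\<^esub> s)"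
      using s c x Sc by (simp add: smult_r_distr smult_assoc1)
    then have "(c \<otimes> r) \<odot>\<^bsub>M\<^esub> x \<oplus>\<^bsub>M\<^esub> (c \<odot>\<^bsub>M\<^esub> s) \<in> N" using NE(4)[OF c s(3)] by simp
    then show ?thesis using s c SE(4) by (auto simp: lead_coeffs_def)
  qed
  have add: "r \<oplus> r' \<in> lead_coeffs N A x"
    if rr: "r \<in> lead_coeffs N A x" "r' \<in> lead_coeffs N A x" for r r'
  proof -
    obtain s where s: "r \<in> carrier R" "s \<in> module_span R M A" "r \<odot>\<^bsub>M\<^esub> x \<oplus>\<^bsub>M\<^esub> s \<in> N"
      using rr by (auto simp: lead_coeffs_def)
    obtain s' where s': "r' \<in> carrier R" "s' \<in> module_span R M A" "r' \<odot>\<^bsub>M\<^esub> x \<oplus>\<^bsub>M\<^esub> s' \<in> N"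
      using rr by (auto simp: lead_coeffs_def)
    have "(r \<odot>\<^bsub>M\<^esub> x \<oplus>\<^bsub>M\<^esub> s) \<oplus>\<^bsub>M\<^esub> (r' \<odot>\<^bsub>M\<^esub> x \<oplus>\<^bsub>M\<^esub> s') = (r \<oplus> r') \<odot>\<^bsub>M\<^esub> x \<oplus>\<^bsub>M\<^esub> (s \<oplus>\<^bsub>M\<^esub> s')"
      using s s' x Sc by (simp add: smult_l_distr M.a_ac)
    then have "(r \<oplus> r') \<odot>\<^bsub>M\<^esub> x \<oplus>\<^bsub>M\<^esub> (s \<oplus>\<^bsub>M\<^esub> s') \<in> N" using NE(5)[OF s(3) s'(3)] by simp
    then show ?thesis using s s' SE(5) by (auto simp: lead_coeffs_def)
  qed
  have zero: "\<zero> \<in> lead_coeffs N A x"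
    using x submodule_zero[OF S] submodule_zero[OF N] by (force simp: lead_coeffs_def)
  have sub: "lead_coeffs N A x \<subseteq> carrier R" by (auto simp: lead_coeffs_def)
  have "subgroup (lead_coeffs N A x) (add_monoid R)"
  proof (rule R.add.subgroupI)
    show "\<ominus> r \<in> lead_coeffs N A x" if "r \<in> lead_coeffs N A x" for r
    proof -
      have "\<ominus> r = (\<ominus> \<one>) \<otimes> r" using that sub by (auto simp: R.l_minus)
      then show ?thesis using mult that by simp
    qed
  qed (use sub zero add in auto)
  moreover have "r \<otimes> c \<in> lead_coeffs N A x" if "c \<in> carrier R" "r \<in> lead_coeffs N A x" for c r
    using mult[OF that] that sub by (simp add: R.m_comm subset_iff)
  ultimately show ?thesis
    by (intro idealI) (use mult R.ring_axioms in auto)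
qed

text \<open>The values of a graph module are finitely generated by definition, so this classical
  fact is needed at each graph. By induction, generators of
  \<open>N \<inter> module_span R M A\<close> are supplemented by finitely many elements of
  \<open>N\<close> whose coefficients of \<open>x\<close> generate
  \<open>lead_coeffs N A x\<close>.\<close>

lemma fg_submodule_noetherian:
  assumes noeth: "noetherian_ring R" and "finite A" and "A \<subseteq> carrier M"
    and "submodule N R M" and "N \<subseteq> module_span R M A"
  shows "\<exists>B\<subseteq>N. finite B \<and> module_span R M B = N"
  using assms(2-)
proof (induction A arbitrary: N)
  case empty
  then show ?case using span_least[of N "{}"] by (intro exI[of _ "{}"]) auto
next
  case (insert x A N)
  then have x: "x \<in> carrier M" and A: "A \<subseteq> carrier M" by auto
  note N = insert.prems(2) and S = span_submodule[OF A]
  note SE = submoduleE[OF S] and NE = submoduleE[OF N]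
  have "submodule (N \<inter> module_span R M A) R M" using submodule_inter[OF N S] .
  then obtain C where C: "C \<subseteq> N \<inter> module_span R M A" "finite C" "module_span R M C = N \<inter> module_span R M A"
    using insert.IH[OF A] by blast
  obtain B where B: "B \<subseteq> carrier R" "finite B" "lead_coeffs N A x = Idl B"
    using noetherian_ring.finetely_gen[OF noeth lead_coeffs_ideal[OF N A x]] by blast
  have "\<forall>b\<in>B. \<exists>s\<in>module_span R M A. b \<odot>\<^bsub>M\<^esub> x \<oplus>\<^bsub>M\<^esub> s \<in> N"
    using R.genideal_self[OF B(1)] B(3) by (auto simp: lead_coeffs_def)
  then obtain s where s: "\<And>b. b \<in> B \<Longrightarrow> s b \<in> module_span R M A \<and> b \<odot>\<^bsub>M\<^esub> x \<oplus>\<^bsub>M\<^esub> s b \<in> N"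
    by metis
  let ?D = "C \<union> (\<lambda>b. b \<odot>\<^bsub>M\<^esub> x \<oplus>\<^bsub>M\<^esub> s b) ` B"
  have DN: "?D \<subseteq> N" using C s by auto
  then have Dc: "?D \<subseteq> carrier M" using NE(1) by blast
  note D = span_submodule[OF Dc]
  have DsN: "module_span R M ?D \<subseteq> N" using span_least[OF N DN] .
  have "B \<subseteq> lead_coeffs (module_span R M ?D) A x"
  proof
    fix b assume b: "b \<in> B"
    then have "b \<odot>\<^bsub>M\<^esub> x \<oplus>\<^bsub>M\<^esub> s b \<in> module_span R M ?D" using span_incl[of ?D] by blast
    then show "b \<in> lead_coeffs (module_span R M ?D) A x"
      using b B(1) s by (auto simp: lead_coeffs_def)
  qed
  then have lead: "lead_coeffs N A x \<subseteq> lead_coeffs (module_span R M ?D) A x"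
    using R.genideal_minimal[OF lead_coeffs_ideal[OF D A x]] B(3) by simp
  have "N \<subseteq> module_span R M ?D"
  proof
    fix n assume n: "n \<in> N"
    then obtain r t where rt: "r \<in> carrier R" "t \<in> module_span R M A" "n = r \<odot>\<^bsub>M\<^esub> x \<oplus>\<^bsub>M\<^esub> t"
      using span_insertE[OF _ x A] insert.prems(3) by blast
    then have "r \<in> lead_coeffs N A x" using n by (auto simp: lead_coeffs_def)
    then obtain u where u: "u \<in> module_span R M A" "r \<odot>\<^bsub>M\<^esub> x \<oplus>\<^bsub>M\<^esub> u \<in> module_span R M ?D"
      using lead by (auto simp: lead_coeffs_def)
    have tu: "t \<in> carrier M" "u \<in> carrier M" using rt u SE(1) by auto
    \<comment> \<open>Subtracting an element of the span of \<open>?D\<close> with the same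
      coefficient \<open>r\<close> removes \<open>x\<close>; the difference lies in \<open>N\<close>
      and in the span of \<open>A\<close>, hence in the span of \<open>C\<close>.\<close>
    have n_eq: "n = (r \<odot>\<^bsub>M\<^esub> x \<oplus>\<^bsub>M\<^esub> u) \<oplus>\<^bsub>M\<^esub> (t \<ominus>\<^bsub>M\<^esub> u)"
      using rt(1,3) x tu by (simp add: a_minus_def M.a_ac M.r_neg2)
    have "t \<ominus>\<^bsub>M\<^esub> u = n \<ominus>\<^bsub>M\<^esub> (r \<odot>\<^bsub>M\<^esub> x \<oplus>\<^bsub>M\<^esub> u)"
      using rt(1,3) x tu by (simp add: a_minus_def M.a_ac M.minus_add M.r_neg M.r_neg2)
    then have "t \<ominus>\<^bsub>M\<^esub> u \<in> N" using submodule_minus[OF N n] u DsN by auto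
    then have "t \<ominus>\<^bsub>M\<^esub> u \<in> module_span R M C" using submodule_minus[OF S] rt u C by auto
    then have "t \<ominus>\<^bsub>M\<^esub> u \<in> module_span R M ?D" using span_mono[of C ?D] by auto
    from submoduleE(5)[OF D u(2) this] show "n \<in> module_span R M ?D" by (simp only: n_eq[symmetric])
  qed
  then show ?case using DN DsN C B by (intro exI[of _ ?D]) auto
qed

end

lemma linear_mapsD:
  assumes "f \<in> linear_maps R M N"
  shows "x \<in> carrier M \<Longrightarrow> f x \<in> carrier N"
    and "x \<in> carrier M \<Longrightarrow> y \<in> carrier M \<Longrightarrow> f (x \<oplus>\<^bsub>M\<^esub> y) = f x \<oplus>\<^bsub>N\<^esub> f y"
    and "a \<in> carrier R \<Longrightarrow> x \<in> carrier M \<Longrightarrow> f (a \<odot>\<^bsub>M\<^esub> x) = a \<odot>\<^bsub>N\<^esub> f x"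
  using assms by (auto simp: linear_maps_def hom_def)

lemma linear_maps_zero_minus:
  assumes f: "f \<in> linear_maps R M N" and M: "module R M" and N: "module R N"
  shows "f \<zero>\<^bsub>M\<^esub> = \<zero>\<^bsub>N\<^esub>" and "x \<in> carrier M \<Longrightarrow> f (\<ominus>\<^bsub>M\<^esub> x) = \<ominus>\<^bsub>N\<^esub> f x"
proof -
  interpret M: plain_module R M using M by (simp add: plain_module_def)
  interpret N: plain_module R N using N by (simp add: plain_module_def)
  interpret group_hom "add_monoid M" "add_monoid N" f
    using f by (unfold_locales) (auto simp: linear_maps_def hom_def)
  show "f \<zero>\<^bsub>M\<^esub> = \<zero>\<^bsub>N\<^esub>" using hom_one by simp
  show "x \<in> carrier M \<Longrightarrow> f (\<ominus>\<^bsub>M\<^esub> x) = \<ominus>\<^bsub>N\<^esub> f x" using hom_inv by (simp add: a_inv_def)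
qed

lemma linear_map_span:
  assumes f: "f \<in> linear_maps R M N" and M: "module R M" and N: "module R N"
    and A: "A \<subseteq> carrier M" and x: "x \<in> module_span R M A"
  shows "f x \<in> module_span R N (f ` A)"
proof -
  interpret M: plain_module R M using M by (simp add: plain_module_def)
  interpret N: plain_module R N using N by (simp add: plain_module_def)
  have "f ` A \<subseteq> carrier N" using A linear_mapsD(1)[OF f] by auto
  note S = N.span_submodule[OF this]
  note SE = N.submoduleE[OF S]
  have "submodule {x \<in> carrier M. f x \<in> module_span R N (f ` A)} R M"
    using linear_mapsD[OF f] linear_maps_zero_minus[OF f M N] SE N.submodule_zero[OF S]
    by (intro M.submoduleI) auto
  moreover have "A \<subseteq> {x \<in> carrier M. f x \<in> module_span R N (f ` A)}" using A N.span_incl by blast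
  ultimately show ?thesis using M.span_least x by blast
qed

section \<open>Leading coefficients\<close>

text \<open>What remains of the graphs for the Groebner argument: modules with a finite, totally
  ordered spanning family and a set \<open>T G G'\<close> of maps from \<open>M G\<close> to
  \<open>M G'\<close>. The direction is that of the pullbacks, opposite to the contractions.\<close>

locale filtered_family =
  fixes R :: "('r, 'x) ring_scheme"
    and Obj :: "'g set"
    and M :: "'g \<Rightarrow> ('r, 'm) module"
    and N :: "'g \<Rightarrow> 'm set"
    and T :: "'g \<Rightarrow> 'g \<Rightarrow> ('m \<Rightarrow> 'm) set"
    and Mon :: "'g \<Rightarrow> 'k set"
    and val :: "'g \<Rightarrow> 'k \<Rightarrow> 'm"
    and key :: "'g \<Rightarrow> 'k \<Rightarrow> 'o :: linorder"
  assumes noetherian: "noetherian_ring R"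
    and module_obj: "G \<in> Obj \<Longrightarrow> module R (M G)"
    and submodule_obj: "G \<in> Obj \<Longrightarrow> submodule (N G) R (M G)"
    and transition: "\<lbrakk>G \<in> Obj; G' \<in> Obj; f \<in> T G G'\<rbrakk> \<Longrightarrow>
      f \<in> linear_maps R (M G) (M G') \<and> f ` N G \<subseteq> N G'"
    and transition_id: "G \<in> Obj \<Longrightarrow> \<exists>f\<in>T G G. \<forall>x\<in>carrier (M G). f x = x"
    and finite_Mon: "G \<in> Obj \<Longrightarrow> finite (Mon G)"
    and val_carrier: "G \<in> Obj \<Longrightarrow> val G ` Mon G \<subseteq> carrier (M G)"
    and val_span: "G \<in> Obj \<Longrightarrow> module_span R (M G) (val G ` Mon G) = carrier (M G)"
    and key_inj: "G \<in> Obj \<Longrightarrow> inj_on (key G) (Mon G)"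
begin

definition lower :: "'g \<Rightarrow> 'k \<Rightarrow> 'k set" where
  "lower G \<mu> = {\<nu> \<in> Mon G. key G \<nu> < key G \<mu>}"

text \<open>The counterpart of divisibility of monomials in Groebner theory.\<close>

definition leads_to :: "'g \<times> 'k \<Rightarrow> 'g \<times> 'k \<Rightarrow> bool" where
  "leads_to p q \<longleftrightarrow> (\<exists>f\<in>T (fst p) (fst q). f (val (fst p) (snd p)) = val (fst q) (snd q) \<and>
     f ` val (fst p) ` lower (fst p) (snd p) \<subseteq> val (fst q) ` lower (fst q) (snd q))"

definition lead :: "'g \<times> 'k \<Rightarrow> 'r set" where
  "lead p = {r \<in> carrier R. \<exists>s\<in>module_span R (M (fst p)) (val (fst p) ` lower (fst p) (snd p)).
     r \<odot>\<^bsub>M (fst p)\<^esub> val (fst p) (snd p) \<oplus>\<^bsub>M (fst p)\<^esub> s \<in> N (fst p)}"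

lemma plain: "G \<in> Obj \<Longrightarrow> plain_module R (M G)"
  by (simp add: plain_module_def module_obj)

lemma val_mem: "\<lbrakk>G \<in> Obj; \<mu> \<in> Mon G\<rbrakk> \<Longrightarrow> val G \<mu> \<in> carrier (M G)"
  using val_carrier by blast

lemma lower_carrier: "G \<in> Obj \<Longrightarrow> val G ` lower G \<mu> \<subseteq> carrier (M G)"
  using val_carrier by (auto simp: lower_def)

lemma lead_ideal:
  assumes "p \<in> Sigma Obj Mon"
  shows "ideal (lead p) R"
proof -
  have O: "fst p \<in> Obj" and v: "val (fst p) (snd p) \<in> carrier (M (fst p))"
    using assms val_mem by auto
  interpret plain_module R "M (fst p)" using plain O .
  have "lead p = lead_coeffs (N (fst p)) (val (fst p) ` lower (fst p) (snd p)) (val (fst p) (snd p))"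
    by (simp add: lead_def lead_coeffs_def)
  then show ?thesis using lead_coeffs_ideal[OF submodule_obj[OF O] lower_carrier[OF O] v] by simp
qed

text \<open>The witness for \<open>r\<close> at \<open>p\<close> is pushed along the map that
  realizes \<open>leads_to p q\<close>. Besides the membership of \<open>r\<close> in
  \<open>lead q\<close>, the element \<open>y\<close> itself is kept, since it lives at
  \<open>fst p\<close>, which will be a generating object.\<close>

lemma transport:
  assumes p: "p \<in> Sigma Obj Mon" and q: "q \<in> Sigma Obj Mon" and "leads_to p q" and r: "r \<in> lead p"
  obtains f y s where "f \<in> T (fst p) (fst q)" and "y \<in> N (fst p)"
    and "s \<in> module_span R (M (fst q)) (val (fst q) ` lower (fst q) (snd q))"
    and "f y = r \<odot>\<^bsub>M (fst q)\<^esub> val (fst q) (snd q) \<oplus>\<^bsub>M (fst q)\<^esub> s" and "r \<in> carrier R"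
proof -
  have pO: "fst p \<in> Obj" and qO: "fst q \<in> Obj" using p q by auto
  interpret P: plain_module R "M (fst p)" using plain pO .
  interpret Q: plain_module R "M (fst q)" using plain qO .
  obtain f where f: "f \<in> T (fst p) (fst q)" "f (val (fst p) (snd p)) = val (fst q) (snd q)"
    "f ` val (fst p) ` lower (fst p) (snd p) \<subseteq> val (fst q) ` lower (fst q) (snd q)"
    using assms(3) by (auto simp: leads_to_def)
  have lin: "f \<in> linear_maps R (M (fst p)) (M (fst q))" using transition[OF pO qO f(1)] by blast
  obtain s where s: "r \<in> carrier R" "s \<in> module_span R (M (fst p)) (val (fst p) ` lower (fst p) (snd p))"
    "r \<odot>\<^bsub>M (fst p)\<^esub> val (fst p) (snd p) \<oplus>\<^bsub>M (fst p)\<^esub> s \<in> N (fst p)"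
    using r by (auto simp: lead_def)
  have v: "val (fst p) (snd p) \<in> carrier (M (fst p))" using val_mem p by auto
  have sc: "s \<in> carrier (M (fst p))"
    using P.submoduleE(1)[OF P.span_submodule[OF lower_carrier[OF pO]]] s(2) by blast
  have "f s \<in> module_span R (M (fst q)) (f ` val (fst p) ` lower (fst p) (snd p))"
    using linear_map_span[OF lin P.module_axioms Q.module_axioms lower_carrier[OF pO] s(2)] .
  then have "f s \<in> module_span R (M (fst q)) (val (fst q) ` lower (fst q) (snd q))"
    using Q.span_mono[OF f(3)] by blast
  moreover have "f (r \<odot>\<^bsub>M (fst p)\<^esub> val (fst p) (snd p) \<oplus>\<^bsub>M (fst p)\<^esub> s) =
      r \<odot>\<^bsub>M (fst q)\<^esub> val (fst q) (snd q) \<oplus>\<^bsub>M (fst q)\<^esub> f s"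
    using s(1) v sc f(2) by (simp add: linear_mapsD[OF lin])
  ultimately show thesis using that f(1) s(3,1) by blast
qed

lemma lead_mono:
  assumes "p \<in> Sigma Obj Mon" and "q \<in> Sigma Obj Mon" and "leads_to p q"
  shows "lead p \<subseteq> lead q"
proof
  fix r assume "r \<in> lead p"
  have O: "fst p \<in> Obj" "fst q \<in> Obj" using assms by auto
  from transport[OF assms \<open>r \<in> lead p\<close>] obtain f y s where fy: "f \<in> T (fst p) (fst q)" "y \<in> N (fst p)"
    "s \<in> module_span R (M (fst q)) (val (fst q) ` lower (fst q) (snd q))"
    "f y = r \<odot>\<^bsub>M (fst q)\<^esub> val (fst q) (snd q) \<oplus>\<^bsub>M (fst q)\<^esub> s" "r \<in> carrier R" .
  then have "f y \<in> N (fst q)" using transition[OF O fy(1)] by blast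
  then show "r \<in> lead q" using fy(3-5) unfolding lead_def by auto
qed

lemma leads_to_refl:
  assumes "p \<in> Sigma Obj Mon"
  shows "leads_to p p"
proof -
  have O: "fst p \<in> Obj" using assms by auto
  obtain f where f: "f \<in> T (fst p) (fst p)" "\<And>x. x \<in> carrier (M (fst p)) \<Longrightarrow> f x = x"
    using transition_id[OF O] by blast
  have "f ` val (fst p) ` lower (fst p) (snd p) = val (fst p) ` lower (fst p) (snd p)"
    using f(2) lower_carrier[OF O] by force
  moreover have "f (val (fst p) (snd p)) = val (fst p) (snd p)"
    using f(2) val_mem[OF O] assms by auto
  ultimately show ?thesis unfolding leads_to_def by (intro bexI[OF _ f(1)]) simp
qed

text \<open>Finitely many monomials lead to all others with equal ideals of leading coefficients,
  and their objects generate by reduction of leading terms. The conclusion quantifies over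
  submodules \<open>H\<close> of \<open>M G\<close> instead of naming a span, because the span will
  finally be taken inside \<open>N G\<close>, a different module record.\<close>

theorem finitely_many_generators:
  assumes af: "almost_full_on leads_to (Sigma Obj Mon)"
  shows "\<exists>\<G>\<subseteq>Obj. finite \<G> \<and> (\<forall>G\<in>Obj. \<forall>H. submodule H R (M G) \<longrightarrow>
     (\<forall>G'\<in>\<G>. \<forall>f\<in>T G' G. f ` N G' \<subseteq> H) \<longrightarrow> N G \<subseteq> H)"
proof -
  interpret noetherian_ring R by (rule noetherian)
  \<comment> \<open>Along a subsequence on which \<open>leads_to\<close> holds for all pairs the
    ideals increase, so two of them coincide by the ascending chain condition.\<close>
  have "almost_full_on (\<lambda>p q. leads_to p q \<and> lead p = lead q) (Sigma Obj Mon)"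
    unfolding almost_full_on_def
  proof (intro allI impI)
    fix p :: "nat \<Rightarrow> 'g \<times> 'k" assume "\<forall>i. p i \<in> Sigma Obj Mon"
    then have p: "\<And>i. p i \<in> Sigma Obj Mon" by simp
    from almost_full_on_subseq[OF af, of p, OF p] obtain h :: "nat \<Rightarrow> nat"
      where h: "strict_mono h" "\<And>i j. i < j \<Longrightarrow> leads_to (p (h i)) (p (h j))"
      by blast
    have "\<exists>i j. i < j \<and> lead (p (h i)) = lead (p (h j))"
      by (rule ideal_sequence_stable) (use lead_ideal[OF p] lead_mono[OF p p h(2)] in auto)
    then obtain i j where "i < j" "lead (p (h i)) = lead (p (h j))" by blast
    then show "good (\<lambda>p q. leads_to p q \<and> lead p = lead q) p"
      using h unfolding good_def strict_mono_def by blast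
  qed
  from almost_full_on_finite_basis[OF this] obtain F where F: "F \<subseteq> Sigma Obj Mon" "finite F"
    "\<And>q. q \<in> Sigma Obj Mon \<Longrightarrow> \<exists>p\<in>F. p = q \<or> leads_to p q \<and> lead p = lead q"
    by blast
  have basis: "\<exists>p\<in>F. leads_to p q \<and> lead p = lead q" if "q \<in> Sigma Obj Mon" for q
    using F(3)[OF that] leads_to_refl[OF that] by blast
  have "N G \<subseteq> H" if G: "G \<in> Obj" and H: "submodule H R (M G)"
    and gen: "\<And>G' f. \<lbrakk>G' \<in> fst ` F; f \<in> T G' G\<rbrakk> \<Longrightarrow> f ` N G' \<subseteq> H" for G H
  proof -
    interpret plain_module R "M G" using plain[OF G] .
    note HE = submoduleE[OF H] and NE = submoduleE[OF submodule_obj[OF G]]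
    \<comment> \<open>Induction over sets \<open>K\<close> of monomials closed under taking smaller
      ones; removing the largest monomial \<open>\<mu>\<close> leaves exactly
      \<open>lower G \<mu>\<close>, again such a set.\<close>
    have "N G \<inter> module_span R (M G) (val G ` K) \<subseteq> H"
      if "finite K" "K \<subseteq> Mon G" "\<And>\<mu> \<nu>. \<lbrakk>\<mu> \<in> K; \<nu> \<in> Mon G; key G \<nu> < key G \<mu>\<rbrakk> \<Longrightarrow> \<nu> \<in> K" for K
      using that
    proof (induction "card K" arbitrary: K)
      case 0
      then have "K = {}" by simp
      then show ?case using span_least[OF H, of "{}"] by auto
    next
      case (Suc n)
      then have "key G ` K \<noteq> {}" by auto
      then obtain \<mu> where \<mu>: "\<mu> \<in> K" "key G \<mu> = Max (key G ` K)"
        using Max_in[of "key G ` K"] Suc.prems(1) by fastforce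
      have max: "key G \<nu> \<le> key G \<mu>" if "\<nu> \<in> K" for \<nu> using \<mu>(2) Suc.prems(1) that by simp
      have \<mu>M: "(G, \<mu>) \<in> Sigma Obj Mon" using \<mu>(1) Suc.prems(2) G by auto
      have low: "K - {\<mu>} = lower G \<mu>"
      proof
        show "K - {\<mu>} \<subseteq> lower G \<mu>"
        proof
          fix \<nu> assume \<nu>: "\<nu> \<in> K - {\<mu>}"
          then have "key G \<nu> \<noteq> key G \<mu>"
            using key_inj[OF G] Suc.prems(2) \<mu>(1) by (metis Diff_iff inj_onD insertI1 subsetD)
          then show "\<nu> \<in> lower G \<mu>" using max[of \<nu>] \<nu> Suc.prems(2) by (auto simp: lower_def)
        qed
        show "lower G \<mu> \<subseteq> K - {\<mu>}" using Suc.prems(3)[OF \<mu>(1)] by (auto simp: lower_def)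
      qed
      have IH: "N G \<inter> module_span R (M G) (val G ` lower G \<mu>) \<subseteq> H"
      proof (rule Suc.hyps(1))
        show "n = card (lower G \<mu>)" using Suc.hyps(2) \<mu>(1) Suc.prems(1) low by (metis card_Diff_singleton diff_Suc_1)
        show "finite (lower G \<mu>)" using Suc.prems(1) low by (metis finite_Diff)
      qed (auto simp: lower_def)
      let ?S = "module_span R (M G) (val G ` lower G \<mu>)"
      note S = span_submodule[OF lower_carrier[OF G, of \<mu>]]
      have v: "val G \<mu> \<in> carrier (M G)" using val_mem[OF G] \<mu>M by auto
      show ?case
      proof
        fix x assume x: "x \<in> N G \<inter> module_span R (M G) (val G ` K)"
        have "val G ` K = insert (val G \<mu>) (val G ` lower G \<mu>)" using low \<mu>(1) by blast
        then obtain r s where rs: "r \<in> carrier R" "s \<in> ?S" "x = r \<odot>\<^bsub>M G\<^esub> val G \<mu> \<oplus>\<^bsub>M G\<^esub> s"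
          using span_insertE[OF _ v lower_carrier[OF G]] x by (metis IntD2)
        then have "r \<in> lead (G, \<mu>)" using x by (auto simp: lead_def)
        then obtain p where p: "p \<in> F" "leads_to p (G, \<mu>)" "r \<in> lead p" using basis[OF \<mu>M] by blast
        have pS: "p \<in> Sigma Obj Mon" using F(1) p(1) by blast
        from transport[OF pS \<mu>M p(2,3)] obtain f y t
          where t: "f \<in> T (fst p) G" "y \<in> N (fst p)" "t \<in> ?S"
            "f y = r \<odot>\<^bsub>M G\<^esub> val G \<mu> \<oplus>\<^bsub>M G\<^esub> t"
          by (metis fst_conv snd_conv)
        have pO: "fst p \<in> Obj" using p(1) F(1) by auto
        have fyH: "f y \<in> H" using gen[of "fst p" f] p(1) t(1,2) by blast
        have fyN: "f y \<in> N G" using transition[OF pO G t(1)] t(2) by blast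
        have c: "s \<in> carrier (M G)" "t \<in> carrier (M G)" using submoduleE(1)[OF S] rs t by auto
        \<comment> \<open>Reduction: \<open>f y\<close> has the same coefficient \<open>r\<close> at
          \<open>\<mu>\<close> as \<open>x\<close> and lies in \<open>H\<close> by hypothesis. The
          difference is an element of \<open>N G\<close> that involves only smaller
          monomials.\<close>
        have x_eq: "x = f y \<oplus>\<^bsub>M G\<^esub> (s \<ominus>\<^bsub>M G\<^esub> t)"
          using rs(1,3) t(4) v c by (simp add: a_minus_def M.a_ac M.r_neg2)
        have "s \<ominus>\<^bsub>M G\<^esub> t = x \<ominus>\<^bsub>M G\<^esub> f y"
          using rs(1,3) t(4) v c by (simp add: a_minus_def M.a_ac M.minus_add M.r_neg M.r_neg2)
        then have "s \<ominus>\<^bsub>M G\<^esub> t \<in> N G" using submodule_minus[OF submodule_obj[OF G]] x fyN by auto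
        moreover have "s \<ominus>\<^bsub>M G\<^esub> t \<in> ?S" using submodule_minus[OF S] rs t by auto
        ultimately have "s \<ominus>\<^bsub>M G\<^esub> t \<in> H" using IH by blast
        then show "x \<in> H" using x_eq HE(5)[OF fyH] by simp
      qed
    qed
    from this[of "Mon G"] show ?thesis
      using finite_Mon[OF G] val_span[OF G] NE(1) by auto
  qed
  moreover have "finite (fst ` F)" "fst ` F \<subseteq> Obj" using F by auto
  ultimately show ?thesis by (intro exI[of _ "fst ` F"]) blast
qed

end

section \<open>Submodules of finitely generated modules\<close>

lemma submodule_trans:
  fixes M :: "('r, 'm) module"
  assumes M: "module R M" and N: "submodule N R M" and K: "submodule K R (M\<lparr>carrier := N\<rparr>)"
  shows "submodule K R M"
proof -
  interpret module R M by fact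
  have "subgroup K ((add_monoid M)\<lparr>carrier := N\<rparr>)" using submodule.axioms(1)[OF K] by simp
  moreover have "subgroup N (add_monoid M)" using submodule.axioms(1)[OF N] .
  ultimately have "subgroup K (add_monoid M)"
    using group.incl_subgroup[of "add_monoid M" N K] M.a_group by blast
  then show ?thesis using submodule.smult_closed[OF K] by (auto simp: submodule_def submodule_axioms_def)
qed

text \<open>Inside \<open>N\<close>, \<open>module_span\<close> ranges over submodules of the
  restricted record. These are submodules of \<open>M\<close> as well, so it is enough to test
  submodules of \<open>M\<close>.\<close>

lemma span_restrict:
  fixes M :: "('r, 'm) module"
  assumes M: "module R M" and N: "submodule N R M" and A: "A \<subseteq> N"
    and least: "\<And>K. \<lbrakk>submodule K R M; A \<subseteq> K\<rbrakk> \<Longrightarrow> N \<subseteq> K"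
  shows "module_span R (M\<lparr>carrier := N\<rparr>) A = N"
proof
  have "module R (M\<lparr>carrier := N\<rparr>)" by (rule submodule.submodule_is_module[OF N M])
  then have "submodule N R (M\<lparr>carrier := N\<rparr>)" using module.carrier_is_submodule by fastforce
  then show "module_span R (M\<lparr>carrier := N\<rparr>) A \<subseteq> N" unfolding module_span_def using A by blast
  show "N \<subseteq> module_span R (M\<lparr>carrier := N\<rparr>) A"
    unfolding module_span_def using least submodule_trans[OF M N] by blast
qed

lemma fg_submodule:
  fixes M :: "('r, 'm) module"
  assumes noeth: "noetherian_ring R" and fg: "fg_module R M" and N: "submodule N R M"
  shows "fg_module R (M\<lparr>carrier := N\<rparr>)"
proof -
  have M: "module R M" using fg by (simp add: fg_module_def)
  interpret plain_module R M using M by (simp add: plain_module_def)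
  obtain A where A: "A \<subseteq> carrier M" "finite A" "module_span R M A = carrier M"
    using fg by (auto simp: fg_module_def)
  have "N \<subseteq> module_span R M A" using submoduleE(1)[OF N] A(3) by simp
  then obtain B where B: "B \<subseteq> N" "finite B" "module_span R M B = N"
    using fg_submodule_noetherian[OF noeth A(2,1) N] by blast
  have "module_span R (M\<lparr>carrier := N\<rparr>) B = N"
    by (rule span_restrict[OF M N B(1)]) (use span_least B(3) in blast)
  then show ?thesis
    unfolding fg_module_def using B(1,2) submodule.submodule_is_module[OF N M]
    by (auto intro!: exI[of _ B])
qed

text \<open>Each value \<open>M H\<close> at a generating graph has finitely many generators.
  Listing the pairs of a graph and a generator yields single elements \<open>m i\<close>, so that
  \<open>i\<close> and a contraction into \<open>H i\<close> determine one element and can serve as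
  a monomial.\<close>

lemma fg_graph_op_module_generators:
  fixes R :: "('r, 'x) ring_scheme" and M :: "('v, 'e, 'l) labeled_graph \<Rightarrow> ('r, 'm) module"
  assumes "fg_graph_op_module R S g M P"
  shows "\<exists>H m. \<exists>n :: nat. (\<forall>i<n. H i \<in> graph_obj g S \<and> m i \<in> carrier (M (H i))) \<and>
     (\<forall>G\<in>graph_obj g S. module_span R (M G)
        {P G (H i) \<phi> (m i) | i \<phi>. i < n \<and> \<phi> \<in> contractions G (H i)} = carrier (M G))"
proof -
  interpret fg_graph_op_module R S g M P by fact
  obtain \<G> where \<G>: "\<G> \<subseteq> graph_obj g S" "finite \<G>"
    and span: "\<And>G. G \<in> graph_obj g S \<Longrightarrow>
       module_span R (M G) (\<Union>H\<in>\<G>. \<Union>\<phi>\<in>contractions G H. P G H \<phi> ` carrier (M H)) = carrier (M G)"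
    using finitely_generated by blast
  have plain: "plain_module R (M G)" if "G \<in> graph_obj g S" for G :: "('v, 'e, 'l) labeled_graph"
    using fg_module_obj[OF that] by (simp add: plain_module_def fg_module_def)
  have "\<forall>H\<in>\<G>. \<exists>A\<subseteq>carrier (M H). finite A \<and> module_span R (M H) A = carrier (M H)"
    using fg_module_obj \<G>(1) unfolding fg_module_def by blast
  then obtain A where A: "\<And>H. H \<in> \<G> \<Longrightarrow> A H \<subseteq> carrier (M H)" "\<And>H. H \<in> \<G> \<Longrightarrow> finite (A H)"
    "\<And>H. H \<in> \<G> \<Longrightarrow> module_span R (M H) (A H) = carrier (M H)" by metis
  have "finite (Sigma \<G> A)" using \<G>(2) A(2) by blast
  then obtain bs where bs: "set bs = Sigma \<G> A" using finite_list by blast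
  let ?H = "\<lambda>i. fst (bs ! i)" and ?m = "\<lambda>i. snd (bs ! i)"
  have mem: "?H i \<in> \<G> \<and> ?m i \<in> A (?H i)" if "i < length bs" for i
    using nth_mem[OF that] bs by (metis SigmaE fst_conv snd_conv)
  have H: "?H i \<in> graph_obj g S" if "i < length bs" for i using mem[OF that] \<G>(1) by blast
  have m: "?m i \<in> carrier (M (?H i))" if "i < length bs" for i using mem[OF that] A(1) by blast
  show ?thesis
  proof (rule exI[of _ ?H], rule exI[of _ ?m], rule exI[of _ "length bs"], intro conjI allI impI ballI)
    show "?H i \<in> graph_obj g S" if "i < length bs" for i using H[OF that] .
    show "?m i \<in> carrier (M (?H i))" if "i < length bs" for i using m[OF that] .
    fix G :: "('v, 'e, 'l) labeled_graph" assume G: "G \<in> graph_obj g S"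
    interpret G: plain_module R "M G" by (rule plain[OF G])
    let ?B = "{P G (?H i) \<phi> (?m i) | i \<phi>. i < length bs \<and> \<phi> \<in> contractions G (?H i)}"
    have B: "?B \<subseteq> carrier (M G)"
      using linear_mapsD(1)[OF pullback_linear[OF G H]] m by blast
    note SB = G.span_submodule[OF B]
    have "(\<Union>H\<in>\<G>. \<Union>\<phi>\<in>contractions G H. P G H \<phi> ` carrier (M H)) \<subseteq> module_span R (M G) ?B"
    proof clarify
      fix K \<phi> x assume K: "K \<in> \<G>" and \<phi>: "\<phi> \<in> contractions G K" and x: "x \<in> carrier (M K)"
      have KO: "K \<in> graph_obj g S" using K \<G>(1) by blast
      interpret K: plain_module R "M K" by (rule plain[OF KO])
      have "P G K \<phi> x \<in> module_span R (M G) (P G K \<phi> ` A K)"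
        by (rule linear_map_span[OF pullback_linear[OF G KO \<phi>] K.module_axioms G.module_axioms A(1)[OF K]])
          (use A(3)[OF K] x in simp)
      moreover have "P G K \<phi> ` A K \<subseteq> ?B"
      proof clarify
        fix a assume "a \<in> A K"
        then have "(K, a) \<in> set bs" using bs K by blast
        then obtain i where "i < length bs" "bs ! i = (K, a)" by (metis in_set_conv_nth)
        then show "\<exists>i \<phi>'. P G K \<phi> a = P G (?H i) \<phi>' (?m i) \<and> i < length bs \<and> \<phi>' \<in> contractions G (?H i)"
          using \<phi> by (intro exI[of _ i] exI[of _ \<phi>]) simp
      qed
      ultimately show "P G K \<phi> x \<in> module_span R (M G) ?B" using G.span_mono by blast
    qed
    then have "carrier (M G) \<subseteq> module_span R (M G) ?B"
      using G.span_least[OF SB] span[OF G] by blast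
    then show "module_span R (M G) ?B = carrier (M G)" using G.submoduleE(1)[OF SB] by blast
  qed
qed

lemma fg_graph_op_submodule_generators:
  fixes R :: "('r, 'x) ring_scheme" and M :: "('v, 'e, 'l) labeled_graph \<Rightarrow> ('r, 'm) module"
  assumes noeth: "noetherian_ring R" and S: "finite S"
    and fg: "fg_graph_op_module R S g M P" and sub: "graph_op_submodule R S g M P N"
  shows "\<exists>\<G>\<subseteq>graph_obj g S. finite \<G> \<and> (\<forall>G\<in>graph_obj g S. \<forall>K. submodule K R (M G) \<longrightarrow>
     (\<forall>G'\<in>\<G>. \<forall>\<phi>\<in>contractions G G'. P G G' \<phi> ` N G' \<subseteq> K) \<longrightarrow> N G \<subseteq> K)"
proof -
  interpret fg_graph_op_module R S g M P by fact
  interpret graph_op_submodule R S g M P N by fact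
  obtain H m and n :: nat where Hm: "\<forall>i<n. H i \<in> graph_obj g S \<and> m i \<in> carrier (M (H i))"
    and span: "\<forall>G\<in>graph_obj g S. module_span R (M G)
        {P G (H i) \<phi> (m i) | i \<phi>. i < n \<and> \<phi> \<in> contractions G (H i)} = carrier (M G)"
    using fg_graph_op_module_generators[OF fg] by blast
  have H: "H i \<in> graph_obj g S" and m: "m i \<in> carrier (M (H i))" if "i < n" for i
    using Hm that by auto
  have "\<exists>q. rigidification G (fst q) (fst (snd q)) (snd (snd q))" if "G \<in> graph_obj g S"
    for G :: "('v, 'e, 'l) labeled_graph"
    using rigidification_exists[OF graph_objD(1)[OF that]] by auto
  then obtain q where rigid: "\<And>G :: ('v, 'e, 'l) labeled_graph. G \<in> graph_obj g S \<Longrightarrow>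
      rigidification G (fst (q G)) (fst (snd (q G))) (snd (snd (q G)))"
    by metis
  have "finite (\<Union>i<n. cells (H i))"
    using finite_graphD(1,2)[OF graph_objD(2)[OF H]] by (auto simp: cells_def)
  then obtain index :: "'v + 'e \<Rightarrow> nat" where index: "inj_on index (\<Union>i<n. cells (H i))"
    using finite_imp_inj_to_nat_seg by metis
  have "\<forall>i. \<exists>l. i < n \<longrightarrow> set l = edges (H i)"
    using finite_list finite_graphD(2)[OF graph_objD(2)[OF H]] by metis
  then obtain targets where targets: "\<And>i. i < n \<Longrightarrow> set (targets i) = edges (H i)" by metis
  interpret rigidified_system g S n H "\<lambda>G. fst (q G)" "\<lambda>G. fst (snd (q G))" "\<lambda>G. snd (snd (q G))" index targets
    by unfold_locales (use S H rigid index targets in auto)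
  define val where "val G \<mu> = P G (H (fst \<mu>)) (snd \<mu>) (m (fst \<mu>))" for G :: "('v, 'e, 'l) labeled_graph" and \<mu>
  define T where "T G G' = P G' G ` contractions G' G" for G G' :: "('v, 'e, 'l) labeled_graph"
  have val_image: "val G ` Mon G = {P G (H i) \<phi> (m i) | i \<phi>. i < n \<and> \<phi> \<in> contractions G (H i)}" for G
    unfolding val_def Mon_def by force
  interpret filtered_family R "graph_obj g S" M N T Mon val key
  proof (rule filtered_family.intro)
    fix G :: "('v, 'e, 'l) labeled_graph" assume G: "G \<in> graph_obj g S"
    show "module R (M G)" using fg_module_obj[OF G] by (simp add: fg_module_def)
    show "submodule (N G) R (M G)" by (rule submodule_obj[OF G])
    show "finite (Mon G)" by (rule finite_Mon[OF G])
    show "val G ` Mon G \<subseteq> carrier (M G)"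
      unfolding val_image using linear_mapsD(1)[OF pullback_linear[OF G H]] m by blast
    show "module_span R (M G) (val G ` Mon G) = carrier (M G)" unfolding val_image using span G by blast
    show "inj_on (key G) (Mon G)" by (rule key_inj[OF G])
    show "\<exists>f\<in>T G G. \<forall>x\<in>carrier (M G). f x = x"
      unfolding T_def using id_contraction[OF G] pullback_id[OF G] by blast
  next
    fix G G' :: "('v, 'e, 'l) labeled_graph" and f assume G: "G \<in> graph_obj g S" and G': "G' \<in> graph_obj g S" and "f \<in> T G G'"
    then show "f \<in> linear_maps R (M G) (M G') \<and> f ` N G \<subseteq> N G'"
      unfolding T_def using pullback_linear[OF G' G] pullback_closed[OF G' G] by blast
  qed (rule noeth)
  have leads: "leads_to q q'" if q: "q \<in> Sigma (graph_obj g S) Mon" and q': "q' \<in> Sigma (graph_obj g S) Mon"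
    and fac: "factors q q'" for q q'
  proof -
    obtain G i \<phi> where q_eq: "q = (G, i, \<phi>)" using prod_cases3 by blast
    obtain G' i' \<phi>' where q'_eq: "q' = (G', i', \<phi>')" using prod_cases3 by blast
    have G: "G \<in> graph_obj g S" "(i, \<phi>) \<in> Mon G" and G': "G' \<in> graph_obj g S" using q q' q_eq q'_eq by auto
    obtain \<psi> where \<psi>: "\<psi> \<in> contractions G' G" "\<phi>' = compose (cells G') \<phi> \<psi>" "i' = i"
      and low: "\<And>j \<nu>. \<lbrakk>(j, \<nu>) \<in> Mon G; key G (j, \<nu>) < key G (i, \<phi>)\<rbrakk> \<Longrightarrow>
        (j, compose (cells G') \<nu> \<psi>) \<in> Mon G' \<and> key G' (j, compose (cells G') \<nu> \<psi>) < key G' (i, \<phi>')"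
      using fac unfolding q_eq q'_eq factors_def by auto
    \<comment> \<open>Functoriality turns the factorization of contractions through
      \<open>\<psi>\<close> into transport of the values of monomials.\<close>
    have comp: "P G' G \<psi> (val G (j, \<nu>)) = val G' (j, compose (cells G') \<nu> \<psi>)" if "(j, \<nu>) \<in> Mon G" for j \<nu>
      using pullback_comp[OF G' G(1) H \<psi>(1) _ m] MonD(1,2)[OF G(1) that] by (simp add: val_def)
    have "P G' G \<psi> ` val G ` lower G (i, \<phi>) \<subseteq> val G' ` lower G' (i, \<phi>')"
    proof clarify
      fix j \<nu> assume "(j, \<nu>) \<in> lower G (i, \<phi>)"
      then have \<nu>: "(j, \<nu>) \<in> Mon G" "key G (j, \<nu>) < key G (i, \<phi>)" by (auto simp: lower_def)
      then have "(j, compose (cells G') \<nu> \<psi>) \<in> lower G' (i, \<phi>')" using low by (simp add: lower_def)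
      then show "P G' G \<psi> (val G (j, \<nu>)) \<in> val G' ` lower G' (i, \<phi>')" using comp[OF \<nu>(1)] by simp
    qed
    then show ?thesis
      unfolding q_eq q'_eq leads_to_def T_def using \<psi> comp[OF G(2)] by (auto intro!: bexI[of _ \<psi>])
  qed
  have "almost_full_on leads_to (Sigma (graph_obj g S) Mon)"
    using factors_almost_full leads unfolding almost_full_on_def good_def by metis
  from finitely_many_generators[OF this] show ?thesis unfolding T_def by (simp add: ball_simps)
qed

theorem theorem1p1:
  fixes R :: "('r, 'x) ring_scheme"
    and S :: "'r set set"
    and g :: nat
    and M :: "('v, 'e, 'r set) labeled_graph \<Rightarrow> ('r, 'm) module"
    and P :: "('v, 'e, 'r set) labeled_graph \<Rightarrow> ('v, 'e, 'r set) labeled_graph \<Rightarrow>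
                ('v + 'e \<Rightarrow> 'v + 'e) \<Rightarrow> 'm \<Rightarrow> 'm"
    and N :: "('v, 'e, 'r set) labeled_graph \<Rightarrow> 'm set"
  assumes "cring R" and "noetherian_ring R"
    and "finite S" and "\<And>I. I \<in> S \<Longrightarrow> ideal I R"
    and "fg_graph_op_module R S g M P"
    and "graph_op_submodule R S g M P N"
  shows "fg_graph_op_module R S g (\<lambda>G. (M G)\<lparr>carrier := N G\<rparr>) P"
proof -
  interpret fg_graph_op_module R S g M P by fact
  interpret graph_op_submodule R S g M P N by fact
  have module_obj: "module R (M G)" if "G \<in> graph_obj g S" for G :: "('v, 'e, 'r set) labeled_graph"
    using fg_module_obj[OF that] by (simp add: fg_module_def)
  have N_carrier: "N G \<subseteq> carrier (M G)" if "G \<in> graph_obj g S" for G :: "('v, 'e, 'r set) labeled_graph"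
    using module.submoduleE(1)[OF module_obj[OF that] submodule_obj[OF that]] .
  show ?thesis
  proof (unfold_locales)
    fix G :: "('v, 'e, 'r set) labeled_graph" assume G: "G \<in> graph_obj g S"
    show "fg_module R ((M G)\<lparr>carrier := N G\<rparr>)"
      by (rule fg_submodule[OF assms(2) fg_module_obj[OF G] submodule_obj[OF G]])
    show "P G G (\<lambda>c\<in>cells G. c) x = x" if "x \<in> carrier ((M G)\<lparr>carrier := N G\<rparr>)" for x
      using pullback_id[OF G] N_carrier[OF G] that by auto
  next
    fix G G' :: "('v, 'e, 'r set) labeled_graph" and \<phi> assume G: "G \<in> graph_obj g S" "G' \<in> graph_obj g S" "\<phi> \<in> contractions G G'"
    show "P G G' \<phi> \<in> linear_maps R ((M G')\<lparr>carrier := N G'\<rparr>) ((M G)\<lparr>carrier := N G\<rparr>)"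
      using linear_mapsD(2,3)[OF pullback_linear[OF G]] pullback_closed[OF G] N_carrier[OF G(2)]
      by (auto simp: linear_maps_def hom_def subset_iff)
  next
    fix G G' G'' :: "('v, 'e, 'r set) labeled_graph" and \<phi> \<psi> x
    assume G: "G \<in> graph_obj g S" "G' \<in> graph_obj g S" "G'' \<in> graph_obj g S" "\<phi> \<in> contractions G G'"
      "\<psi> \<in> contractions G' G''" and "x \<in> carrier ((M G'')\<lparr>carrier := N G''\<rparr>)"
    then show "P G G'' (compose (cells G) \<psi> \<phi>) x = P G G' \<phi> (P G' G'' \<psi> x)"
      using pullback_comp[OF G] N_carrier[OF G(3)] by auto
  next
    obtain \<G> where \<G>: "\<G> \<subseteq> graph_obj g S" "finite \<G>"
      and gen: "\<And>G K. \<lbrakk>G \<in> graph_obj g S; submodule K R (M G);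
        \<forall>G'\<in>\<G>. \<forall>\<phi>\<in>contractions G G'. P G G' \<phi> ` N G' \<subseteq> K\<rbrakk> \<Longrightarrow> N G \<subseteq> K"
      using fg_graph_op_submodule_generators[OF assms(2,3,5,6)] by meson
    have "module_span R ((M G)\<lparr>carrier := N G\<rparr>) (\<Union>H\<in>\<G>. \<Union>\<phi>\<in>contractions G H. P G H \<phi> ` N H) = N G"
      if G: "G \<in> graph_obj g S" for G :: "('v, 'e, 'r set) labeled_graph"
    proof (rule span_restrict[OF module_obj[OF G] submodule_obj[OF G]])
      show "(\<Union>H\<in>\<G>. \<Union>\<phi>\<in>contractions G H. P G H \<phi> ` N H) \<subseteq> N G"
        using pullback_closed[OF G] \<G>(1) by blast
      show "N G \<subseteq> K" if "submodule K R (M G)"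
        "(\<Union>H\<in>\<G>. \<Union>\<phi>\<in>contractions G H. P G H \<phi> ` N H) \<subseteq> K" for K
        by (rule gen[OF G that(1)]) (use that(2) in blast)
    qed
    then show "\<exists>\<G>\<subseteq>graph_obj g S. finite \<G> \<and> (\<forall>G\<in>graph_obj g S.
        module_span R ((M G)\<lparr>carrier := N G\<rparr>)
          (\<Union>H\<in>\<G>. \<Union>\<phi>\<in>contractions G H. P G H \<phi> ` carrier ((M H)\<lparr>carrier := N H\<rparr>))
        = carrier ((M G)\<lparr>carrier := N G\<rparr>))"
      using \<G> by (intro exI[of _ \<G>]) simp
  qed
qed

end
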